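(* Let $(R,\mathfrak m_R)$ and $(A,\mathfrak m_A)$ be complete Noetherian local rings, let $I\subset R$ be an ideal, and let $A\hookrightarrow R$ be an injective local homomorphism whose composition with the quotient map $R\twoheadrightarrow R/I$ is injective and makes $R/I$ a finitely generated $A$-module (so that $I+\mathfrak m_AR$ is $\mathfrak m_R$-primary). (C.1) Let $T\in\mathbb N$ be any integer with $\mathfrak m_R^T\subset\mathfrak m_R(I+\mathfrak m_AR)$. Then for any generators $f_1,\dots,f_c$ of $I$ and any $\epsilon_1,\dots,\epsilon_c\in\mathfrak m_R^T$, writing $\mathfrak b=(f_1+\epsilon_1,\dots,f_c+\epsilon_c)$: (i) the composition $A\to R\to R/\mathfrak b$ is module finite; (ii) if $M$ is a finitely generated $R$-module and $m_1,\dots,m_\mu\in M$, with $\mu=\mu_A(M/IM)$, are elements whose images in $M/IM$ are minimal $A$-module generators of $M/IM$, then the images of $m_1,\dots,m_\mu$ in $M/\mathfrak bM$ are a minimal $A$-generating set of $M/\mathfrak bM$. (C.2) Assume that $\mathrm{depth}_{\mathfrak m_A}(A)\ge1$ and that $M$ is a finitely generated $R$-module such that $d\,\mathbf H_1(I;M)=0$ for some $d\in A$ which is a non-zero-divisor in $A$. Let $m_1,\dots,m_n\in M$ be any elements such that the image of $N:=Am_1+\dots+Am_n$ in $M/IM$ is a free $A$-module of rank $n$. Then there is $T\in\mathbb N$ (depending only on $A\to R\to R/I$, $M$ and $N$) such that for all minimal generating sets $f_1,\dots,f_c$ of $I$ and all $\epsilon_1,\dots,\epsilon_c\in\mathfrak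 m_R^T$, the image of $N$ in $M/(f_1+\epsilon_1,\dots,f_c+\epsilon_c)M$ is a free $A$-module of rank $n$.
   Context: $R$-modules are regarded as $A$-modules via $A\hookrightarrow R$. $\mu_A(V)$ is the minimal number of generators of a finite $A$-module $V$. $\mathbf H_1(I;M)$ is the first homology of the Koszul complex $\mathbf K(f_1,\dots,f_c;M)$ on a minimal generating set of $I$ in $R$; up to isomorphism it does not depend on the choice. *)

theory Defs
  imports "HOL-Algebra.Ring_Divisibility" "HOL-Algebra.Module" "HOL-Algebra.Ideal_Product"
    "HOL-Algebra.QuotRing" "HOL-Library.Extended_Nat"
begin

abbreviation ideal_power :: "('a, 'x) ring_scheme \<Rightarrow> 'a set \<Rightarrow> nat \<Rightarrow> 'a set"
  where "ideal_power R J n \<equiv> J [^]\<^bsub>ideals_set R\<^esub> n"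

text \<open>The natural map from \<open>R\<close> to the inverse limit of the rings \<open>R/J\<^sup>n\<close> is bijective.
  A point of the limit is given by representatives \<open>x n\<close> of its components, so that existence
  of \<open>y\<close> is surjectivity and uniqueness is injectivity (separatedness).\<close>

definition adically_complete :: "('a, 'x) ring_scheme \<Rightarrow> 'a set \<Rightarrow> bool"
  where "adically_complete R J \<longleftrightarrow>
    (\<forall>x :: nat \<Rightarrow> 'a.
       (\<forall>n. x n \<in> carrier R \<and> x (Suc n) \<ominus>\<^bsub>R\<^esub> x n \<in> ideal_power R J n) \<longrightarrow>
       (\<exists>!y. y \<in> carrier R \<and> (\<forall>n. x n \<ominus>\<^bsub>R\<^esub> y \<in> ideal_power R J n)))"

locale complete_noetherian_local_ring =
  cring R + noetherian_ring R + maximalideal \<mm> R for R (structure) and \<mm> +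
  assumes maximalideal_unique: "maximalideal J R \<Longrightarrow> J = \<mm>"
    and complete: "adically_complete R \<mm>"

text \<open>A module is a record extending a ring record; the fields \<open>mult\<close> and \<open>one\<close> of a module
  carry no information and are never used.\<close>

definition ring_as_module :: "('a \<Rightarrow> 's) \<Rightarrow> ('s, 'x) ring_scheme \<Rightarrow> ('a, 's) module"
  where "ring_as_module \<phi> S =
    \<lparr>carrier = carrier S, monoid.mult = monoid.mult S, one = \<one>\<^bsub>S\<^esub>, zero = \<zero>\<^bsub>S\<^esub>, add = add S,
     smult = (\<lambda>a x. \<phi> a \<otimes>\<^bsub>S\<^esub> x)\<rparr>"

abbreviation self_module :: "('a, 'x) ring_scheme \<Rightarrow> ('a, 'a) module"
  where "self_module R \<equiv> ring_as_module (\<lambda>a. a) R"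

definition restrict_scalars :: "('a \<Rightarrow> 'r) \<Rightarrow> ('r, 'm, 'x) module_scheme \<Rightarrow> ('a, 'm) module"
  where "restrict_scalars \<phi> M =
    \<lparr>carrier = carrier M, monoid.mult = monoid.mult M, one = \<one>\<^bsub>M\<^esub>, zero = \<zero>\<^bsub>M\<^esub>, add = add M,
     smult = (\<lambda>a x. \<phi> a \<odot>\<^bsub>M\<^esub> x)\<rparr>"

definition quotient_module :: "('r, 'm, 'x) module_scheme \<Rightarrow> 'm set \<Rightarrow> ('r, 'm set) module"
  where "quotient_module M U =
    \<lparr>carrier = a_rcosets\<^bsub>M\<^esub> U, monoid.mult = (\<lambda>_ _. undefined), one = undefined,
     zero = U, add = set_add M,
     smult = (\<lambda>r X. \<Union>x\<in>X. U +>\<^bsub>M\<^esub> (r \<odot>\<^bsub>M\<^esub> x))\<rparr>"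

definition module_span ::
    "('r, 'y) ring_scheme \<Rightarrow> ('r, 'm, 'x) module_scheme \<Rightarrow> 'm set \<Rightarrow> 'm set"
  where "module_span R M S = \<Inter> {U. submodule U R M \<and> S \<subseteq> U}"

text \<open>The submodule \<open>JM\<close> of \<open>M\<close>.\<close>

definition ideal_smult ::
    "('r, 'y) ring_scheme \<Rightarrow> 'r set \<Rightarrow> ('r, 'm, 'x) module_scheme \<Rightarrow> 'm set"
  where "ideal_smult R J M = module_span R M {r \<odot>\<^bsub>M\<^esub> x | r x. r \<in> J \<and> x \<in> carrier M}"

definition fin_gen_module :: "('r, 'y) ring_scheme \<Rightarrow> ('r, 'm, 'x) module_scheme \<Rightarrow> bool"
  where "fin_gen_module R M \<longleftrightarrow> module R M \<and>
    (\<exists>S. finite S \<and> S \<subseteq> carrier M \<and> module_span R M S = carrier M)"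

definition module_finite :: "('a, 'y) ring_scheme \<Rightarrow> ('a \<Rightarrow> 's) \<Rightarrow> ('s, 'x) ring_scheme \<Rightarrow> bool"
  where "module_finite A \<phi> S \<longleftrightarrow> fin_gen_module A (ring_as_module \<phi> S)"

text \<open>Finite families are functions on \<open>{..<n}\<close>.  Minimality means that no proper subfamily
  generates; in particular a minimal family has no repetitions.\<close>

definition generating_family ::
    "('r, 'y) ring_scheme \<Rightarrow> ('r, 'm, 'x) module_scheme \<Rightarrow> nat \<Rightarrow> (nat \<Rightarrow> 'm) \<Rightarrow> bool"
  where "generating_family R M n x \<longleftrightarrow>
    x \<in> {..<n} \<rightarrow> carrier M \<and> module_span R M (x ` {..<n}) = carrier M"

definition minimal_generating_family ::
    "('r, 'y) ring_scheme \<Rightarrow> ('r, 'm, 'x) module_scheme \<Rightarrow> nat \<Rightarrow> (nat \<Rightarrow> 'm) \<Rightarrow> bool"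
  where "minimal_generating_family R M n x \<longleftrightarrow>
    generating_family R M n x \<and>
    (\<forall>K. K \<subset> {..<n} \<longrightarrow> module_span R M (x ` K) \<noteq> carrier M)"

definition min_num_generators :: "('r, 'y) ring_scheme \<Rightarrow> ('r, 'm, 'x) module_scheme \<Rightarrow> nat"
  where "min_num_generators R M = (LEAST n. \<exists>x. generating_family R M n x)"

definition ideal_generators ::
    "('r, 'y) ring_scheme \<Rightarrow> 'r set \<Rightarrow> nat \<Rightarrow> (nat \<Rightarrow> 'r) \<Rightarrow> bool"
  where "ideal_generators R J c f \<longleftrightarrow>
    f \<in> {..<c} \<rightarrow> carrier R \<and> Idl\<^bsub>R\<^esub> (f ` {..<c}) = J"

definition minimal_ideal_generators ::
    "('r, 'y) ring_scheme \<Rightarrow> 'r set \<Rightarrow> nat \<Rightarrow> (nat \<Rightarrow> 'r) \<Rightarrow> bool"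
  where "minimal_ideal_generators R J c f \<longleftrightarrow>
    ideal_generators R J c f \<and> (\<forall>K. K \<subset> {..<c} \<longrightarrow> Idl\<^bsub>R\<^esub> (f ` K) \<noteq> J)"

definition free_of_rank :: "('r, 'y) ring_scheme \<Rightarrow> ('r, 'm, 'x) module_scheme \<Rightarrow> nat \<Rightarrow> bool"
  where "free_of_rank R V n \<longleftrightarrow>
    (\<exists>b \<in> {..<n} \<rightarrow> carrier V.
       bij_betw (\<lambda>a. \<Oplus>\<^bsub>V\<^esub>i\<in>{..<n}. a i \<odot>\<^bsub>V\<^esub> b i) ({..<n} \<rightarrow>\<^sub>E carrier R) (carrier V))"

definition nonzerodivisor_on :: "('r, 'm, 'x) module_scheme \<Rightarrow> 'r \<Rightarrow> bool"
  where "nonzerodivisor_on M r \<longleftrightarrow> (\<forall>x\<in>carrier M. r \<odot>\<^bsub>M\<^esub> x = \<zero>\<^bsub>M\<^esub> \<longrightarrow> x = \<zero>\<^bsub>M\<^esub>)"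

definition regular_sequence ::
    "('r, 'y) ring_scheme \<Rightarrow> ('r, 'm, 'x) module_scheme \<Rightarrow> 'r list \<Rightarrow> bool"
  where "regular_sequence R M xs \<longleftrightarrow>
    set xs \<subseteq> carrier R \<and>
    (\<forall>i<length xs. nonzerodivisor_on
       (quotient_module M (ideal_smult R (Idl\<^bsub>R\<^esub> (set (take i xs))) M)) (xs ! i)) \<and>
    ideal_smult R (Idl\<^bsub>R\<^esub> (set xs)) M \<noteq> carrier M"

definition depth ::
    "('r, 'y) ring_scheme \<Rightarrow> 'r set \<Rightarrow> ('r, 'm, 'x) module_scheme \<Rightarrow> enat"
  where "depth R J M =
    (if ideal_smult R J M = carrier M then \<infinity>
     else (SUP xs \<in> {xs. set xs \<subseteq> J \<and> regular_sequence R M xs}. enat (length xs)))"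

text \<open>The Koszul complex \<open>K(f 0, \<dots>, f (c - 1); M)\<close>: an element of degree \<open>p\<close> is written
  \<open>\<Sum>K. x K e\<^sub>K\<close> with \<open>K\<close> ranging over the \<open>p\<close>-element subsets of \<open>{..<c}\<close>, and
  \<open>e\<^sub>K\<close> is mapped to the sum over \<open>i \<in> K\<close> of
  \<open>(-1)\<^sup>s f i e\<^bsub>K - {i}\<^esub>\<close>, where \<open>s\<close> is the number of \<open>j \<in> K\<close> with \<open>j < i\<close>.\<close>

definition koszul_index :: "nat \<Rightarrow> nat \<Rightarrow> nat set set"
  where "koszul_index c p = {K. K \<subseteq> {..<c} \<and> card K = p}"

definition koszul_module ::
    "nat \<Rightarrow> ('r, 'm, 'x) module_scheme \<Rightarrow> nat \<Rightarrow> ('r, nat set \<Rightarrow> 'm) module"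
  where "koszul_module c M p =
    \<lparr>carrier = koszul_index c p \<rightarrow>\<^sub>E carrier M,
     monoid.mult = (\<lambda>_ _. undefined), one = undefined,
     zero = (\<lambda>K\<in>koszul_index c p. \<zero>\<^bsub>M\<^esub>),
     add = (\<lambda>x y. \<lambda>K\<in>koszul_index c p. x K \<oplus>\<^bsub>M\<^esub> y K),
     smult = (\<lambda>r x. \<lambda>K\<in>koszul_index c p. r \<odot>\<^bsub>M\<^esub> x K)\<rparr>"

text \<open>The differential from degree \<open>p + 1\<close> to degree \<open>p\<close>.\<close>

definition koszul_diff ::
    "nat \<Rightarrow> (nat \<Rightarrow> 'r) \<Rightarrow> ('r, 'm, 'x) module_scheme \<Rightarrow> nat \<Rightarrow> (nat set \<Rightarrow> 'm) \<Rightarrow> nat set \<Rightarrow> 'm"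
  where "koszul_diff c f M p x = (\<lambda>J\<in>koszul_index c p.
    \<Oplus>\<^bsub>M\<^esub>i\<in>{..<c} - J.
      (if even (card {j\<in>J. j < i}) then f i \<odot>\<^bsub>M\<^esub> x (insert i J)
       else \<ominus>\<^bsub>M\<^esub> (f i \<odot>\<^bsub>M\<^esub> x (insert i J))))"

definition koszul_cycles ::
    "nat \<Rightarrow> (nat \<Rightarrow> 'r) \<Rightarrow> ('r, 'm, 'x) module_scheme \<Rightarrow> nat \<Rightarrow> (nat set \<Rightarrow> 'm) set"
  where "koszul_cycles c f M p =
    (case p of
       0 \<Rightarrow> carrier (koszul_module c M 0)
     | Suc q \<Rightarrow> {x \<in> carrier (koszul_module c M (Suc q)).
                  koszul_diff c f M q x = \<zero>\<^bsub>koszul_module c M q\<^esub>})"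

definition koszul_boundaries ::
    "nat \<Rightarrow> (nat \<Rightarrow> 'r) \<Rightarrow> ('r, 'm, 'x) module_scheme \<Rightarrow> nat \<Rightarrow> (nat set \<Rightarrow> 'm) set"
  where "koszul_boundaries c f M p = koszul_diff c f M p ` carrier (koszul_module c M (Suc p))"

definition koszul_homology ::
    "nat \<Rightarrow> (nat \<Rightarrow> 'r) \<Rightarrow> ('r, 'm, 'x) module_scheme \<Rightarrow> nat \<Rightarrow> ('r, (nat set \<Rightarrow> 'm) set) module"
  where "koszul_homology c f M p =
    quotient_module ((koszul_module c M p)\<lparr>carrier := koszul_cycles c f M p\<rparr>)
      (koszul_boundaries c f M p)"

text \<open>Annihilation of \<open>H\<^sub>1(J; M)\<close>. The homology module does not depend, up to isomorphism,
  on the minimal generating set of \<open>J\<close>, so it is computed from any one of them.\<close>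

definition annihilates_koszul_H1 ::
    "('r, 'y) ring_scheme \<Rightarrow> 'r set \<Rightarrow> ('r, 'm, 'x) module_scheme \<Rightarrow> 'r \<Rightarrow> bool"
  where "annihilates_koszul_H1 R J M r \<longleftrightarrow>
    (\<exists>c g. minimal_ideal_generators R J c g \<and>
       (\<forall>x\<in>carrier (koszul_homology c g M 1).
          r \<odot>\<^bsub>koszul_homology c g M 1\<^esub> x = \<zero>\<^bsub>koszul_homology c g M 1\<^esub>))"

definition perturbed_ideal ::
    "('r, 'y) ring_scheme \<Rightarrow> nat \<Rightarrow> (nat \<Rightarrow> 'r) \<Rightarrow> (nat \<Rightarrow> 'r) \<Rightarrow> 'r set"
  where "perturbed_ideal R c f \<epsilon> = Idl\<^bsub>R\<^esub> ((\<lambda>i. f i \<oplus>\<^bsub>R\<^esub> \<epsilon> i) ` {..<c})"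

definition reduction_map ::
    "('r, 'y) ring_scheme \<Rightarrow> ('r, 'm, 'x) module_scheme \<Rightarrow> 'r set \<Rightarrow> 'm \<Rightarrow> 'm set"
  where "reduction_map R M J x = ideal_smult R J M +>\<^bsub>M\<^esub> x"

text \<open>\<open>M/JM\<close> as a module over the source of \<open>h\<close>, whose target is \<open>R\<close>.\<close>

definition reduction ::
    "('a \<Rightarrow> 'r) \<Rightarrow> ('r, 'y) ring_scheme \<Rightarrow> ('r, 'm, 'x) module_scheme \<Rightarrow> 'r set \<Rightarrow> ('a, 'm set) module"
  where "reduction h R M J = restrict_scalars h (quotient_module M (ideal_smult R J M))"

end

(*
Nakayama's lemma gives b + m_A R = I + m_A R. Hence generators of M/IM over A generate
M/(b + m_A R)M, and by completeness of A together with Krull's intersection theorem in M/bM they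
generate M/bM; the argument is symmetric in I and b, which yields minimality.

For the freeness statement put J = I + m_A R, F = f + eps, and let u in N be equal to sum_i F_i y_i
with all y_i in J^s M. As the image of N in M/IM is free, N meets IM trivially, and the Artin-Rees
lemma gives sum_i f_i y_i = sum_i f_i y'_i with the y'_i much deeper than the y_i. Then y - y' is a
Koszul cycle for f, so d (y - y') is a boundary, again of controlled depth, and replacing the
boundary for f by the one for F shows that d u = sum_i F_i y''_i with y''_i in J^(s + C) M, where the
gain C is as large as we like if T is large. Iterating, d^j u lies in m_A^(j C - const) N for all j.
By Artin-Rees, dividing by the non-zero-divisor d costs only a constant e depending on d, so for
C > e the element u lies in every m_A^j N and vanishes by Krull's theorem. *)

theory Submission
  imports Defs
begin


section \<open>Submodules and chain conditions\<close>

text \<open>Two obstacles shape the freeness part. One exponent T must serve every minimal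
  generating set of I, whereas d H_1 = 0 is given for a single set g. The estimate is therefore made
  for g alone, and a perturbation (f + eps) of another minimal set is rewritten as (g + eps') with
  eps' still in m_R^T. Moreover the cycle y - y' need not be a boundary, so depth is gained for d u
  and not for u. Coefficients cannot be divided by d, only elements of N can; all divisions are
  postponed to the end, and a round gains exactly one more than a division costs. At the start of a
  round, u becomes deep in N because J acts on M/IM through m_A and M/IM is finite over A; this
  makes sum_i f_i y_i deep in M. In the first part M/bM is not known beforehand to be finite over A.
  Completeness replaces that knowledge: the coefficients with respect to the generators are limits
  in A. The arguments take place between two submodules U and W of M instead of in W/U, so that M/IM
  and M/bM can be compared inside M.\<close>

context module
begin

lemma submoduleI':
  assumes "H \<subseteq> carrier M" "\<zero>\<^bsub>M\<^esub> \<in> H"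
    and "\<And>a b. \<lbrakk>a \<in> H; b \<in> H\<rbrakk> \<Longrightarrow> a \<oplus>\<^bsub>M\<^esub> b \<in> H"
    and "\<And>a x. \<lbrakk>a \<in> carrier R; x \<in> H\<rbrakk> \<Longrightarrow> a \<odot>\<^bsub>M\<^esub> x \<in> H"
  shows "submodule H R M"
proof (rule submoduleI)
  fix a assume "a \<in> H"
  then show "\<ominus>\<^bsub>M\<^esub> a \<in> H"
    using assms(4)[of "\<ominus> \<one>" a] assms(1) smult_l_minus[of \<one> a] by auto
qed (use assms in auto)

lemma submodule_carrier: "\<lbrakk>submodule H R M; x \<in> H\<rbrakk> \<Longrightarrow> x \<in> carrier M"
  using submoduleE(1) by blast

lemma submodule_zero: "submodule H R M \<Longrightarrow> \<zero>\<^bsub>M\<^esub> \<in> H"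
  using submodule.axioms(1) subgroup.one_closed by fastforce

lemmas submodule_add = submoduleE(5) and submodule_smult = submoduleE(4) and submodule_neg = submoduleE(3)

lemma submodule_minus: "\<lbrakk>submodule H R M; x \<in> H; y \<in> H\<rbrakk> \<Longrightarrow> x \<ominus>\<^bsub>M\<^esub> y \<in> H"
  by (simp add: M.minus_eq submodule_add submodule_neg)

lemmas submodule_intros = submodule_carrier submodule_zero submodule_add submodule_smult submodule_minus

lemma minus_cancel:
  assumes "x \<in> carrier M" "y \<in> carrier M"
  shows "y \<oplus>\<^bsub>M\<^esub> (x \<ominus>\<^bsub>M\<^esub> y) = x" "(x \<ominus>\<^bsub>M\<^esub> y) \<oplus>\<^bsub>M\<^esub> y = x" "(x \<oplus>\<^bsub>M\<^esub> y) \<ominus>\<^bsub>M\<^esub> y = x"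
    "(y \<oplus>\<^bsub>M\<^esub> x) \<ominus>\<^bsub>M\<^esub> y = x"
  using assms by (simp_all add: M.minus_eq M.a_ac M.r_neg M.r_neg1 M.r_neg2 M.l_neg)

lemma smult_minus_distr:
  assumes "r \<in> carrier R" "x \<in> carrier M" "y \<in> carrier M"
  shows "r \<odot>\<^bsub>M\<^esub> (x \<ominus>\<^bsub>M\<^esub> y) = r \<odot>\<^bsub>M\<^esub> x \<ominus>\<^bsub>M\<^esub> r \<odot>\<^bsub>M\<^esub> y"
  using assms by (simp add: M.minus_eq smult_r_distr smult_r_minus)

lemma submodule_mem_cancel:
  assumes "submodule H R M" "x \<in> carrier M" "y \<in> H" "x \<oplus>\<^bsub>M\<^esub> y \<in> H"
  shows "x \<in> H"
  using submodule_minus[OF assms(1,4,3)] assms(2) minus_cancel(3)[of x y] submodule_carrier[OF assms(1,3)] by simp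

lemma submodule_mem_cancel':
  assumes "submodule H R M" "x \<in> carrier M" "y \<in> H" "x \<ominus>\<^bsub>M\<^esub> y \<in> H"
  shows "x \<in> H"
  using submodule_add[OF assms(1,4,3)] assms(2) minus_cancel(2)[of x y] submodule_carrier[OF assms(1,3)] by simp

lemma zero_submodule: "submodule {\<zero>\<^bsub>M\<^esub>} R M"
  by (rule submoduleI') auto

lemma submodule_Inter:
  assumes "\<And>k. submodule (C k) R M"
  shows "submodule (\<Inter>k. C k) R M"
  by (rule submoduleI') (auto intro: submodule_intros[OF assms])

lemma submodule_Int:
  assumes "submodule U R M" "submodule V R M"
  shows "submodule (U \<inter> V) R M"
  by (rule submoduleI') (auto intro: submodule_intros[OF assms(1)] submodule_intros[OF assms(2)])

definition msum :: "'c set \<Rightarrow> 'c set \<Rightarrow> 'c set"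
  where "msum U V = {u \<oplus>\<^bsub>M\<^esub> v | u v. u \<in> U \<and> v \<in> V}"

lemma msumI: "\<lbrakk>u \<in> U; v \<in> V; x = u \<oplus>\<^bsub>M\<^esub> v\<rbrakk> \<Longrightarrow> x \<in> msum U V"
  by (auto simp: msum_def)

lemma msumE: "\<lbrakk>x \<in> msum U V; \<And>u v. \<lbrakk>u \<in> U; v \<in> V; x = u \<oplus>\<^bsub>M\<^esub> v\<rbrakk> \<Longrightarrow> P\<rbrakk> \<Longrightarrow> P"
  by (auto simp: msum_def)

lemma add_interchange:
  assumes "a \<in> carrier M" "b \<in> carrier M" "c \<in> carrier M" "d \<in> carrier M"
  shows "(a \<oplus>\<^bsub>M\<^esub> b) \<oplus>\<^bsub>M\<^esub> (c \<oplus>\<^bsub>M\<^esub> d) = (a \<oplus>\<^bsub>M\<^esub> c) \<oplus>\<^bsub>M\<^esub> (b \<oplus>\<^bsub>M\<^esub> d)"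
  using assms by (simp add: M.a_ac)

lemma minus_interchange:
  assumes "a \<in> carrier M" "b \<in> carrier M" "c \<in> carrier M" "d \<in> carrier M"
  shows "(a \<oplus>\<^bsub>M\<^esub> b) \<ominus>\<^bsub>M\<^esub> (c \<oplus>\<^bsub>M\<^esub> d) = (a \<ominus>\<^bsub>M\<^esub> c) \<oplus>\<^bsub>M\<^esub> (b \<ominus>\<^bsub>M\<^esub> d)"
  using assms by (simp add: M.minus_eq M.minus_add M.a_ac)

lemma msum_submodule:
  assumes U: "submodule U R M" and V: "submodule V R M"
  shows "submodule (msum U V) R M"
proof (rule submoduleI')
  show "msum U V \<subseteq> carrier M"
    using submodule_carrier[OF U] submodule_carrier[OF V] by (auto elim!: msumE)
  show "\<zero>\<^bsub>M\<^esub> \<in> msum U V"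
    using submodule_zero[OF U] submodule_zero[OF V] by (auto intro!: msumI[of "\<zero>\<^bsub>M\<^esub>" _ "\<zero>\<^bsub>M\<^esub>"])
next
  fix a b assume "a \<in> msum U V" "b \<in> msum U V"
  then obtain u v u' v' where *: "u \<in> U" "v \<in> V" "a = u \<oplus>\<^bsub>M\<^esub> v" "u' \<in> U" "v' \<in> V" "b = u' \<oplus>\<^bsub>M\<^esub> v'"
    by (auto elim!: msumE)
  then have "a \<oplus>\<^bsub>M\<^esub> b = (u \<oplus>\<^bsub>M\<^esub> u') \<oplus>\<^bsub>M\<^esub> (v \<oplus>\<^bsub>M\<^esub> v')"
    using submodule_carrier[OF U] submodule_carrier[OF V] by (simp add: add_interchange)
  with * show "a \<oplus>\<^bsub>M\<^esub> b \<in> msum U V"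
    using submodule_add[OF U] submodule_add[OF V] by (intro msumI) auto
next
  fix a x assume a: "a \<in> carrier R" "x \<in> msum U V"
  then obtain u v where *: "u \<in> U" "v \<in> V" "x = u \<oplus>\<^bsub>M\<^esub> v"
    by (auto elim!: msumE)
  then have "a \<odot>\<^bsub>M\<^esub> x = a \<odot>\<^bsub>M\<^esub> u \<oplus>\<^bsub>M\<^esub> a \<odot>\<^bsub>M\<^esub> v"
    using a submodule_carrier[OF U] submodule_carrier[OF V] by (simp add: smult_r_distr)
  with * show "a \<odot>\<^bsub>M\<^esub> x \<in> msum U V"
    using a submodule_smult[OF U] submodule_smult[OF V] by (intro msumI) auto
qed

lemma msum_upper:
  assumes U: "submodule U R M" and V: "submodule V R M"
  shows "U \<subseteq> msum U V" "V \<subseteq> msum U V"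
  using submodule_zero[OF U] submodule_zero[OF V] submodule_carrier[OF U] submodule_carrier[OF V]
  by (auto intro: msumI[of _ _ "\<zero>\<^bsub>M\<^esub>"] msumI[of "\<zero>\<^bsub>M\<^esub>"])

lemma msum_least:
  assumes "submodule B R M" "U \<subseteq> B" "V \<subseteq> B"
  shows "msum U V \<subseteq> B"
  using assms submodule_add by (fastforce elim!: msumE)

lemma cyclic_submodule:
  assumes "x \<in> carrier M"
  shows "submodule {r \<odot>\<^bsub>M\<^esub> x | r. r \<in> carrier R} R M"
proof (rule submoduleI')
  show "\<zero>\<^bsub>M\<^esub> \<in> {r \<odot>\<^bsub>M\<^esub> x |r. r \<in> carrier R}"
    using assms by (auto intro!: exI[of _ \<zero>])
  fix a b assume "a \<in> {r \<odot>\<^bsub>M\<^esub> x |r. r \<in> carrier R}" "b \<in> {r \<odot>\<^bsub>M\<^esub> x |r. r \<in> carrier R}"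
  then show "a \<oplus>\<^bsub>M\<^esub> b \<in> {r \<odot>\<^bsub>M\<^esub> x |r. r \<in> carrier R}"
    using assms smult_l_distr[symmetric] by (auto intro!: R.a_closed)
next
  fix a b assume "a \<in> carrier R" "b \<in> {r \<odot>\<^bsub>M\<^esub> x |r. r \<in> carrier R}"
  then show "a \<odot>\<^bsub>M\<^esub> b \<in> {r \<odot>\<^bsub>M\<^esub> x |r. r \<in> carrier R}"
    using assms smult_assoc1[symmetric] by (auto intro!: R.m_closed)
qed (use assms in auto)

lemma span_submodule:
  assumes "S \<subseteq> carrier M"
  shows "submodule (module_span R M S) R M"
proof (rule submoduleI')
  show "module_span R M S \<subseteq> carrier M"
    using assms carrier_is_submodule by (auto simp: module_span_def)
qed (auto simp: module_span_def intro: submodule_intros)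

lemma span_superset: "S \<subseteq> module_span R M S"
  by (auto simp: module_span_def)

lemma span_least: "\<lbrakk>submodule U R M; S \<subseteq> U\<rbrakk> \<Longrightarrow> module_span R M S \<subseteq> U"
  by (auto simp: module_span_def)

lemma span_empty: "module_span R M {} = {\<zero>\<^bsub>M\<^esub>}"
  using span_least[OF zero_submodule, of "{}"] submodule_zero[OF span_submodule[of "{}"]] by auto

lemma span_insert:
  assumes "x \<in> carrier M" "S \<subseteq> carrier M"
  shows "module_span R M (insert x S) = msum {r \<odot>\<^bsub>M\<^esub> x | r. r \<in> carrier R} (module_span R M S)"
proof
  note s = msum_submodule[OF cyclic_submodule[OF assms(1)] span_submodule[OF assms(2)]]
  note u = msum_upper[OF cyclic_submodule[OF assms(1)] span_submodule[OF assms(2)]]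
  have "x \<in> {r \<odot>\<^bsub>M\<^esub> x | r. r \<in> carrier R}"
    using assms by (auto intro!: exI[of _ \<one>])
  then show "module_span R M (insert x S) \<subseteq> msum {r \<odot>\<^bsub>M\<^esub> x | r. r \<in> carrier R} (module_span R M S)"
    using u span_superset by (intro span_least[OF s]) blast
  have i: "submodule (module_span R M (insert x S)) R M"
    using assms span_submodule by simp
  show "msum {r \<odot>\<^bsub>M\<^esub> x | r. r \<in> carrier R} (module_span R M S) \<subseteq> module_span R M (insert x S)"
  proof (rule msum_least[OF i])
    show "{r \<odot>\<^bsub>M\<^esub> x |r. r \<in> carrier R} \<subseteq> module_span R M (insert x S)"
      using submodule_smult[OF i] span_superset by blast
    show "module_span R M S \<subseteq> module_span R M (insert x S)"
      using span_superset by (intro span_least[OF i]) blast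
  qed
qed

text \<open>This is the ascending chain condition for W/U, stated for submodules of \<open>M\<close>
  so that the quotient need not be formed. Later arguments carry a lower bound \<open>U\<close> in
  the same way; for instance U = IM lets M/IM be treated as an A-module while its elements stay in
  \<open>M\<close>.\<close>

definition noeth_between :: "'c set \<Rightarrow> 'c set \<Rightarrow> bool"
  where "noeth_between U W \<longleftrightarrow> submodule U R M \<and> submodule W R M \<and> U \<subseteq> W \<and>
    (\<forall>C. (\<forall>k. submodule (C k) R M \<and> U \<subseteq> C k \<and> C k \<subseteq> W \<and> C k \<subseteq> C (Suc k)) \<longrightarrow>
      (\<exists>p::nat. \<forall>k\<ge>p. C k = C p))"

lemma noeth_betweenD:
  assumes "noeth_between U W"
  shows "submodule U R M" "submodule W R M" "U \<subseteq> W"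
  using assms by (auto simp: noeth_between_def)

lemma noeth_between_chain:
  assumes "noeth_between U W"
    and "\<And>k. submodule (C k) R M" "\<And>k. U \<subseteq> C k" "\<And>k. C k \<subseteq> W" "\<And>k. C k \<subseteq> C (Suc k)"
  obtains p :: nat where "\<And>k. k \<ge> p \<Longrightarrow> C k = C p"
  using assms unfolding noeth_between_def by meson

lemma noeth_between_mono:
  assumes "noeth_between U W" "submodule U' R M" "submodule W' R M" "U \<subseteq> U'" "U' \<subseteq> W'" "W' \<subseteq> W"
  shows "noeth_between U' W'"
proof -
  have "\<exists>p. \<forall>k\<ge>p. C k = C p"
    if "\<And>k. submodule (C k) R M \<and> U' \<subseteq> C k \<and> C k \<subseteq> W' \<and> C k \<subseteq> C (Suc k)" for C :: "nat \<Rightarrow> _"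
    using noeth_between_chain[OF assms(1), of C] that assms(4,6) by (meson subset_trans)
  with assms show ?thesis by (auto simp: noeth_between_def)
qed

lemma noeth_between_maximal:
  assumes "noeth_between U W" "V \<in> \<C>"
    and \<C>: "\<And>V. V \<in> \<C> \<Longrightarrow> submodule V R M \<and> U \<subseteq> V \<and> V \<subseteq> W"
  obtains B where "B \<in> \<C>" "\<And>B'. \<lbrakk>B' \<in> \<C>; B \<subseteq> B'\<rbrakk> \<Longrightarrow> B' = B"
proof (rule ccontr)
  assume "\<not> thesis"
  with that have "\<forall>B\<in>\<C>. \<exists>B'\<in>\<C>. B \<subset> B'"
    by blast
  then obtain g where g: "\<And>B. B \<in> \<C> \<Longrightarrow> g B \<in> \<C> \<and> B \<subset> g B"
    by metis
  define C where "C k = (g ^^ k) V" for k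
  have C: "C k \<in> \<C>" for k
    by (induction k) (use g assms(2) in \<open>auto simp: C_def\<close>)
  have S: "C k \<subset> C (Suc k)" for k
    using g[OF C[of k]] by (simp add: C_def)
  obtain p where "\<And>k. k \<ge> p \<Longrightarrow> C k = C p"
    by (rule noeth_between_chain[OF assms(1), of C]) (use C \<C> S in blast)+
  from this[of "Suc p"] S[of p] show False
    by simp
qed

end

lemma (in noetherian_ring) ideal_chain_stable:
  assumes "\<And>k. ideal (C k) R" "\<And>k. C k \<subseteq> C (Suc k)"
  obtains p :: nat where "\<And>k. k \<ge> p \<Longrightarrow> C k = C p"
proof -
  have mono: "C i \<subseteq> C j" if "i \<le> j" for i j
    using lift_Suc_mono_le[of C, OF assms(2) that] .
  have "subset.chain {I. ideal I R} (range C)"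
  proof -
    have "C i \<subseteq> C j \<or> C j \<subseteq> C i" for i j
      using mono nat_le_linear by blast
    then show ?thesis
      using assms(1) unfolding pred_on.chain_def by blast
  qed
  from ideal_chain_is_trivial[OF _ this] obtain p where p: "\<Union>(range C) = C p"
    by auto
  show thesis
  proof
    fix k assume "k \<ge> p"
    then show "C k = C p"
      using mono[of p k] p by blast
  qed
qed

locale noeth_module = module R M + noetherian_ring R for R (structure) and M (structure)
begin

text \<open>A chain \<open>C\<close> below W + Rx is controlled by two chains that become
  stationary: its traces on \<open>W\<close>, and the ideals of those coefficients of
  \<open>x\<close> that occur in it modulo \<open>W\<close>. This is the chain condition for an
  extension of a cyclic module by W/U.\<close>

lemma noeth_between_insert:
  assumes N: "noeth_between U W" and x: "x \<in> carrier M"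
  defines "W' \<equiv> msum {r \<odot>\<^bsub>M\<^esub> x | r. r \<in> carrier R} W"
  shows "noeth_between U W'"
proof -
  note U = noeth_betweenD(1)[OF N] and W = noeth_betweenD(2)[OF N]
  have W': "submodule W' R M" "W \<subseteq> W'"
    unfolding W'_def using msum_submodule msum_upper cyclic_submodule x W by auto
  have "\<exists>p. \<forall>k\<ge>p. C k = C p"
    if C: "\<And>k. submodule (C k) R M" "\<And>k. U \<subseteq> C k" "\<And>k. C k \<subseteq> W'" "\<And>k. C k \<subseteq> C (Suc k)" for C :: "nat \<Rightarrow> _"
  proof -
    obtain p where p: "\<And>k. k \<ge> p \<Longrightarrow> C k \<inter> W = C p \<inter> W"
    proof (rule noeth_between_chain[OF N, of "\<lambda>k. C k \<inter> W"])
      show "submodule (C k \<inter> W) R M" for k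
        using submodule_Int C W by blast
    qed (use C noeth_betweenD(3)[OF N] in blast)+
    define J where "J k = {r \<in> carrier R. \<exists>w\<in>W. r \<odot>\<^bsub>M\<^esub> x \<oplus>\<^bsub>M\<^esub> w \<in> C k}" for k
    have J: "ideal (J k) R" for k
    proof (rule idealI)
      show "ring R" by (rule R.ring_axioms)
      show smul: "a \<otimes> r \<in> J k" if "r \<in> J k" "a \<in> carrier R" for r a
      proof -
        from that obtain w where w: "r \<in> carrier R" "w \<in> W" "r \<odot>\<^bsub>M\<^esub> x \<oplus>\<^bsub>M\<^esub> w \<in> C k"
          by (auto simp: J_def)
        have "a \<odot>\<^bsub>M\<^esub> (r \<odot>\<^bsub>M\<^esub> x \<oplus>\<^bsub>M\<^esub> w) = (a \<otimes> r) \<odot>\<^bsub>M\<^esub> x \<oplus>\<^bsub>M\<^esub> a \<odot>\<^bsub>M\<^esub> w"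
          using w that x submodule_carrier[OF W] by (simp add: smult_r_distr smult_assoc1)
        with w that submodule_smult[OF C(1) that(2), of _ k] submodule_smult[OF W that(2)] show ?thesis
          unfolding J_def by force
      qed
      then show "r \<otimes> a \<in> J k" if "r \<in> J k" "a \<in> carrier R" for r a
        using that R.m_comm[of r a] by (auto simp: J_def)
      show "subgroup (J k) (add_monoid R)"
      proof (rule R.add.subgroupI)
        show "J k \<noteq> {}"
          using x submodule_zero[OF C(1)[of k]] submodule_zero[OF W] by (auto simp: J_def intro!: exI[of _ \<zero>] bexI[of _ "\<zero>\<^bsub>M\<^esub>"])
        fix r assume r: "r \<in> J k"
        then have "r \<in> carrier R" by (simp add: J_def)
        then show "\<ominus> r \<in> J k"
          using smul[OF r, of "\<ominus> \<one>"] by (simp add: l_minus)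
      next
        fix r s assume "r \<in> J k" "s \<in> J k"
        then obtain w v where wv: "r \<in> carrier R" "w \<in> W" "r \<odot>\<^bsub>M\<^esub> x \<oplus>\<^bsub>M\<^esub> w \<in> C k"
          "s \<in> carrier R" "v \<in> W" "s \<odot>\<^bsub>M\<^esub> x \<oplus>\<^bsub>M\<^esub> v \<in> C k"
          by (auto simp: J_def)
        have "(r \<odot>\<^bsub>M\<^esub> x \<oplus>\<^bsub>M\<^esub> w) \<oplus>\<^bsub>M\<^esub> (s \<odot>\<^bsub>M\<^esub> x \<oplus>\<^bsub>M\<^esub> v) = (r \<oplus> s) \<odot>\<^bsub>M\<^esub> x \<oplus>\<^bsub>M\<^esub> (w \<oplus>\<^bsub>M\<^esub> v)"
          using wv x submodule_carrier[OF W] by (simp add: smult_l_distr add_interchange)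
        with wv submodule_add[OF C(1)[of k] wv(3,6)] submodule_add[OF W wv(2,5)] show "r \<oplus> s \<in> J k"
          unfolding J_def by force
      qed (auto simp: J_def)
    qed
    have JS: "J k \<subseteq> J (Suc k)" for k
      using C(4) by (auto simp: J_def)
    obtain q where q: "\<And>k. k \<ge> q \<Longrightarrow> J k = J q"
      by (rule ideal_chain_stable[of J]) (use J JS in blast)+
    have "C k \<subseteq> C (max p q)" if "k \<ge> max p q" for k
    proof
      fix u assume u: "u \<in> C k"
      with C(3) obtain r w where rw: "r \<in> carrier R" "w \<in> W" "u = r \<odot>\<^bsub>M\<^esub> x \<oplus>\<^bsub>M\<^esub> w"
        unfolding W'_def msum_def by blast
      with u have "r \<in> J k" by (auto simp: J_def)
      then have "r \<in> J (max p q)"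
        using q[of k] q[of "max p q"] that by simp
      then obtain v where v: "v \<in> W" "r \<odot>\<^bsub>M\<^esub> x \<oplus>\<^bsub>M\<^esub> v \<in> C (max p q)"
        by (auto simp: J_def)
      \<comment> \<open>\<open>u\<close> and \<open>?v\<close> have the same coefficient at
        \<open>x\<close>, so their difference lies in the trace on \<open>W\<close>, which is
        already stationary.\<close>
      let ?v = "r \<odot>\<^bsub>M\<^esub> x \<oplus>\<^bsub>M\<^esub> v"
      have vk: "?v \<in> C k"
        using v(2) lift_Suc_mono_le[of C, OF C(4) that] by blast
      have "u \<ominus>\<^bsub>M\<^esub> ?v = w \<ominus>\<^bsub>M\<^esub> v"
        using rw v x submodule_carrier[OF W] by (simp add: minus_interchange) (simp add: M.minus_eq M.r_neg)
      then have "u \<ominus>\<^bsub>M\<^esub> ?v \<in> C k \<inter> W"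
        using submodule_minus[OF C(1) u vk] submodule_minus[OF W rw(2) v(1)] by auto
      then have "u \<ominus>\<^bsub>M\<^esub> ?v \<in> C (max p q)"
        using p[of k] p[of "max p q"] that by auto
      then show "u \<in> C (max p q)"
        using submodule_mem_cancel'[OF C(1) submodule_carrier[OF C(1) u] v(2)] by simp
    qed
    moreover have "C (max p q) \<subseteq> C k" if "k \<ge> max p q" for k
      using lift_Suc_mono_le[of C, OF C(4) that] .
    ultimately show ?thesis by blast
  qed
  moreover have "U \<subseteq> W'"
    using W'(2) noeth_betweenD(3)[OF N] by simp
  ultimately show ?thesis
    using W'(1) U by (auto simp: noeth_between_def)
qed

lemma noeth_between_span:
  assumes "submodule U R M" "finite S" "S \<subseteq> carrier M" "submodule W R M" "U \<subseteq> W"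
    and "W \<subseteq> msum (module_span R M S) U"
  shows "noeth_between U W"
proof -
  have "noeth_between U (msum (module_span R M S) U)"
    using assms(2,3)
  proof (induction S rule: finite_induct)
    case empty
    have "msum {\<zero>\<^bsub>M\<^esub>} U = U"
      using submodule_carrier[OF assms(1)] by (force simp: msum_def)
    moreover have "C k = C 0" if "\<forall>k. submodule (C k) R M \<and> U \<subseteq> C k \<and> C k \<subseteq> U \<and> C k \<subseteq> C (Suc k)" for C and k :: nat
      using that by (metis subset_antisym)
    ultimately show ?case
      using assms(1) unfolding noeth_between_def span_empty by (metis subset_refl)
  next
    case (insert x S)
    then have S: "submodule (module_span R M S) R M" and x: "x \<in> carrier M" "S \<subseteq> carrier M"
      using span_submodule by auto
    let ?X = "{r \<odot>\<^bsub>M\<^esub> x | r. r \<in> carrier R}"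
    have i: "submodule (module_span R M (insert x S)) R M"
      using x span_submodule by simp
    have *: "noeth_between U (msum ?X (msum (module_span R M S) U))"
      using insert x by (intro noeth_between_insert) auto
    show ?case
    proof (rule noeth_between_mono[OF *])
      show "submodule (msum (module_span R M (insert x S)) U) R M"
        using i assms(1) msum_submodule by blast
      show "U \<subseteq> msum (module_span R M (insert x S)) U"
        using msum_upper[OF i assms(1)] by simp
      have b: "submodule (msum ?X (msum (module_span R M S) U)) R M"
        using noeth_betweenD[OF *] by simp
      note u = msum_upper[OF cyclic_submodule[OF x(1)] msum_submodule[OF S assms(1)]] msum_upper[OF S assms(1)]
      have "module_span R M (insert x S) \<subseteq> msum ?X (msum (module_span R M S) U)"
        unfolding span_insert[OF x] using u by (intro msum_least[OF b]) auto
      then show "msum (module_span R M (insert x S)) U \<subseteq> msum ?X (msum (module_span R M S) U)"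
        using u by (intro msum_least[OF b]) auto
    qed (use assms in auto)
  qed
  then show ?thesis
    using noeth_between_mono assms by blast
qed

end

section \<open>Filtrations by powers of an ideal\<close>

context module
begin

text \<open>The powers of the ideal are replaced by sums of iterated products, so a mere set of
  generators \<open>S\<close> is enough. The rule \<open>in_filt_base\<close> puts \<open>U\<close>
  into every level, while \<open>in_filt_0\<close> lets \<open>W\<close> enter only at level
  0.\<close>

inductive in_filt :: "'c set \<Rightarrow> 'c set \<Rightarrow> 'a set \<Rightarrow> nat \<Rightarrow> 'c \<Rightarrow> bool" for W U S where
  in_filt_0: "w \<in> W \<Longrightarrow> in_filt W U S 0 w"
| in_filt_base: "u \<in> U \<Longrightarrow> in_filt W U S k u"
| in_filt_smult: "\<lbrakk>s \<in> S; in_filt W U S k x\<rbrakk> \<Longrightarrow> in_filt W U S (Suc k) (s \<odot>\<^bsub>M\<^esub> x)"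
| in_filt_add: "\<lbrakk>in_filt W U S k x; in_filt W U S k y\<rbrakk> \<Longrightarrow> in_filt W U S k (x \<oplus>\<^bsub>M\<^esub> y)"

text \<open>The submodule \<open>J\<^sup>k W + U\<close>, where \<open>J\<close> is the ideal generated by \<open>S\<close>.\<close>

definition filt :: "'c set \<Rightarrow> 'c set \<Rightarrow> 'a set \<Rightarrow> nat \<Rightarrow> 'c set"
  where "filt W U S k = {x. in_filt W U S k x}"

lemma filt_base: "u \<in> U \<Longrightarrow> u \<in> filt W U S k"
  and filt_smult: "\<lbrakk>s \<in> S; x \<in> filt W U S k\<rbrakk> \<Longrightarrow> s \<odot>\<^bsub>M\<^esub> x \<in> filt W U S (Suc k)"
  and filt_add: "\<lbrakk>x \<in> filt W U S k; y \<in> filt W U S k\<rbrakk> \<Longrightarrow> x \<oplus>\<^bsub>M\<^esub> y \<in> filt W U S k"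
  by (auto simp: filt_def intro: in_filt.intros)

lemma filt_0I: "w \<in> W \<Longrightarrow> w \<in> filt W U S 0"
  by (auto simp: filt_def intro: in_filt.intros)

text \<open>The induction principle of the filtration. The family \<open>X\<close> varies with the
  level because a factor from \<open>S\<close> moves from level \<open>k\<close> to k + 1. A claim
  about one level alone is obtained with a family that is \<open>UNIV\<close> above it.\<close>

lemma filt_least:
  assumes "x \<in> filt W U S k"
    and "W \<subseteq> X 0" "\<And>k. U \<subseteq> X k"
    and "\<And>k s x. \<lbrakk>s \<in> S; x \<in> X k\<rbrakk> \<Longrightarrow> s \<odot>\<^bsub>M\<^esub> x \<in> X (Suc k)"
    and "\<And>k x y. \<lbrakk>x \<in> X k; y \<in> X k\<rbrakk> \<Longrightarrow> x \<oplus>\<^bsub>M\<^esub> y \<in> X k"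
  shows "x \<in> X k"
proof -
  have "in_filt W U S k x \<Longrightarrow> x \<in> X k"
    by (induction rule: in_filt.induct) (use assms in blast)+
  with assms(1) show ?thesis by (simp add: filt_def)
qed

lemma filt_mono:
  assumes "W \<subseteq> W'" "S \<subseteq> S'"
  shows "filt W U S k \<subseteq> filt W' U S' k"
proof
  fix x assume "x \<in> filt W U S k"
  then show "x \<in> filt W' U S' k"
    by (rule filt_least) (use assms in \<open>blast intro: filt_base filt_smult filt_add filt_0I\<close>)+
qed

lemma filt_trans: "filt (filt W U S j) U S k \<subseteq> filt W U S (j + k)"
proof
  fix x assume "x \<in> filt (filt W U S j) U S k"
  then show "x \<in> filt W U S (j + k)"
    by (rule filt_least) (auto intro: filt_base filt_smult filt_add)
qed

end

locale module_pair = module +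
  fixes W U
  assumes W: "submodule W R M" and U: "submodule U R M" and UW: "U \<subseteq> W"
begin

lemma filt_0: "filt W U S 0 = W"
proof
  have "x \<in> (if k = 0 then W else UNIV)" if "x \<in> filt W U S k" for k x
    using that by (rule filt_least) (use UW submodule_add[OF W] in auto)
  from this[of _ 0] show "filt W U S 0 \<subseteq> W" by auto
qed (auto simp: filt_def intro: in_filt_0)

lemma filt_subset:
  assumes "S \<subseteq> carrier R"
  shows "filt W U S k \<subseteq> W"
proof
  fix x assume "x \<in> filt W U S k"
  then show "x \<in> W"
    by (rule filt_least) (use assms UW submodule_add[OF W] submodule_smult[OF W] in auto)
qed

text \<open>Only products with \<open>S\<close> are built into the filtration. Scalars from
  \<open>R\<close> commute with them and can be pushed down to level 0, where \<open>W\<close> and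
  \<open>U\<close> absorb them.\<close>

lemma filt_submodule:
  assumes S: "S \<subseteq> carrier R"
  shows "submodule (filt W U S k) R M"
proof (rule submoduleI')
  fix r x assume r: "r \<in> carrier R" and x: "x \<in> filt W U S k"
  let ?X = "\<lambda>k. {x \<in> filt W U S k. r \<odot>\<^bsub>M\<^esub> x \<in> filt W U S k}"
  from x have "x \<in> ?X k"
  proof (rule filt_least)
    show "s \<odot>\<^bsub>M\<^esub> x \<in> ?X (Suc k)" if "s \<in> S" "x \<in> ?X k" for s x k
    proof -
      have "x \<in> carrier M"
        using that filt_subset[OF S] submodule_carrier[OF W] by blast
      then have "r \<odot>\<^bsub>M\<^esub> (s \<odot>\<^bsub>M\<^esub> x) = s \<odot>\<^bsub>M\<^esub> (r \<odot>\<^bsub>M\<^esub> x)"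
        using r S that(1) smult_assoc1[of r s x] smult_assoc1[of s r x] R.m_comm[of r s] by auto
      with that show ?thesis by (auto intro: filt_smult)
    qed
    show "x \<oplus>\<^bsub>M\<^esub> y \<in> ?X k" if "x \<in> ?X k" "y \<in> ?X k" for x y k
    proof -
      have "x \<in> carrier M" "y \<in> carrier M"
        using that filt_subset[OF S] submodule_carrier[OF W] by blast+
      then show ?thesis
        using that r by (auto simp: smult_r_distr intro: filt_add)
    qed
    show "W \<subseteq> ?X 0"
      using submodule_smult[OF W r] by (auto simp: filt_0)
    show "U \<subseteq> ?X k" for k
      using submodule_smult[OF U r] by (auto intro: filt_base)
  qed
  then show "r \<odot>\<^bsub>M\<^esub> x \<in> filt W U S k" by simp
qed (use filt_subset[OF S] submodule_carrier[OF W] submodule_zero[OF U] in \<open>auto intro: filt_base filt_add\<close>)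

lemma filt_Suc_subset:
  assumes "S \<subseteq> carrier R"
  shows "filt W U S (Suc k) \<subseteq> filt W U S k"
proof
  fix x assume "x \<in> filt W U S (Suc k)"
  \<comment> \<open>The same filtration shifted by one level, with \<open>W\<close> repeated at
    level 0.\<close>
  then have "x \<in> (case Suc k of 0 \<Rightarrow> W | Suc j \<Rightarrow> filt W U S j)"
  proof (rule filt_least)
    fix k s x assume "s \<in> S" "x \<in> (case k of 0 \<Rightarrow> W | Suc j \<Rightarrow> filt W U S j)"
    then show "s \<odot>\<^bsub>M\<^esub> x \<in> (case Suc k of 0 \<Rightarrow> W | Suc j \<Rightarrow> filt W U S j)"
      using assms submodule_smult[OF W] by (auto simp: filt_0 split: nat.splits intro: filt_smult)
  qed (use UW submodule_add[OF W] in \<open>auto split: nat.splits intro: filt_base filt_add\<close>)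
  then show "x \<in> filt W U S k" by simp
qed

lemma filt_antimono:
  assumes "S \<subseteq> carrier R" "j \<le> k"
  shows "filt W U S k \<subseteq> filt W U S j"
  using lift_Suc_antimono_le[of "filt W U S", OF filt_Suc_subset[OF assms(1)] assms(2)] .

lemma filt_shift_ideal:
  assumes S: "S \<subseteq> carrier R"
  shows "ideal {r \<in> carrier R. \<forall>k. \<forall>x\<in>filt W U S k. r \<odot>\<^bsub>M\<^esub> x \<in> filt W U S (k + t)} R" (is "ideal ?I R")
proof (rule idealI)
  note sm = filt_submodule[OF S]
  note c = submodule_carrier[OF sm]
  show "ring R" by (rule R.ring_axioms)
  show smul: "a \<otimes> r \<in> ?I" if "r \<in> ?I" "a \<in> carrier R" for r a
    using that submodule_smult[OF sm] c by (auto simp: smult_assoc1)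
  then show "r \<otimes> a \<in> ?I" if "r \<in> ?I" "a \<in> carrier R" for r a
    using that R.m_comm[of r a] by auto
  show "subgroup ?I (add_monoid R)"
  proof (rule R.add.subgroupI)
    show "?I \<noteq> {}"
      using submodule_zero[OF sm] c by (auto intro!: exI[of _ \<zero>])
    fix r assume r: "r \<in> ?I"
    then show "\<ominus> r \<in> ?I"
      using smul[OF r, of "\<ominus> \<one>"] by (simp add: l_minus)
  next
    fix r s assume "r \<in> ?I" "s \<in> ?I"
    then show "r \<oplus> s \<in> ?I"
      using submodule_add[OF sm] c by (auto simp: smult_l_distr)
  qed auto
qed

text \<open>The ring elements that raise every level by one form an ideal; as it contains
  \<open>S\<close>, it contains \<open>Idl S\<close>.\<close>

lemma filt_genideal:
  assumes S: "S \<subseteq> carrier R"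
  shows "filt W U (Idl S) k = filt W U S k"
proof
  show "filt W U S k \<subseteq> filt W U (Idl S) k"
    using R.genideal_self[OF S] by (intro filt_mono) auto
  have "Idl S \<subseteq> {r \<in> carrier R. \<forall>k. \<forall>x\<in>filt W U S k. r \<odot>\<^bsub>M\<^esub> x \<in> filt W U S (k + 1)}"
    using S by (intro R.genideal_minimal[OF filt_shift_ideal[OF S]]) (auto intro: filt_smult)
  then have step: "s \<odot>\<^bsub>M\<^esub> x \<in> filt W U S (Suc k)" if "s \<in> Idl S" "x \<in> filt W U S k" for s x k
    using that by auto
  show "filt W U (Idl S) k \<subseteq> filt W U S k"
  proof
    fix x assume "x \<in> filt W U (Idl S) k"
    then show "x \<in> filt W U S k"
      by (rule filt_least) (auto simp: filt_0 intro: filt_base filt_add step)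
  qed
qed

end

context module
begin

lemma filt_1_least:
  assumes "submodule B R M" "U \<subseteq> B" "\<And>s x. \<lbrakk>s \<in> S; x \<in> W\<rbrakk> \<Longrightarrow> s \<odot>\<^bsub>M\<^esub> x \<in> B"
    and "module_pair R M W U"
  shows "filt W U S 1 \<subseteq> B"
proof
  interpret module_pair R M W U by fact
  fix x assume "x \<in> filt W U S 1"
  then have "x \<in> (if (1::nat) = 0 then W else if (1::nat) = 1 then B else UNIV)"
    by (rule filt_least)
      (use assms(2,3) UW submodule_add[OF W] submodule_add[OF assms(1)] in \<open>auto split: if_splits\<close>)
  then show "x \<in> B" by simp
qed

end

section \<open>The Artin--Rees lemma\<close>

lemma (in module) image_submodule:
  assumes "r \<in> carrier R" "submodule V R M"
  shows "submodule ((\<lambda>x. r \<odot>\<^bsub>M\<^esub> x) ` V) R M"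
proof (rule submoduleI')
  note c = submodule_carrier[OF assms(2)]
  show "(\<lambda>x. r \<odot>\<^bsub>M\<^esub> x) ` V \<subseteq> carrier M"
    using assms(1) c by auto
  show "\<zero>\<^bsub>M\<^esub> \<in> (\<lambda>x. r \<odot>\<^bsub>M\<^esub> x) ` V"
    using assms submodule_zero[OF assms(2)] by (auto intro!: image_eqI[of _ _ "\<zero>\<^bsub>M\<^esub>"])
  fix a b assume "a \<in> (\<lambda>x. r \<odot>\<^bsub>M\<^esub> x) ` V" "b \<in> (\<lambda>x. r \<odot>\<^bsub>M\<^esub> x) ` V"
  then obtain x y where "x \<in> V" "y \<in> V" "a = r \<odot>\<^bsub>M\<^esub> x" "b = r \<odot>\<^bsub>M\<^esub> y" by auto
  then show "a \<oplus>\<^bsub>M\<^esub> b \<in> (\<lambda>x. r \<odot>\<^bsub>M\<^esub> x) ` V"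
    using assms c by (intro image_eqI[of _ _ "x \<oplus>\<^bsub>M\<^esub> y"]) (auto simp: smult_r_distr intro: submodule_add)
next
  note c = submodule_carrier[OF assms(2)]
  fix a x assume a: "a \<in> carrier R" "x \<in> (\<lambda>x. r \<odot>\<^bsub>M\<^esub> x) ` V"
  then obtain v where v: "v \<in> V" "x = r \<odot>\<^bsub>M\<^esub> v" by auto
  then have "a \<odot>\<^bsub>M\<^esub> x = r \<odot>\<^bsub>M\<^esub> (a \<odot>\<^bsub>M\<^esub> v)"
    using a(1) assms(1) c[OF v(1)] smult_assoc1[of a r v] smult_assoc1[of r a v] R.m_comm[of a r] by simp
  with v a show "a \<odot>\<^bsub>M\<^esub> x \<in> (\<lambda>x. r \<odot>\<^bsub>M\<^esub> x) ` V"
    using assms(2) by (auto intro: submodule_smult)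
qed

lemma (in module) image_submodule_mono:
  assumes "submodule V R M" "r \<in> carrier R"
  shows "(\<lambda>x. r \<odot>\<^bsub>M\<^esub> x) ` V \<subseteq> V"
  using assms submodule_smult by blast

lemma (in module) module_pairI:
  "\<lbrakk>submodule W R M; submodule U R M; U \<subseteq> W\<rbrakk> \<Longrightarrow> module_pair R M W U"
  by (intro module_pair.intro module_pair_axioms.intro module_axioms)

locale noeth_pair = module_pair +
  assumes noeth: "noeth_between U W"
begin

text \<open>A graded submodule of the Rees module of \<open>W\<close> relative to \<open>U\<close>,
  given by its homogeneous pieces. The Artin-Rees lemma is needed only for traces on a fixed
  submodule, but its proof by induction on the generators passes to families of leading
  coefficients, which are of this more general kind.\<close>

definition filt_family :: "'a set \<Rightarrow> (nat \<Rightarrow> 'c set) \<Rightarrow> bool"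
  where "filt_family S F \<longleftrightarrow> (\<forall>k. submodule (F k) R M \<and> U \<subseteq> F k \<and> F k \<subseteq> filt W U S k \<and>
    (\<forall>s\<in>S. \<forall>x\<in>F k. s \<odot>\<^bsub>M\<^esub> x \<in> F (Suc k)))"

text \<open>Above degree \<open>p\<close> the graded submodule needs no new generators apart from
  \<open>U\<close>.\<close>

definition stable_from :: "'a set \<Rightarrow> (nat \<Rightarrow> 'c set) \<Rightarrow> nat \<Rightarrow> bool"
  where "stable_from S F p \<longleftrightarrow> (\<forall>k\<ge>p. F (Suc k) \<subseteq> filt (F k) U S 1)"

lemma filt_familyD:
  assumes "filt_family S F"
  shows "submodule (F k) R M" "U \<subseteq> F k" "F k \<subseteq> filt W U S k"
    "\<lbrakk>s \<in> S; x \<in> F k\<rbrakk> \<Longrightarrow> s \<odot>\<^bsub>M\<^esub> x \<in> F (Suc k)"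
  using assms by (auto simp: filt_family_def)

text \<open>The elements of \<open>J\<^sup>K W + U\<close>, where \<open>J = (S, x)\<close>, that have degree less than \<open>j\<close> in \<open>x\<close>;
  only used for \<open>j \<le> K + 1\<close>.\<close>

primrec low :: "'a set \<Rightarrow> 'a \<Rightarrow> nat \<Rightarrow> nat \<Rightarrow> 'c set"
  where "low S x 0 K = U"
  | "low S x (Suc j) K = msum (low S x j K) ((\<lambda>g. (x [^] j) \<odot>\<^bsub>M\<^esub> g) ` filt W U S (K - j))"

context
  fixes S x
  assumes S: "S \<subseteq> carrier R" and x: "x \<in> carrier R"
begin

lemma lead_submodule: "submodule ((\<lambda>g. (x [^] (j::nat)) \<odot>\<^bsub>M\<^esub> g) ` filt W U S k) R M"
  by (rule image_submodule) (auto simp: x intro: filt_submodule[OF S])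

lemma low_submodule: "submodule (low S x j K) R M"
  by (induction j) (auto simp: U intro: msum_submodule lead_submodule)

lemma low_mono: "low S x j K \<subseteq> low S x (Suc j) K"
  using msum_upper(1)[OF low_submodule lead_submodule] by auto

lemma low_base: "U \<subseteq> low S x j K"
proof (induction j)
  case (Suc j)
  then show ?case using low_mono by (rule subset_trans)
qed simp

lemma filt_carrier: "g \<in> filt W U S k \<Longrightarrow> g \<in> carrier M"
  using submodule_carrier[OF filt_submodule[OF S]] .

lemma low_carrier: "l \<in> low S x j K \<Longrightarrow> l \<in> carrier M"
  using submodule_carrier[OF low_submodule] .

lemma x_pow_Suc: "g \<in> carrier M \<Longrightarrow> x \<odot>\<^bsub>M\<^esub> ((x [^] (j::nat)) \<odot>\<^bsub>M\<^esub> g) = (x [^] Suc j) \<odot>\<^bsub>M\<^esub> g"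
  using x smult_assoc1[of x "x [^] j" g] R.m_comm[of x "x [^] j"] by simp

lemma low_shift_x: "l \<in> low S x j K \<Longrightarrow> x \<odot>\<^bsub>M\<^esub> l \<in> low S x (Suc j) (Suc K)"
proof (induction j arbitrary: l)
  case 0
  then have "x \<odot>\<^bsub>M\<^esub> l \<in> low S x 0 (Suc K)"
    using x U submodule_smult by auto
  then show ?case
    using low_mono by blast
next
  case (Suc j)
  then obtain l' g where l: "l' \<in> low S x j K" "g \<in> filt W U S (K - j)" "l = l' \<oplus>\<^bsub>M\<^esub> (x [^] j) \<odot>\<^bsub>M\<^esub> g"
    by (auto elim!: msumE)
  have "x \<odot>\<^bsub>M\<^esub> l = x \<odot>\<^bsub>M\<^esub> l' \<oplus>\<^bsub>M\<^esub> (x [^] Suc j) \<odot>\<^bsub>M\<^esub> g"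
    using l x low_carrier filt_carrier x_pow_Suc[of g j] by (simp add: smult_r_distr)
  moreover have "x \<odot>\<^bsub>M\<^esub> l' \<in> low S x (Suc j) (Suc K)"
    using Suc.IH l(1) by blast
  moreover have "g \<in> filt W U S (Suc K - Suc j)"
    using l(2) by simp
  ultimately show ?case
    by (subst low.simps(2)) (rule msumI, assumption, rule imageI, assumption+)
qed

text \<open>Multiplication by \<open>s\<close> must raise each K - i by one, for the exponents i < j
  of \<open>x\<close> that occur. With truncated subtraction this is right exactly because j <= K +
  1.\<close>

lemma low_shift_S:
  assumes "s \<in> S"
  shows "\<lbrakk>j \<le> Suc K; l \<in> low S x j K\<rbrakk> \<Longrightarrow> s \<odot>\<^bsub>M\<^esub> l \<in> low S x j (Suc K)"
proof (induction j arbitrary: l)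
  case 0
  then show ?case
    using S assms U submodule_smult by auto
next
  case (Suc j)
  then obtain l' g where l: "l' \<in> low S x j K" "g \<in> filt W U S (K - j)" "l = l' \<oplus>\<^bsub>M\<^esub> (x [^] j) \<odot>\<^bsub>M\<^esub> g"
    by (auto elim!: msumE)
  have s: "s \<in> carrier R" and g: "g \<in> carrier M"
    using assms S l filt_carrier by auto
  have "s \<odot>\<^bsub>M\<^esub> ((x [^] j) \<odot>\<^bsub>M\<^esub> g) = (x [^] j) \<odot>\<^bsub>M\<^esub> (s \<odot>\<^bsub>M\<^esub> g)"
    using s g x smult_assoc1[of s "x [^] j" g] smult_assoc1[of "x [^] j" s g] R.m_comm[of s "x [^] j"] by simp
  then have "s \<odot>\<^bsub>M\<^esub> l = s \<odot>\<^bsub>M\<^esub> l' \<oplus>\<^bsub>M\<^esub> (x [^] j) \<odot>\<^bsub>M\<^esub> (s \<odot>\<^bsub>M\<^esub> g)"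
    using l(1,3) low_carrier s g x by (simp add: smult_r_distr)
  moreover have "s \<odot>\<^bsub>M\<^esub> l' \<in> low S x j (Suc K)"
    using Suc l(1) by simp
  moreover have "s \<odot>\<^bsub>M\<^esub> g \<in> filt W U S (Suc K - j)"
    using filt_smult[OF assms l(2)] Suc.prems by (simp add: Suc_diff_le)
  ultimately show ?case
    by (subst low.simps(2)) (rule msumI, assumption, rule imageI, assumption+)
qed

text \<open>Sorting products of \<open>K\<close> factors by the exponent of \<open>x\<close>
  produces the exponents 0, ..., K, hence the strict degree bound \<open>Suc K\<close>.\<close>

lemma filt_insert_subset_low: "filt W U (insert x S) K \<subseteq> low S x (Suc K) K"
proof
  fix y assume "y \<in> filt W U (insert x S) K"
  then show "y \<in> low S x (Suc K) K"
  proof (rule filt_least)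
    have "w \<in> msum U ((\<lambda>g. \<one> \<odot>\<^bsub>M\<^esub> g) ` filt W U S 0)" if "w \<in> W" for w
      using that submodule_zero[OF U] submodule_carrier[OF W]
      by (intro msumI[of "\<zero>\<^bsub>M\<^esub>" _ "\<one> \<odot>\<^bsub>M\<^esub> w"]) (auto simp: filt_0)
    then show "W \<subseteq> low S x (Suc 0) 0" by auto
    fix k s y assume "s \<in> insert x S" "y \<in> low S x (Suc k) k"
    then show "s \<odot>\<^bsub>M\<^esub> y \<in> low S x (Suc (Suc k)) (Suc k)"
      using low_shift_x[of y "Suc k" k] low_shift_S[of s "Suc k" k y] low_mono by blast
  next
    show "a \<oplus>\<^bsub>M\<^esub> b \<in> low S x (Suc k) k" if "a \<in> low S x (Suc k) k" "b \<in> low S x (Suc k) k" for k a b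
      using submodule_add[OF low_submodule] that by blast
  qed (rule low_base)
qed

text \<open>Leading coefficients in \<open>x\<close>, as in the proof of Hilbert's basis theorem.\<close>

definition lead :: "(nat \<Rightarrow> 'c set) \<Rightarrow> nat \<Rightarrow> nat \<Rightarrow> 'c set"
  where "lead F j k = {g \<in> filt W U S k. \<exists>l\<in>low S x j (k + j). l \<oplus>\<^bsub>M\<^esub> (x [^] j) \<odot>\<^bsub>M\<^esub> g \<in> F (k + j)}"

lemma leadE:
  assumes "g \<in> lead F j k"
  obtains l where "g \<in> filt W U S k" "l \<in> low S x j (k + j)" "l \<oplus>\<^bsub>M\<^esub> (x [^] j) \<odot>\<^bsub>M\<^esub> g \<in> F (k + j)"
  using assms by (auto simp: lead_def)

lemma leadI:
  assumes "g \<in> filt W U S k" "l \<in> low S x j (k + j)" "l \<oplus>\<^bsub>M\<^esub> (x [^] j) \<odot>\<^bsub>M\<^esub> g \<in> F (k + j)"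
  shows "g \<in> lead F j k"
  using assms by (auto simp: lead_def)

text \<open>Multiplying an element of F (k + j) by some \<open>s\<close> from \<open>S\<close>
  multiplies its coefficient at x^j by \<open>s\<close> and keeps the remainder of degree less than
  \<open>j\<close>. So for fixed \<open>j\<close> the leading coefficients form a family for the
  smaller set \<open>S\<close>, to which an induction hypothesis can be applied.\<close>

lemma lead_family:
  assumes F: "filt_family (insert x S) F"
  shows "filt_family S (lead F j)"
  unfolding filt_family_def
proof (intro allI conjI ballI)
  note fam = filt_familyD[OF F]
  fix k
  show "submodule (lead F j k) R M"
  proof (rule submoduleI')
    show "\<zero>\<^bsub>M\<^esub> \<in> lead F j k"
      by (rule leadI[of _ _ "\<zero>\<^bsub>M\<^esub>"])
        (use x submodule_zero[OF fam(1)] submodule_zero[OF filt_submodule[OF S]] submodule_zero[OF low_submodule] in auto)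
    show "lead F j k \<subseteq> carrier M"
      using filt_carrier by (auto simp: lead_def)
  next
    fix a b assume ab: "a \<in> lead F j k" "b \<in> lead F j k"
    from leadE[OF ab(1)] obtain l where l: "a \<in> filt W U S k" "l \<in> low S x j (k + j)" "l \<oplus>\<^bsub>M\<^esub> (x [^] j) \<odot>\<^bsub>M\<^esub> a \<in> F (k + j)" .
    from leadE[OF ab(2)] obtain m where m: "b \<in> filt W U S k" "m \<in> low S x j (k + j)" "m \<oplus>\<^bsub>M\<^esub> (x [^] j) \<odot>\<^bsub>M\<^esub> b \<in> F (k + j)" .
    have "(l \<oplus>\<^bsub>M\<^esub> m) \<oplus>\<^bsub>M\<^esub> (x [^] j) \<odot>\<^bsub>M\<^esub> (a \<oplus>\<^bsub>M\<^esub> b) =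
        (l \<oplus>\<^bsub>M\<^esub> (x [^] j) \<odot>\<^bsub>M\<^esub> a) \<oplus>\<^bsub>M\<^esub> (m \<oplus>\<^bsub>M\<^esub> (x [^] j) \<odot>\<^bsub>M\<^esub> b)"
      using l m x low_carrier filt_carrier by (simp add: smult_r_distr add_interchange)
    with submodule_add[OF fam(1) l(3) m(3)] show "a \<oplus>\<^bsub>M\<^esub> b \<in> lead F j k"
      by (intro leadI[of _ _ "l \<oplus>\<^bsub>M\<^esub> m"])
        (use l m submodule_add[OF low_submodule] submodule_add[OF filt_submodule[OF S]] in auto)
  next
    fix r a assume r: "r \<in> carrier R" and a: "a \<in> lead F j k"
    from leadE[OF a] obtain l where l: "a \<in> filt W U S k" "l \<in> low S x j (k + j)" "l \<oplus>\<^bsub>M\<^esub> (x [^] j) \<odot>\<^bsub>M\<^esub> a \<in> F (k + j)" .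
    have "r \<odot>\<^bsub>M\<^esub> l \<oplus>\<^bsub>M\<^esub> (x [^] j) \<odot>\<^bsub>M\<^esub> (r \<odot>\<^bsub>M\<^esub> a) = r \<odot>\<^bsub>M\<^esub> (l \<oplus>\<^bsub>M\<^esub> (x [^] j) \<odot>\<^bsub>M\<^esub> a)"
      using l r x low_carrier filt_carrier smult_assoc1[of r "x [^] j" a] smult_assoc1[of "x [^] j" r a] R.m_comm[of r "x [^] j"]
      by (simp add: smult_r_distr)
    with submodule_smult[OF fam(1) r l(3)] show "r \<odot>\<^bsub>M\<^esub> a \<in> lead F j k"
      by (intro leadI[of _ _ "r \<odot>\<^bsub>M\<^esub> l"])
        (use l r submodule_smult[OF low_submodule] submodule_smult[OF filt_submodule[OF S]] in auto)
  qed
  show "U \<subseteq> lead F j k"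
  proof
    fix u assume u: "u \<in> U"
    then have "(x [^] j) \<odot>\<^bsub>M\<^esub> u \<in> U"
      using x submodule_smult[OF U] by simp
    then have "\<zero>\<^bsub>M\<^esub> \<oplus>\<^bsub>M\<^esub> (x [^] j) \<odot>\<^bsub>M\<^esub> u \<in> F (k + j)"
      using fam(2) submodule_carrier[OF U] by auto
    then show "u \<in> lead F j k"
      using u submodule_zero[OF low_submodule] by (intro leadI[of _ _ "\<zero>\<^bsub>M\<^esub>"]) (auto intro: filt_base)
  qed
  show "lead F j k \<subseteq> filt W U S k"
    by (auto simp: lead_def)
  fix s g assume s: "s \<in> S" and g: "g \<in> lead F j k"
  from leadE[OF g] obtain l where l: "g \<in> filt W U S k" "l \<in> low S x j (k + j)" "l \<oplus>\<^bsub>M\<^esub> (x [^] j) \<odot>\<^bsub>M\<^esub> g \<in> F (k + j)" .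
  have sR: "s \<in> carrier R" using s S by auto
  have "s \<odot>\<^bsub>M\<^esub> l \<oplus>\<^bsub>M\<^esub> (x [^] j) \<odot>\<^bsub>M\<^esub> (s \<odot>\<^bsub>M\<^esub> g) = s \<odot>\<^bsub>M\<^esub> (l \<oplus>\<^bsub>M\<^esub> (x [^] j) \<odot>\<^bsub>M\<^esub> g)"
    using l sR x low_carrier filt_carrier smult_assoc1[of s "x [^] j" g] smult_assoc1[of "x [^] j" s g] R.m_comm[of s "x [^] j"]
    by (simp add: smult_r_distr)
  then have "s \<odot>\<^bsub>M\<^esub> l \<oplus>\<^bsub>M\<^esub> (x [^] j) \<odot>\<^bsub>M\<^esub> (s \<odot>\<^bsub>M\<^esub> g) \<in> F (Suc k + j)"
    using fam(4)[of s, OF _ l(3)] s by auto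
  then show "s \<odot>\<^bsub>M\<^esub> g \<in> lead F j (Suc k)"
    using low_shift_S[OF s _ l(2)] by (intro leadI[of _ _ "s \<odot>\<^bsub>M\<^esub> l"] filt_smult[OF s l(1)]) auto
qed

text \<open>Multiplication by \<open>x\<close> raises the degree from \<open>j\<close> to j + 1 and
  keeps the leading coefficient.\<close>

lemma lead_mono:
  assumes F: "filt_family (insert x S) F"
  shows "lead F j k \<subseteq> lead F (Suc j) k"
proof
  fix g assume "g \<in> lead F j k"
  then obtain l where l: "g \<in> filt W U S k" "l \<in> low S x j (k + j)" "l \<oplus>\<^bsub>M\<^esub> (x [^] j) \<odot>\<^bsub>M\<^esub> g \<in> F (k + j)"
    by (rule leadE)
  have "x \<odot>\<^bsub>M\<^esub> (l \<oplus>\<^bsub>M\<^esub> (x [^] j) \<odot>\<^bsub>M\<^esub> g) = x \<odot>\<^bsub>M\<^esub> l \<oplus>\<^bsub>M\<^esub> (x [^] Suc j) \<odot>\<^bsub>M\<^esub> g"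
    using l x low_carrier filt_carrier x_pow_Suc[of g j] by (simp add: smult_r_distr)
  then have "x \<odot>\<^bsub>M\<^esub> l \<oplus>\<^bsub>M\<^esub> (x [^] Suc j) \<odot>\<^bsub>M\<^esub> g \<in> F (k + Suc j)"
    using filt_familyD(4)[OF F _ l(3), of x] by simp
  then show "g \<in> lead F (Suc j) k"
    using low_shift_x[OF l(2)] l(1) by (intro leadI[of _ _ "x \<odot>\<^bsub>M\<^esub> l"]) auto
qed

text \<open>Hilbert's basis argument with \<open>x\<close> as the variable. The pieces
  \<open>lead F j k\<close> increase with \<open>j\<close>, and their union over \<open>j\<close> is
  stable in \<open>k\<close> by the induction hypothesis. Hence finitely many \<open>k\<close>
  suffice to find a degree \<open>j0\<close> beyond which \<open>lead F j k\<close> no longer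
  depends on \<open>j\<close>. For the finitely many degrees up to \<open>j0\<close> the induction
  hypothesis is used once more, now for each family \<open>lead F j\<close>.\<close>

lemma stable_from_insert:
  assumes IH: "\<And>F. filt_family S F \<Longrightarrow> \<exists>p. stable_from S F p"
    and F: "filt_family (insert x S) F"
  shows "\<exists>p. stable_from (insert x S) F p"
proof -
  note fam = filt_familyD[OF F] and lfam = lead_family[OF F]
  have sub: "submodule (lead F j k) R M" for j k
    using filt_familyD(1)[OF lfam] .
  have mono: "lead F i k \<subseteq> lead F j k" if "i \<le> j" for i j k
    using lift_Suc_mono_le[of "\<lambda>j. lead F j k", OF lead_mono[OF F] that] .
  define G where "G k = (\<Union>j. lead F j k)" for k
  have G: "filt_family S G"
    unfolding filt_family_def
  proof (intro allI conjI ballI)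
    fix k
    show "submodule (G k) R M"
    proof (rule submoduleI')
      fix a b assume "a \<in> G k" "b \<in> G k"
      then obtain i j where "a \<in> lead F i k" "b \<in> lead F j k" by (auto simp: G_def)
      then have "a \<in> lead F (max i j) k" "b \<in> lead F (max i j) k"
        using mono[of i "max i j" k] mono[of j "max i j" k] by auto
      then show "a \<oplus>\<^bsub>M\<^esub> b \<in> G k"
        using submodule_add[OF sub] unfolding G_def by blast
    next
      show "G k \<subseteq> carrier M"
        using submodule_carrier[OF sub] by (auto simp: G_def)
      show "\<zero>\<^bsub>M\<^esub> \<in> G k"
        using submodule_zero[OF sub] by (auto simp: G_def)
    next
      fix r a assume "r \<in> carrier R" "a \<in> G k"
      then show "r \<odot>\<^bsub>M\<^esub> a \<in> G k"
        using submodule_smult[OF sub] unfolding G_def by blast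
    qed
    show "U \<subseteq> G k" "G k \<subseteq> filt W U S k"
      using filt_familyD(2,3)[OF lfam] unfolding G_def by blast+
    show "s \<odot>\<^bsub>M\<^esub> g \<in> G (Suc k)" if "s \<in> S" "g \<in> G k" for s g
      using filt_familyD(4)[OF lfam that(1)] that(2) unfolding G_def by blast
  qed
  from IH[OF G] obtain p0 where p0: "stable_from S G p0" by auto
  have "\<exists>q. \<forall>j\<ge>q. lead F j k = lead F q k" for k
  proof -
    obtain q where "\<And>j. j \<ge> q \<Longrightarrow> lead F j k = lead F q k"
      by (rule noeth_between_chain[OF noeth, of "\<lambda>j. lead F j k"])
        (use sub lead_mono[OF F] filt_familyD(2,3)[OF lfam] filt_subset[OF S] in blast)+
    then show ?thesis by blast
  qed
  then obtain q where q: "\<And>k j. j \<ge> q k \<Longrightarrow> lead F j k = lead F (q k) k" by metis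
  \<comment> \<open>Degrees up to \<open>p0\<close> are enough here: above \<open>p0\<close> each
    piece of \<open>G\<close> is generated by \<open>S\<close> and \<open>U\<close> from the
    previous one.\<close>
  define j0 where "j0 = Max (q ` {..p0})"
  have j0: "q k \<le> j0" if "k \<le> p0" for k
    using that by (auto simp: j0_def)
  have G_low: "G k \<subseteq> lead F j0 k" if "k \<le> p0" for k
  proof
    fix g assume "g \<in> G k"
    then obtain j where "g \<in> lead F j k" by (auto simp: G_def)
    then have "g \<in> lead F (max j j0) k" using mono[of j "max j j0" k] by auto
    then show "g \<in> lead F j0 k"
      using q[of k "max j j0"] q[of k j0] j0[OF that] by simp
  qed
  have G_j0: "G (p0 + k) \<subseteq> lead F j0 (p0 + k)" for k
  proof (induction k)
    case (Suc k)
    have "G (Suc (p0 + k)) \<subseteq> filt (G (p0 + k)) U S 1"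
      using p0 by (simp add: stable_from_def)
    also have "\<dots> \<subseteq> lead F j0 (Suc (p0 + k))"
    proof (rule filt_1_least)
      show "module_pair R M (G (p0 + k)) U"
        by (rule module_pairI[OF filt_familyD(1)[OF G] U filt_familyD(2)[OF G]])
      show "s \<odot>\<^bsub>M\<^esub> y \<in> lead F j0 (Suc (p0 + k))" if "s \<in> S" "y \<in> G (p0 + k)" for s y
        using Suc that filt_familyD(4)[OF lfam] by blast
    qed (use sub filt_familyD(2)[OF lfam] in auto)
    finally show ?case by simp
  qed (use G_low in auto)
  have "lead F j k \<subseteq> G k" for j k by (auto simp: G_def)
  then have lead_j0: "lead F j k \<subseteq> lead F j0 k" for j k
    using G_j0[of "k - p0"] G_low[of k] by (cases "k \<le> p0") (auto simp: subset_iff)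
  from IH[OF lfam] obtain p where p: "\<And>j. stable_from S (lead F j) (p j)" by metis
  define P where "P = Max (p ` {..j0})"
  have P: "lead F j (Suc k) \<subseteq> filt (lead F j k) U S 1" if "j \<le> j0" "k \<ge> P" for j k
  proof -
    have "p j \<le> P" using that(1) by (auto simp: P_def)
    then show ?thesis
      using p[of j] that(2) by (auto simp: stable_from_def)
  qed
  \<comment> \<open>For K >= P + j0 every degree l <= j0 leaves K - l >= P, where the leading
    coefficients of degree \<open>l\<close> are already generated by \<open>S\<close> and
    \<open>U\<close>. An element of F (Suc K) is reduced modulo \<open>?Z\<close> by lowering its
    degree in \<open>x\<close>.\<close>
  have "F (Suc K) \<subseteq> filt (F K) U (insert x S) 1" if K: "K \<ge> P + j0" for K
  proof -
    let ?Z = "filt (F K) U (insert x S) 1"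
    interpret FK: module_pair R M "F K" U
      by (rule module_pairI[OF fam(1) U fam(2)])
    have Z: "submodule ?Z R M"
      using S x by (intro FK.filt_submodule) auto
    have ZF: "?Z \<subseteq> F (Suc K)"
      by (rule filt_1_least) (use fam FK.module_pair_axioms in auto)
    have Zs: "s \<odot>\<^bsub>M\<^esub> y \<in> ?Z" if "s \<in> insert x S" "y \<in> F K" for s y
      using filt_smult[OF that(1) filt_0I[OF that(2)], of U] by simp
    have "F (Suc K) \<inter> low S x l (Suc K) \<subseteq> ?Z" if "l \<le> Suc (Suc K)" for l
      using that
    proof (induction l)
      case 0
      then show ?case by (auto intro: filt_base)
    next
      case (Suc l)
      then have l: "l \<le> Suc K" by simp
      show ?case
      proof
        fix u assume u: "u \<in> F (Suc K) \<inter> low S x (Suc l) (Suc K)"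
        then obtain w g where g: "w \<in> low S x l (Suc K)" "g \<in> filt W U S (Suc K - l)"
          "u = w \<oplus>\<^bsub>M\<^esub> (x [^] l) \<odot>\<^bsub>M\<^esub> g"
          by (auto elim!: msumE)
        then have gl: "g \<in> lead F l (Suc K - l)"
          using u l by (intro leadI[of _ _ w]) auto
        \<comment> \<open>It suffices to find an element of \<open>?Z\<close> with the same leading
          term as \<open>u\<close>: the difference has smaller degree and falls under the
          induction.\<close>
        have "\<exists>w'\<in>low S x l (Suc K). w' \<oplus>\<^bsub>M\<^esub> (x [^] l) \<odot>\<^bsub>M\<^esub> g \<in> ?Z"
        proof (cases "l \<le> j0")
          case False
          \<comment> \<open>Beyond \<open>j0\<close> the coefficient \<open>g\<close> already occurs
            one degree lower, for an element of \<open>F K\<close>; multiplied by \<open>x\<close>,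
            that element has the required leading term.\<close>
          then obtain l' where l': "l = Suc l'" "j0 \<le> l'" by (cases l) auto
          have "g \<in> lead F l' (K - l')"
            using gl lead_j0[of l "K - l'"] mono[OF l'(2), of "K - l'"] l' l by auto
          then obtain w' where w': "w' \<in> low S x l' (K - l' + l')"
            "w' \<oplus>\<^bsub>M\<^esub> (x [^] l') \<odot>\<^bsub>M\<^esub> g \<in> F (K - l' + l')"
            by (rule leadE)
          then have w'2: "w' \<in> low S x l' K" "w' \<oplus>\<^bsub>M\<^esub> (x [^] l') \<odot>\<^bsub>M\<^esub> g \<in> F K"
            using l l' by auto
          have "x \<odot>\<^bsub>M\<^esub> (w' \<oplus>\<^bsub>M\<^esub> (x [^] l') \<odot>\<^bsub>M\<^esub> g) = x \<odot>\<^bsub>M\<^esub> w' \<oplus>\<^bsub>M\<^esub> (x [^] l) \<odot>\<^bsub>M\<^esub> g"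
            using w'2 g x low_carrier filt_carrier x_pow_Suc[of g l'] l' by (simp add: smult_r_distr)
          then have "x \<odot>\<^bsub>M\<^esub> w' \<oplus>\<^bsub>M\<^esub> (x [^] l) \<odot>\<^bsub>M\<^esub> g \<in> ?Z"
            using Zs[OF _ w'2(2), of x] by simp
          then show ?thesis
            using low_shift_x[OF w'2(1)] l' by auto
        next
          case True
          \<comment> \<open>In small degree, \<open>g\<close> is a sum of products of
            \<open>S\<close> with leading coefficients belonging to \<open>F K\<close>, up to
            \<open>U\<close>. The coefficients \<open>?T\<close> that can be lifted to
            \<open>?Z\<close> form a submodule, so only these products and \<open>U\<close> have to
            be tested.\<close>
          have "Suc K - l = Suc (K - l)" "K - l \<ge> P"
            using K True by auto
          then have "g \<in> filt (lead F l (K - l)) U S 1"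
            using gl P[OF True, of "K - l"] by auto
          then have "g \<in> {g \<in> carrier M. \<exists>w'\<in>low S x l (Suc K). w' \<oplus>\<^bsub>M\<^esub> (x [^] l) \<odot>\<^bsub>M\<^esub> g \<in> ?Z}"
            (is "_ \<in> ?T")
          proof (rule subsetD[OF filt_1_least, rotated -1])
            show "module_pair R M (lead F l (K - l)) U"
              by (rule module_pairI[OF filt_familyD(1)[OF lfam] U filt_familyD(2)[OF lfam]])
            show "U \<subseteq> ?T"
            proof
              fix y assume y: "y \<in> U"
              then have "(x [^] l) \<odot>\<^bsub>M\<^esub> y \<in> U"
                using x submodule_smult[OF U] by simp
              then have "\<zero>\<^bsub>M\<^esub> \<oplus>\<^bsub>M\<^esub> (x [^] l) \<odot>\<^bsub>M\<^esub> y \<in> ?Z"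
                using submodule_carrier[OF U] by (auto intro: filt_base)
              then show "y \<in> ?T"
                using y submodule_carrier[OF U] submodule_zero[OF low_submodule] by blast
            qed
            show "s \<odot>\<^bsub>M\<^esub> y \<in> ?T" if s: "s \<in> S" and y: "y \<in> lead F l (K - l)" for s y
            proof -
              from y obtain w' where w': "y \<in> filt W U S (K - l)" "w' \<in> low S x l (K - l + l)"
                "w' \<oplus>\<^bsub>M\<^esub> (x [^] l) \<odot>\<^bsub>M\<^esub> y \<in> F (K - l + l)"
                by (rule leadE)
              have kl: "K - l + l = K" using True K by simp
              have sR: "s \<in> carrier R" using s S by auto
              have yM: "y \<in> carrier M" using w' filt_carrier by simp
              have "s \<odot>\<^bsub>M\<^esub> (w' \<oplus>\<^bsub>M\<^esub> (x [^] l) \<odot>\<^bsub>M\<^esub> y) = s \<odot>\<^bsub>M\<^esub> w' \<oplus>\<^bsub>M\<^esub> (x [^] l) \<odot>\<^bsub>M\<^esub> (s \<odot>\<^bsub>M\<^esub> y)"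
                using w' sR x yM low_carrier smult_assoc1[of s "x [^] l" y] smult_assoc1[of "x [^] l" s y]
                  R.m_comm[of s "x [^] l"] by (simp add: smult_r_distr)
              then have "s \<odot>\<^bsub>M\<^esub> w' \<oplus>\<^bsub>M\<^esub> (x [^] l) \<odot>\<^bsub>M\<^esub> (s \<odot>\<^bsub>M\<^esub> y) \<in> ?Z"
                using Zs[OF _ w'(3)[unfolded kl], of s] s by simp
              moreover have "s \<odot>\<^bsub>M\<^esub> w' \<in> low S x l (Suc K)"
                using low_shift_S[OF s l w'(2)[unfolded kl]] .
              ultimately show ?thesis
                using sR yM by auto
            qed
            show "submodule ?T R M"
            proof (rule submoduleI')
              show "\<zero>\<^bsub>M\<^esub> \<in> ?T"
                using x submodule_zero[OF low_submodule] submodule_zero[OF Z]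
                by (auto intro!: bexI[of _ "\<zero>\<^bsub>M\<^esub>"])
            next
              fix a b assume "a \<in> ?T" "b \<in> ?T"
              then obtain v w where vw: "a \<in> carrier M" "b \<in> carrier M" "v \<in> low S x l (Suc K)" "w \<in> low S x l (Suc K)"
                "v \<oplus>\<^bsub>M\<^esub> (x [^] l) \<odot>\<^bsub>M\<^esub> a \<in> ?Z" "w \<oplus>\<^bsub>M\<^esub> (x [^] l) \<odot>\<^bsub>M\<^esub> b \<in> ?Z" by auto
              have "(v \<oplus>\<^bsub>M\<^esub> w) \<oplus>\<^bsub>M\<^esub> (x [^] l) \<odot>\<^bsub>M\<^esub> (a \<oplus>\<^bsub>M\<^esub> b) =
                  (v \<oplus>\<^bsub>M\<^esub> (x [^] l) \<odot>\<^bsub>M\<^esub> a) \<oplus>\<^bsub>M\<^esub> (w \<oplus>\<^bsub>M\<^esub> (x [^] l) \<odot>\<^bsub>M\<^esub> b)"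
                using vw x low_carrier by (simp add: smult_r_distr add_interchange)
              with submodule_add[OF Z vw(5,6)] submodule_add[OF low_submodule vw(3,4)] vw(1,2)
              show "a \<oplus>\<^bsub>M\<^esub> b \<in> ?T" by (auto intro!: bexI[of _ "v \<oplus>\<^bsub>M\<^esub> w"])
            next
              fix r a assume r: "r \<in> carrier R" and "a \<in> ?T"
              then obtain v where v: "a \<in> carrier M" "v \<in> low S x l (Suc K)" "v \<oplus>\<^bsub>M\<^esub> (x [^] l) \<odot>\<^bsub>M\<^esub> a \<in> ?Z" by auto
              have "r \<odot>\<^bsub>M\<^esub> (v \<oplus>\<^bsub>M\<^esub> (x [^] l) \<odot>\<^bsub>M\<^esub> a) = r \<odot>\<^bsub>M\<^esub> v \<oplus>\<^bsub>M\<^esub> (x [^] l) \<odot>\<^bsub>M\<^esub> (r \<odot>\<^bsub>M\<^esub> a)"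
                using v r x low_carrier smult_assoc1[of r "x [^] l" a] smult_assoc1[of "x [^] l" r a]
                  R.m_comm[of r "x [^] l"] by (simp add: smult_r_distr)
              with submodule_smult[OF Z r v(3)] submodule_smult[OF low_submodule r v(2)] v(1) r
              show "r \<odot>\<^bsub>M\<^esub> a \<in> ?T" by (auto intro!: bexI[of _ "r \<odot>\<^bsub>M\<^esub> v"])
            qed auto
          qed
          then show ?thesis by simp
        qed
        then obtain w' where w': "w' \<in> low S x l (Suc K)" "w' \<oplus>\<^bsub>M\<^esub> (x [^] l) \<odot>\<^bsub>M\<^esub> g \<in> ?Z" by auto
        have c: "w \<in> carrier M" "w' \<in> carrier M" "(x [^] l) \<odot>\<^bsub>M\<^esub> g \<in> carrier M"
          using w' g x low_carrier filt_carrier by auto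
        then have "u \<ominus>\<^bsub>M\<^esub> (w' \<oplus>\<^bsub>M\<^esub> (x [^] l) \<odot>\<^bsub>M\<^esub> g) = w \<ominus>\<^bsub>M\<^esub> w'"
          unfolding g(3) by (simp add: minus_interchange) (simp add: M.minus_eq M.r_neg)
        then have "u \<ominus>\<^bsub>M\<^esub> (w' \<oplus>\<^bsub>M\<^esub> (x [^] l) \<odot>\<^bsub>M\<^esub> g) \<in> F (Suc K) \<inter> low S x l (Suc K)"
          using submodule_minus[OF fam(1) _ subsetD[OF ZF w'(2)], of u] u submodule_minus[OF low_submodule g(1) w'(1)] by auto
        then have "u \<ominus>\<^bsub>M\<^esub> (w' \<oplus>\<^bsub>M\<^esub> (x [^] l) \<odot>\<^bsub>M\<^esub> g) \<in> ?Z"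
          using Suc by auto
        moreover have "u \<in> carrier M"
          using u submodule_carrier[OF fam(1)] by blast
        ultimately show "u \<in> ?Z"
          using submodule_mem_cancel'[OF Z _ w'(2)] by blast
      qed
    qed
    from this[of "Suc (Suc K)"] show ?thesis
      using fam(3)[of "Suc K"] filt_insert_subset_low[of "Suc K"] by auto
  qed
  then show ?thesis by (auto simp: stable_from_def)
qed

end

lemma ex_stable_from:
  assumes "finite S" "S \<subseteq> carrier R" "filt_family S F"
  shows "\<exists>p. stable_from S F p"
  using assms
proof (induction S arbitrary: F rule: finite_induct)
  case empty
  \<comment> \<open>Without generators all levels above 0 collapse to \<open>U\<close>.\<close>
  have "filt W U {} (Suc k) \<subseteq> U" for k
  proof
    fix x assume "x \<in> filt W U {} (Suc k)"
    then have "x \<in> (if Suc k = 0 then carrier M else U)"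
      by (rule filt_least) (use submodule_add[OF U] submodule_carrier[OF U] submodule_carrier[OF W] in auto)
    then show "x \<in> U" by simp
  qed
  then have "stable_from {} F 0"
    using filt_familyD(3)[OF empty(2)] unfolding stable_from_def by (blast intro: filt_base)
  then show ?case by blast
next
  case (insert x S)
  then show ?case
    by (intro stable_from_insert) auto
qed

text \<open>The traces of the filtration on \<open>B\<close> are a graded submodule of the Rees
  module; the degree from which it is stable is the Artin-Rees shift.\<close>

lemma artin_rees_finite:
  assumes S: "finite S" "S \<subseteq> carrier R" and B: "submodule B R M" "U \<subseteq> B" "B \<subseteq> W"
  shows "\<exists>p. \<forall>k. B \<inter> filt W U S (k + p) \<subseteq> filt B U S k"
proof -
  have "filt_family S (\<lambda>k. B \<inter> filt W U S k)"
    unfolding filt_family_def using S B submodule_Int[OF B(1) filt_submodule[OF S(2)]]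
    by (auto intro: filt_base filt_smult submodule_smult)
  from ex_stable_from[OF S this] obtain p where p: "stable_from S (\<lambda>k. B \<inter> filt W U S k) p" by auto
  have "B \<inter> filt W U S (p + k) \<subseteq> filt B U S k" for k
  proof (induction k)
    case 0
    then show ?case by (auto intro: filt_0I)
  next
    case (Suc k)
    have "B \<inter> filt W U S (Suc (p + k)) \<subseteq> filt (B \<inter> filt W U S (p + k)) U S 1"
      using p by (simp add: stable_from_def)
    also have "\<dots> \<subseteq> filt (filt B U S k) U S 1"
      by (intro filt_mono Suc) auto
    also have "\<dots> \<subseteq> filt B U S (Suc k)"
      using filt_trans[of B U S k 1] by simp
    finally show ?case by simp
  qed
  then show ?thesis by (metis add.commute)
qed

end

section \<open>Nakayama and Krull\<close>

context module
begin

lemma colon_ideal: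
  assumes "submodule B R M" "X \<subseteq> carrier M"
  shows "ideal {r \<in> carrier R. \<forall>x\<in>X. r \<odot>\<^bsub>M\<^esub> x \<in> B} R" (is "ideal ?I R")
proof (rule idealI)
  show "ring R" by (rule R.ring_axioms)
  show smul: "a \<otimes> r \<in> ?I" if "r \<in> ?I" "a \<in> carrier R" for r a
    using that assms submodule_smult[OF assms(1)] by (auto simp: smult_assoc1 subset_iff)
  then show "r \<otimes> a \<in> ?I" if "r \<in> ?I" "a \<in> carrier R" for r a
    using that R.m_comm[of r a] by auto
  show "subgroup ?I (add_monoid R)"
  proof (rule R.add.subgroupI)
    show "?I \<noteq> {}"
      using submodule_zero[OF assms(1)] assms(2) by (auto intro!: exI[of _ \<zero>] simp: subset_iff)
    fix r assume r: "r \<in> ?I"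
    then show "\<ominus> r \<in> ?I"
      using smul[OF r, of "\<ominus> \<one>"] by (simp add: l_minus)
  next
    fix r s assume "r \<in> ?I" "s \<in> ?I"
    then show "r \<oplus> s \<in> ?I"
      using submodule_add[OF assms(1)] assms(2) by (auto simp: smult_l_distr subset_iff)
  qed auto
qed

text \<open>The scalars that send \<open>X\<close> into \<open>B\<close> form an ideal, so testing
  generators is enough.\<close>

lemma genideal_smult_mem:
  assumes "S \<subseteq> carrier R" "submodule B R M" "X \<subseteq> carrier M"
    and "\<And>s x. \<lbrakk>s \<in> S; x \<in> X\<rbrakk> \<Longrightarrow> s \<odot>\<^bsub>M\<^esub> x \<in> B"
    and "r \<in> Idl S" "x \<in> X"
  shows "r \<odot>\<^bsub>M\<^esub> x \<in> B"
proof -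
  have "Idl S \<subseteq> {r \<in> carrier R. \<forall>x\<in>X. r \<odot>\<^bsub>M\<^esub> x \<in> B}"
    by (rule R.genideal_minimal[OF colon_ideal[OF assms(2,3)]]) (use assms(1,4) in auto)
  with assms(5,6) show ?thesis by auto
qed

lemma ideal_smult_submodule:
  assumes "J \<subseteq> carrier R"
  shows "submodule (ideal_smult R J M) R M"
  unfolding ideal_smult_def by (rule span_submodule) (use assms in auto)

lemma ideal_smultI: "\<lbrakk>r \<in> J; x \<in> carrier M\<rbrakk> \<Longrightarrow> r \<odot>\<^bsub>M\<^esub> x \<in> ideal_smult R J M"
  unfolding ideal_smult_def using span_superset by fastforce

lemma ideal_smult_least:
  assumes "submodule B R M" "\<And>r x. \<lbrakk>r \<in> J; x \<in> carrier M\<rbrakk> \<Longrightarrow> r \<odot>\<^bsub>M\<^esub> x \<in> B"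
  shows "ideal_smult R J M \<subseteq> B"
  unfolding ideal_smult_def using assms by (intro span_least) auto

lemma ideal_smult_mono:
  assumes "J \<subseteq> J'" "J' \<subseteq> carrier R"
  shows "ideal_smult R J M \<subseteq> ideal_smult R J' M"
  using assms by (intro ideal_smult_least ideal_smult_submodule ideal_smultI) auto

lemma submodule_finsum:
  assumes "submodule B R M" "finite X" "\<And>i. i \<in> X \<Longrightarrow> f i \<in> B"
  shows "finsum M f X \<in> B"
  using assms(2,3)
proof (induction X rule: finite_induct)
  case empty
  then show ?case using submodule_zero[OF assms(1)] by simp
next
  case (insert i X)
  then have "f \<in> X \<rightarrow> carrier M" "f i \<in> carrier M"
    using submodule_carrier[OF assms(1)] by auto
  with insert show ?case
    using submodule_add[OF assms(1)] by simp
qed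

lemma lincomb_submodule:
  assumes "finite X" "f \<in> X \<rightarrow> carrier R" "submodule B R M"
  shows "submodule {\<Oplus>\<^bsub>M\<^esub>i\<in>X. f i \<odot>\<^bsub>M\<^esub> y i | y. y \<in> X \<rightarrow> B} R M" (is "submodule ?E R M")
proof -
  note c = submodule_carrier[OF assms(3)]
  have cl: "(\<lambda>i. f i \<odot>\<^bsub>M\<^esub> y i) \<in> X \<rightarrow> carrier M" if "y \<in> X \<rightarrow> B" for y
    using that assms c by (fastforce simp: Pi_iff)
  show ?thesis
  proof (rule submoduleI')
    show "?E \<subseteq> carrier M"
      using cl by auto
    have "(\<Oplus>\<^bsub>M\<^esub>i\<in>X. f i \<odot>\<^bsub>M\<^esub> \<zero>\<^bsub>M\<^esub>) = \<zero>\<^bsub>M\<^esub>"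
      using assms by (intro M.add.finprod_one_eqI) (auto simp: Pi_iff)
    then show "\<zero>\<^bsub>M\<^esub> \<in> ?E"
      using submodule_zero[OF assms(3)] by (auto intro!: exI[of _ "\<lambda>_. \<zero>\<^bsub>M\<^esub>"])
  next
    fix a b assume "a \<in> ?E" "b \<in> ?E"
    then obtain y z where y: "y \<in> X \<rightarrow> B" "a = (\<Oplus>\<^bsub>M\<^esub>i\<in>X. f i \<odot>\<^bsub>M\<^esub> y i)"
      and z: "z \<in> X \<rightarrow> B" "b = (\<Oplus>\<^bsub>M\<^esub>i\<in>X. f i \<odot>\<^bsub>M\<^esub> z i)" by auto
    have "(\<Oplus>\<^bsub>M\<^esub>i\<in>X. f i \<odot>\<^bsub>M\<^esub> (y i \<oplus>\<^bsub>M\<^esub> z i)) = (\<Oplus>\<^bsub>M\<^esub>i\<in>X. f i \<odot>\<^bsub>M\<^esub> y i \<oplus>\<^bsub>M\<^esub> f i \<odot>\<^bsub>M\<^esub> z i)"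
      using y z assms c cl by (intro M.finsum_cong') (auto simp: Pi_iff smult_r_distr)
    then have "a \<oplus>\<^bsub>M\<^esub> b = (\<Oplus>\<^bsub>M\<^esub>i\<in>X. f i \<odot>\<^bsub>M\<^esub> (y i \<oplus>\<^bsub>M\<^esub> z i))"
      using y z cl by (simp add: M.finsum_addf)
    then show "a \<oplus>\<^bsub>M\<^esub> b \<in> ?E"
      using y z submodule_add[OF assms(3)] by (auto intro!: exI[of _ "\<lambda>i. y i \<oplus>\<^bsub>M\<^esub> z i"] simp: Pi_iff)
  next
    fix r a assume r: "r \<in> carrier R" and "a \<in> ?E"
    then obtain y where y: "y \<in> X \<rightarrow> B" "a = (\<Oplus>\<^bsub>M\<^esub>i\<in>X. f i \<odot>\<^bsub>M\<^esub> y i)" by auto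
    have "(\<Oplus>\<^bsub>M\<^esub>i\<in>X. f i \<odot>\<^bsub>M\<^esub> (r \<odot>\<^bsub>M\<^esub> y i)) = (\<Oplus>\<^bsub>M\<^esub>i\<in>X. r \<odot>\<^bsub>M\<^esub> (f i \<odot>\<^bsub>M\<^esub> y i))"
    proof (rule M.finsum_cong')
      show "(\<lambda>i. r \<odot>\<^bsub>M\<^esub> (f i \<odot>\<^bsub>M\<^esub> y i)) \<in> X \<rightarrow> carrier M"
        using cl[OF y(1)] r by auto
      fix i assume "i \<in> X"
      then have "f i \<in> carrier R" "y i \<in> carrier M" using y assms c by auto
      then show "f i \<odot>\<^bsub>M\<^esub> (r \<odot>\<^bsub>M\<^esub> y i) = r \<odot>\<^bsub>M\<^esub> (f i \<odot>\<^bsub>M\<^esub> y i)"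
        using r smult_assoc1[of r "f i" "y i"] smult_assoc1[of "f i" r "y i"] R.m_comm[of r "f i"] by simp
    qed simp
    then have "r \<odot>\<^bsub>M\<^esub> a = (\<Oplus>\<^bsub>M\<^esub>i\<in>X. f i \<odot>\<^bsub>M\<^esub> (r \<odot>\<^bsub>M\<^esub> y i))"
      using y cl finsum_smult_ldistr[OF assms(1) r] by simp
    then show "r \<odot>\<^bsub>M\<^esub> a \<in> ?E"
      using y r submodule_smult[OF assms(3)] by (auto intro!: exI[of _ "\<lambda>i. r \<odot>\<^bsub>M\<^esub> y i"] simp: Pi_iff)
  qed
qed

lemma lincomb_single:
  assumes "finite X" "f \<in> X \<rightarrow> carrier R" "j \<in> X" "x \<in> carrier M"
  shows "(\<Oplus>\<^bsub>M\<^esub>i\<in>X. f i \<odot>\<^bsub>M\<^esub> (if i = j then x else \<zero>\<^bsub>M\<^esub>)) = f j \<odot>\<^bsub>M\<^esub> x"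
proof -
  have "(\<Oplus>\<^bsub>M\<^esub>i\<in>X. f i \<odot>\<^bsub>M\<^esub> (if i = j then x else \<zero>\<^bsub>M\<^esub>)) = (\<Oplus>\<^bsub>M\<^esub>i\<in>X. if j = i then f i \<odot>\<^bsub>M\<^esub> x else \<zero>\<^bsub>M\<^esub>)"
    using assms by (intro M.finsum_cong') (auto simp: Pi_iff)
  also have "\<dots> = f j \<odot>\<^bsub>M\<^esub> x"
    using assms by (intro M.add.finprod_singleton) (auto simp: Pi_iff)
  finally show ?thesis .
qed

lemma ideal_smult_genideal:
  assumes "finite X" "f \<in> X \<rightarrow> carrier R"
  shows "ideal_smult R (Idl (f ` X)) M = {\<Oplus>\<^bsub>M\<^esub>i\<in>X. f i \<odot>\<^bsub>M\<^esub> y i | y. y \<in> X \<rightarrow> carrier M}" (is "_ = ?E")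
proof
  have fX: "f ` X \<subseteq> carrier R" using assms by auto
  note E = lincomb_submodule[OF assms carrier_is_submodule]
  have fE: "f j \<odot>\<^bsub>M\<^esub> x \<in> ?E" if "j \<in> X" "x \<in> carrier M" for j x
    using lincomb_single[OF assms that, symmetric] that
    by (auto intro!: exI[of _ "\<lambda>i. if i = j then x else \<zero>\<^bsub>M\<^esub>"])
  show "ideal_smult R (Idl (f ` X)) M \<subseteq> ?E"
  proof (rule ideal_smult_least[OF E])
    fix r x assume "r \<in> Idl (f ` X)" "x \<in> carrier M"
    then show "r \<odot>\<^bsub>M\<^esub> x \<in> ?E"
      by (rule genideal_smult_mem[OF fX E order_refl, rotated]) (use fE in blast)
  qed
  have s: "submodule (ideal_smult R (Idl (f ` X)) M) R M"
    by (intro ideal_smult_submodule ideal.Icarr[OF R.genideal_ideal[OF fX]] subsetI)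
  show "?E \<subseteq> ideal_smult R (Idl (f ` X)) M"
  proof
    fix z assume "z \<in> ?E"
    then obtain y where y: "y \<in> X \<rightarrow> carrier M" "z = (\<Oplus>\<^bsub>M\<^esub>i\<in>X. f i \<odot>\<^bsub>M\<^esub> y i)" by blast
    show "z \<in> ideal_smult R (Idl (f ` X)) M"
      unfolding y(2)
    proof (rule submodule_finsum[OF s assms(1)])
      fix i assume "i \<in> X"
      then show "f i \<odot>\<^bsub>M\<^esub> y i \<in> ideal_smult R (Idl (f ` X)) M"
        using R.genideal_self[OF fX] y(1) by (intro ideal_smultI) auto
    qed
  qed
qed

end

context noeth_module
begin

lemma artin_rees:
  assumes N: "noeth_between U W" and J: "ideal J R" and B: "submodule B R M" "U \<subseteq> B" "B \<subseteq> W"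
  obtains p where "\<And>k. B \<inter> filt W U J (k + p) \<subseteq> filt B U J k"
proof -
  interpret noeth_pair R M W U
    by (intro noeth_pair.intro noeth_pair_axioms.intro N module_pairI[OF noeth_betweenD(2,1,3)[OF N]])
  obtain S where S: "S \<subseteq> carrier R" "finite S" "J = Idl S"
    using finetely_gen[OF J] by auto
  obtain p where "\<And>k. B \<inter> filt W U S (k + p) \<subseteq> filt B U S k"
    using artin_rees_finite[OF S(2,1) B] by auto
  moreover have "filt B U S k \<subseteq> filt B U J k" for k
    using S R.genideal_self by (intro filt_mono) auto
  ultimately show thesis
    using that unfolding S(3) filt_genideal[OF S(1)] by (meson subset_trans)
qed

text \<open>The premise \<open>gen\<close> expresses that \<open>D\<close> lies in \<mm>D + U
  without forming that submodule, and \<open>m\<close> says that \<mm> is contained in the Jacobson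
  radical. The chain condition gives a maximal \<open>B\<close> among the submodules that contain
  \<open>U\<close> and are properly contained in \<open>D\<close>. If r x is outside
  \<open>B\<close>, then B + R r x = D, so x = b + s r x; as 1 - s r is a unit, \<open>x\<close>
  lies in \<open>B\<close>, and so does r x.\<close>

lemma nakayama:
  assumes m: "\<And>r. r \<in> \<mm> \<Longrightarrow> r \<in> carrier R \<and> (\<forall>s\<in>carrier R. \<one> \<ominus> s \<otimes> r \<in> Units R)"
    and D: "noeth_between U D"
    and gen: "\<And>B. \<lbrakk>submodule B R M; U \<subseteq> B; \<And>r x. \<lbrakk>r \<in> \<mm>; x \<in> D\<rbrakk> \<Longrightarrow> r \<odot>\<^bsub>M\<^esub> x \<in> B\<rbrakk> \<Longrightarrow> D \<subseteq> B"
  shows "D \<subseteq> U"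
proof (rule ccontr)
  assume "\<not> D \<subseteq> U"
  note D' = noeth_betweenD[OF D]
  let ?C = "{B. submodule B R M \<and> U \<subseteq> B \<and> B \<subset> D}"
  have "U \<in> ?C" using D' \<open>\<not> D \<subseteq> U\<close> by auto
  then obtain B where B: "B \<in> ?C" "\<And>B'. \<lbrakk>B' \<in> ?C; B \<subseteq> B'\<rbrakk> \<Longrightarrow> B' = B"
    by (rule noeth_between_maximal[OF D]) auto
  then have Bs: "submodule B R M" by simp
  have "\<not> (\<forall>r\<in>\<mm>. \<forall>x\<in>D. r \<odot>\<^bsub>M\<^esub> x \<in> B)"
    using gen[OF Bs] B(1) by auto
  then obtain r x where rx: "r \<in> \<mm>" "x \<in> D" "r \<odot>\<^bsub>M\<^esub> x \<notin> B" by blast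
  have r: "r \<in> carrier R" and x: "x \<in> carrier M"
    using m rx submodule_carrier[OF D'(2)] by auto
  let ?X = "{s \<odot>\<^bsub>M\<^esub> (r \<odot>\<^bsub>M\<^esub> x) | s. s \<in> carrier R}"
  have X: "submodule ?X R M" using r x by (intro cyclic_submodule) simp
  have "r \<odot>\<^bsub>M\<^esub> x \<in> ?X"
    using r x by (auto intro!: exI[of _ \<one>])
  then have "msum B ?X \<noteq> B"
    using msum_upper[OF Bs X] rx(3) by auto
  moreover have "?X \<subseteq> D"
    using submodule_smult[OF D'(2)] r rx(2) by auto
  then have "msum B ?X \<subseteq> D"
    using B by (intro msum_least[OF D'(2)]) auto
  ultimately have "D \<subseteq> msum B ?X"
    using B(2)[of "msum B ?X"] msum_submodule[OF Bs X] msum_upper[OF Bs X] B(1) by blast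
  then obtain b s where bs: "b \<in> B" "s \<in> carrier R" "x = b \<oplus>\<^bsub>M\<^esub> s \<odot>\<^bsub>M\<^esub> (r \<odot>\<^bsub>M\<^esub> x)"
    using rx(2) by (blast elim: msumE)
  let ?u = "\<one> \<ominus> s \<otimes> r"
  have u: "?u \<in> Units R" using m rx(1) bs(2) by auto
  have bM: "b \<in> carrier M" using submodule_carrier[OF Bs bs(1)] .
  have "?u \<odot>\<^bsub>M\<^esub> x = x \<ominus>\<^bsub>M\<^esub> s \<odot>\<^bsub>M\<^esub> (r \<odot>\<^bsub>M\<^esub> x)"
    using r x bs(2) by (simp add: R.minus_eq smult_l_distr smult_l_minus smult_assoc1 M.minus_eq)
  also have "\<dots> = b"
    using bs r x bM minus_cancel(3)[of b "s \<odot>\<^bsub>M\<^esub> (r \<odot>\<^bsub>M\<^esub> x)"] by simp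
  finally have "(inv ?u) \<odot>\<^bsub>M\<^esub> (?u \<odot>\<^bsub>M\<^esub> x) \<in> B"
    using bs(1) u submodule_smult[OF Bs] by simp
  moreover have "(inv ?u) \<odot>\<^bsub>M\<^esub> (?u \<odot>\<^bsub>M\<^esub> x) = x"
    using u x smult_assoc1[of "inv ?u" ?u x] R.Units_closed[OF u] by simp
  ultimately have "x \<in> B" by simp
  then show False
    using rx(3) submodule_smult[OF Bs r] by simp
qed

text \<open>By the Artin-Rees lemma the intersection \<open>D\<close> of all levels is contained in
  JD + U, and Nakayama's lemma applies to it. The result is that W/U is separated for the J-adic
  topology.\<close>

lemma krull_intersection:
  assumes m: "\<And>r. r \<in> \<mm> \<Longrightarrow> r \<in> carrier R \<and> (\<forall>s\<in>carrier R. \<one> \<ominus> s \<otimes> r \<in> Units R)"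
    and J: "ideal J R" "J \<subseteq> \<mm>"
    and N: "noeth_between U W" and x: "\<And>k. x \<in> filt W U J k"
  shows "x \<in> U"
proof -
  interpret module_pair R M W U
    by (rule module_pairI[OF noeth_betweenD(2,1,3)[OF N]])
  have JR: "J \<subseteq> carrier R" using ideal.Icarr[OF J(1)] by auto
  define D where "D = (\<Inter>k. filt W U J k)"
  have D: "submodule D R M" "U \<subseteq> D" "D \<subseteq> W"
    unfolding D_def using submodule_Inter[OF filt_submodule[OF JR]] filt_subset[OF JR, of 0] by (auto intro: filt_base)
  have ND: "noeth_between U D"
    using noeth_between_mono[OF N U D(1)] D by auto
  obtain p where p: "\<And>k. D \<inter> filt W U J (k + p) \<subseteq> filt D U J k"
    using artin_rees[OF N J(1) D] by blast
  have "D \<subseteq> U"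
  proof (rule nakayama[OF m ND])
    fix B assume B: "submodule B R M" "U \<subseteq> B" "\<And>r x. \<lbrakk>r \<in> \<mm>; x \<in> D\<rbrakk> \<Longrightarrow> r \<odot>\<^bsub>M\<^esub> x \<in> B"
    have "D \<subseteq> filt D U J 1"
      using p[of 1] by (auto simp: D_def)
    also have "\<dots> \<subseteq> B"
      by (rule filt_1_least[OF B(1,2)]) (use B(3) J module_pairI[OF D(1) U D(2)] in auto)
    finally show "D \<subseteq> B" .
  qed
  with x show ?thesis by (auto simp: D_def)
qed

section \<open>Finitely generated modules and their surjective endomorphisms\<close>

lemma fin_gen_noeth:
  assumes "fin_gen_module R M"
  shows "noeth_between {\<zero>\<^bsub>M\<^esub>} (carrier M)"
proof -
  from assms obtain S where S: "finite S" "S \<subseteq> carrier M" "module_span R M S = carrier M"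
    by (auto simp: fin_gen_module_def)
  show ?thesis
    by (rule noeth_between_span[OF zero_submodule S(1,2) carrier_is_submodule])
      (use S(3) msum_upper[OF carrier_is_submodule zero_submodule] in auto)
qed

text \<open>The kernels of the powers of \<phi> become stationary, say at \<open>p\<close>. By
  surjectivity x = \<phi>^p(y); then \<open>y\<close> is killed by the power p + 1, hence already by
  the power \<open>p\<close>, which means x = 0.\<close>

lemma surj_endo_inj:
  assumes N: "noeth_between {\<zero>\<^bsub>M\<^esub>} (carrier M)"
    and phi: "\<phi> \<in> carrier M \<rightarrow> carrier M" "\<phi> ` carrier M = carrier M"
    and add: "\<And>x y. \<lbrakk>x \<in> carrier M; y \<in> carrier M\<rbrakk> \<Longrightarrow> \<phi> (x \<oplus>\<^bsub>M\<^esub> y) = \<phi> x \<oplus>\<^bsub>M\<^esub> \<phi> y"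
    and smult: "\<And>r x. \<lbrakk>r \<in> carrier R; x \<in> carrier M\<rbrakk> \<Longrightarrow> \<phi> (r \<odot>\<^bsub>M\<^esub> x) = r \<odot>\<^bsub>M\<^esub> \<phi> x"
    and x: "x \<in> carrier M" "\<phi> x = \<zero>\<^bsub>M\<^esub>"
  shows "x = \<zero>\<^bsub>M\<^esub>"
proof -
  have pc: "(\<phi> ^^ k) y \<in> carrier M" if "y \<in> carrier M" for k y
    using that phi(1) by (induction k) auto
  have padd: "(\<phi> ^^ k) (y \<oplus>\<^bsub>M\<^esub> z) = (\<phi> ^^ k) y \<oplus>\<^bsub>M\<^esub> (\<phi> ^^ k) z" if "y \<in> carrier M" "z \<in> carrier M" for k y z
    using that pc add by (induction k) auto
  have psmult: "(\<phi> ^^ k) (r \<odot>\<^bsub>M\<^esub> y) = r \<odot>\<^bsub>M\<^esub> (\<phi> ^^ k) y" if "y \<in> carrier M" "r \<in> carrier R" for k y r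
    using that pc smult by (induction k) auto
  have p0: "\<phi> \<zero>\<^bsub>M\<^esub> = \<zero>\<^bsub>M\<^esub>"
    using smult[of \<zero> "\<zero>\<^bsub>M\<^esub>"] funcset_mem[OF phi(1) M.zero_closed] by simp
  have pz: "(\<phi> ^^ k) \<zero>\<^bsub>M\<^esub> = \<zero>\<^bsub>M\<^esub>" for k
    using p0 by (induction k) auto
  have surj: "\<exists>y\<in>carrier M. (\<phi> ^^ k) y = z" if "z \<in> carrier M" for k z
    using that
  proof (induction k arbitrary: z)
    case (Suc k)
    then obtain w where "w \<in> carrier M" "\<phi> w = z" using phi(2) by (metis imageE)
    with Suc.IH[of w] show ?case by auto
  qed auto
  define K where "K k = {y \<in> carrier M. (\<phi> ^^ k) y = \<zero>\<^bsub>M\<^esub>}" for k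
  obtain p where p: "\<And>k. k \<ge> p \<Longrightarrow> K k = K p"
  proof (rule noeth_between_chain[OF N, of K])
    show "submodule (K k) R M" for k
      by (rule submoduleI') (auto simp: K_def padd psmult pz)
  qed (auto simp: K_def pz p0)
  obtain y where y: "y \<in> carrier M" "(\<phi> ^^ p) y = x"
    using surj[OF x(1)] by auto
  then have "y \<in> K (Suc p)"
    using x by (auto simp: K_def)
  then have "y \<in> K p" using p[of "Suc p"] by simp
  with y show ?thesis by (simp add: K_def)
qed

end

section \<open>Surjections and bases\<close>

lemma abelian_group_transfer:
  assumes "abelian_group G" "carrier H = carrier G" "add H = add G" "zero H = zero G"
  shows "abelian_group H"
proof -
  interpret G: abelian_group G by fact
  show ?thesis
    by (rule abelian_groupI) (use assms G.a_assoc G.a_comm G.l_neg in \<open>auto intro: G.a_inv_closed\<close>)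
qed

lemma ring_as_module_module:
  assumes "cring A" "cring S" "\<phi> \<in> ring_hom A S"
  shows "module A (ring_as_module \<phi> S)"
proof -
  interpret A: cring A by fact
  interpret S: cring S by fact
  interpret h: ring_hom_cring A S \<phi>
    by (intro ring_hom_cring.intro ring_hom_cring_axioms.intro assms)
  show ?thesis
  proof (rule moduleI)
    show "abelian_group (ring_as_module \<phi> S)"
      by (rule abelian_group_transfer[OF S.is_abelian_group]) (simp_all add: ring_as_module_def)
  qed (use assms in \<open>simp_all add: ring_as_module_def S.l_distr S.r_distr S.m_assoc\<close>)
qed

lemma restrict_scalars_simps [simp]:
  "carrier (restrict_scalars h M) = carrier M" "zero (restrict_scalars h M) = zero M"
  "add (restrict_scalars h M) = add M" "smult (restrict_scalars h M) a x = smult M (h a) x"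
  by (simp_all add: restrict_scalars_def)

lemma ring_as_module_simps [simp]:
  "carrier (ring_as_module h S) = carrier S" "zero (ring_as_module h S) = zero S"
  "add (ring_as_module h S) = add S" "smult (ring_as_module h S) a x = h a \<otimes>\<^bsub>S\<^esub> x"
  by (simp_all add: ring_as_module_def)

lemma restrict_scalars_module:
  fixes A (structure) and R (structure)
  assumes "cring A" "h \<in> ring_hom A R" "module R M"
  shows "module A (restrict_scalars h M)"
proof -
  interpret A: cring A by fact
  interpret M: module R M by fact
  interpret h: ring_hom_cring A R h
    by (intro ring_hom_cring.intro ring_hom_cring_axioms.intro assms M.R.is_cring)
  show ?thesis
  proof (rule moduleI)
    show "abelian_group (restrict_scalars h M)"
      by (rule abelian_group_transfer[OF M.M.abelian_group_axioms]) simp_all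
  qed (use assms in \<open>simp_all add: M.smult_l_distr M.smult_r_distr M.smult_assoc1\<close>)
qed

lemma finsum_hom:
  assumes "abelian_monoid G" "abelian_monoid H" "f \<in> carrier G \<rightarrow> carrier H" "f \<zero>\<^bsub>G\<^esub> = \<zero>\<^bsub>H\<^esub>"
    and "\<And>x y. \<lbrakk>x \<in> carrier G; y \<in> carrier G\<rbrakk> \<Longrightarrow> f (x \<oplus>\<^bsub>G\<^esub> y) = f x \<oplus>\<^bsub>H\<^esub> f y"
    and "finite X" "g \<in> X \<rightarrow> carrier G"
  shows "f (finsum G g X) = finsum H (\<lambda>i. f (g i)) X"
proof -
  interpret G: abelian_monoid G by fact
  interpret H: abelian_monoid H by fact
  show ?thesis
    using assms(6,7)
  proof (induction X rule: finite_induct)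
    case (insert i X)
    then have "(\<lambda>i. f (g i)) \<in> X \<rightarrow> carrier H" "f (g i) \<in> carrier H"
      using assms(3) by auto
    with insert show ?case using assms(5) by (simp add: Pi_iff)
  qed (simp add: assms(4))
qed

context module
begin

lemma coeff_span_submodule:
  assumes "finite X" "v \<in> X \<rightarrow> carrier M" "ideal K R"
  shows "submodule {\<Oplus>\<^bsub>M\<^esub>i\<in>X. a i \<odot>\<^bsub>M\<^esub> v i | a. a \<in> X \<rightarrow> K} R M" (is "submodule ?E R M")
proof -
  interpret K: ideal K R by fact
  have cl: "(\<lambda>i. a i \<odot>\<^bsub>M\<^esub> v i) \<in> X \<rightarrow> carrier M" if "a \<in> X \<rightarrow> K" for a
    using that assms by (auto simp: Pi_iff)
  show ?thesis
  proof (rule submoduleI')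
    show "?E \<subseteq> carrier M"
      using cl by auto
    have "(\<Oplus>\<^bsub>M\<^esub>i\<in>X. \<zero> \<odot>\<^bsub>M\<^esub> v i) = \<zero>\<^bsub>M\<^esub>"
      using assms by (intro M.add.finprod_one_eqI) (auto simp: Pi_iff)
    then show "\<zero>\<^bsub>M\<^esub> \<in> ?E"
      by (auto intro!: exI[of _ "\<lambda>_. \<zero>"])
  next
    fix a b assume "a \<in> ?E" "b \<in> ?E"
    then obtain y z where y: "y \<in> X \<rightarrow> K" "a = (\<Oplus>\<^bsub>M\<^esub>i\<in>X. y i \<odot>\<^bsub>M\<^esub> v i)"
      and z: "z \<in> X \<rightarrow> K" "b = (\<Oplus>\<^bsub>M\<^esub>i\<in>X. z i \<odot>\<^bsub>M\<^esub> v i)" by auto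
    have "(\<Oplus>\<^bsub>M\<^esub>i\<in>X. (y i \<oplus> z i) \<odot>\<^bsub>M\<^esub> v i) = (\<Oplus>\<^bsub>M\<^esub>i\<in>X. y i \<odot>\<^bsub>M\<^esub> v i \<oplus>\<^bsub>M\<^esub> z i \<odot>\<^bsub>M\<^esub> v i)"
      using y z assms cl by (intro M.finsum_cong') (auto simp: Pi_iff smult_l_distr)
    then have "a \<oplus>\<^bsub>M\<^esub> b = (\<Oplus>\<^bsub>M\<^esub>i\<in>X. (y i \<oplus> z i) \<odot>\<^bsub>M\<^esub> v i)"
      using y z cl by (simp add: M.finsum_addf)
    then show "a \<oplus>\<^bsub>M\<^esub> b \<in> ?E"
      using y z by (auto intro!: exI[of _ "\<lambda>i. y i \<oplus> z i"] simp: Pi_iff)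
  next
    fix r a assume r: "r \<in> carrier R" and "a \<in> ?E"
    then obtain y where y: "y \<in> X \<rightarrow> K" "a = (\<Oplus>\<^bsub>M\<^esub>i\<in>X. y i \<odot>\<^bsub>M\<^esub> v i)" by auto
    have "(\<Oplus>\<^bsub>M\<^esub>i\<in>X. (r \<otimes> y i) \<odot>\<^bsub>M\<^esub> v i) = (\<Oplus>\<^bsub>M\<^esub>i\<in>X. r \<odot>\<^bsub>M\<^esub> (y i \<odot>\<^bsub>M\<^esub> v i))"
      using r y assms cl[OF y(1)] by (intro M.finsum_cong') (auto simp: Pi_iff smult_assoc1)
    then have "r \<odot>\<^bsub>M\<^esub> a = (\<Oplus>\<^bsub>M\<^esub>i\<in>X. (r \<otimes> y i) \<odot>\<^bsub>M\<^esub> v i)"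
      using y cl finsum_smult_ldistr[OF assms(1) r] by simp
    then show "r \<odot>\<^bsub>M\<^esub> a \<in> ?E"
      using y r K.I_l_closed by (auto intro!: exI[of _ "\<lambda>i. r \<otimes> y i"] simp: Pi_iff)
  qed
qed

lemma span_finite_family:
  assumes "finite X" "v \<in> X \<rightarrow> carrier M"
  shows "module_span R M (v ` X) = {\<Oplus>\<^bsub>M\<^esub>i\<in>X. a i \<odot>\<^bsub>M\<^esub> v i | a. a \<in> X \<rightarrow> carrier R}" (is "_ = ?E")
proof
  have vX: "v ` X \<subseteq> carrier M" using assms by auto
  show "module_span R M (v ` X) \<subseteq> ?E"
  proof (rule span_least[OF coeff_span_submodule[OF assms R.oneideal]])
    show "v ` X \<subseteq> ?E"
    proof
      fix x assume "x \<in> v ` X"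
      then obtain j where j: "j \<in> X" "x = v j" by auto
      have "(\<Oplus>\<^bsub>M\<^esub>i\<in>X. (if i = j then \<one> else \<zero>) \<odot>\<^bsub>M\<^esub> v i) = (\<Oplus>\<^bsub>M\<^esub>i\<in>X. if j = i then v i else \<zero>\<^bsub>M\<^esub>)"
        using assms by (intro M.finsum_cong') (auto simp: Pi_iff)
      also have "\<dots> = v j"
        using assms j by (intro M.add.finprod_singleton) (auto simp: Pi_iff)
      finally show "x \<in> ?E"
        using j(2) by (auto intro!: exI[of _ "\<lambda>i. if i = j then \<one> else \<zero>"])
    qed
  qed
  show "?E \<subseteq> module_span R M (v ` X)"
  proof
    fix z assume "z \<in> ?E"
    then obtain a where a: "a \<in> X \<rightarrow> carrier R" "z = (\<Oplus>\<^bsub>M\<^esub>i\<in>X. a i \<odot>\<^bsub>M\<^esub> v i)" by blast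
    show "z \<in> module_span R M (v ` X)"
      unfolding a(2)
    proof (rule submodule_finsum[OF span_submodule[OF vX] assms(1)])
      fix i assume "i \<in> X"
      then show "a i \<odot>\<^bsub>M\<^esub> v i \<in> module_span R M (v ` X)"
        using span_superset[of "v ` X"] a(1) by (intro submodule_smult[OF span_submodule[OF vX]]) auto
    qed
  qed
qed

end

text \<open>\<open>Q\<close> is not assumed to be a module: the module laws are carried over along
  the surjection. Quotients given as explicit records thereby become modules without separate
  verification.\<close>

locale module_surjection = module A M for A (structure) and M (structure) +
  fixes Q and \<pi>
  assumes surj: "\<pi> ` carrier M = carrier Q"
    and map_add: "\<And>x y. \<lbrakk>x \<in> carrier M; y \<in> carrier M\<rbrakk> \<Longrightarrow> \<pi> (x \<oplus>\<^bsub>M\<^esub> y) = \<pi> x \<oplus>\<^bsub>Q\<^esub> \<pi> y"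
    and map_smult: "\<And>a x. \<lbrakk>a \<in> carrier A; x \<in> carrier M\<rbrakk> \<Longrightarrow> \<pi> (a \<odot>\<^bsub>M\<^esub> x) = a \<odot>\<^bsub>Q\<^esub> \<pi> x"
    and map_zero: "\<pi> \<zero>\<^bsub>M\<^esub> = \<zero>\<^bsub>Q\<^esub>"
begin

lemma map_closed: "x \<in> carrier M \<Longrightarrow> \<pi> x \<in> carrier Q"
  using surj by auto

lemma target_module: "module A Q"
proof (rule moduleI[OF R.is_cring])
  have ex: "\<exists>x\<in>carrier M. z = \<pi> x" if "z \<in> carrier Q" for z
    using that surj by auto
  note s = map_add[symmetric] map_smult[symmetric]
  show "abelian_group Q"
  proof (rule abelian_groupI)
    show "\<zero>\<^bsub>Q\<^esub> \<in> carrier Q" using map_closed[OF M.zero_closed] map_zero by simp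
    show "x \<oplus>\<^bsub>Q\<^esub> y \<in> carrier Q" if "x \<in> carrier Q" "y \<in> carrier Q" for x y
      using ex[OF that(1)] ex[OF that(2)] map_closed by (auto simp: s)
    show "x \<oplus>\<^bsub>Q\<^esub> y \<oplus>\<^bsub>Q\<^esub> z = x \<oplus>\<^bsub>Q\<^esub> (y \<oplus>\<^bsub>Q\<^esub> z)" if "x \<in> carrier Q" "y \<in> carrier Q" "z \<in> carrier Q" for x y z
      using ex[OF that(1)] ex[OF that(2)] ex[OF that(3)] by (auto simp: s M.a_assoc)
    show "x \<oplus>\<^bsub>Q\<^esub> y = y \<oplus>\<^bsub>Q\<^esub> x" if "x \<in> carrier Q" "y \<in> carrier Q" for x y
      using ex[OF that(1)] ex[OF that(2)] by (auto simp: s M.a_comm)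
    show "\<zero>\<^bsub>Q\<^esub> \<oplus>\<^bsub>Q\<^esub> x = x" if "x \<in> carrier Q" for x
      using ex[OF that(1)] by (auto simp: s map_zero[symmetric])
    show "\<exists>y\<in>carrier Q. y \<oplus>\<^bsub>Q\<^esub> x = \<zero>\<^bsub>Q\<^esub>" if "x \<in> carrier Q" for x
    proof -
      from ex[OF that] obtain w where w: "w \<in> carrier M" "x = \<pi> w" by auto
      then show ?thesis
        using map_closed[of "\<ominus>\<^bsub>M\<^esub> w"] map_add[of "\<ominus>\<^bsub>M\<^esub> w" w] by (auto simp: M.l_neg map_zero)
    qed
  qed
  show "a \<odot>\<^bsub>Q\<^esub> x \<in> carrier Q" if "a \<in> carrier A" "x \<in> carrier Q" for a x
    using ex[OF that(2)] that(1) map_closed by (auto simp: s)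
  show "(a \<oplus> b) \<odot>\<^bsub>Q\<^esub> x = a \<odot>\<^bsub>Q\<^esub> x \<oplus>\<^bsub>Q\<^esub> b \<odot>\<^bsub>Q\<^esub> x" if "a \<in> carrier A" "b \<in> carrier A" "x \<in> carrier Q" for a b x
    using ex[OF that(3)] that by (auto simp: s smult_l_distr)
  show "a \<odot>\<^bsub>Q\<^esub> (x \<oplus>\<^bsub>Q\<^esub> y) = a \<odot>\<^bsub>Q\<^esub> x \<oplus>\<^bsub>Q\<^esub> a \<odot>\<^bsub>Q\<^esub> y" if "a \<in> carrier A" "x \<in> carrier Q" "y \<in> carrier Q" for a x y
    using ex[OF that(2)] ex[OF that(3)] that(1) by (auto simp: s smult_r_distr)
  show "(a \<otimes> b) \<odot>\<^bsub>Q\<^esub> x = a \<odot>\<^bsub>Q\<^esub> (b \<odot>\<^bsub>Q\<^esub> x)" if "a \<in> carrier A" "b \<in> carrier A" "x \<in> carrier Q" for a b x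
    using ex[OF that(3)] that by (auto simp: s smult_assoc1)
  show "\<one> \<odot>\<^bsub>Q\<^esub> x = x" if "x \<in> carrier Q" for x
    using ex[OF that] by (auto simp: s)
qed

sublocale Q: module A Q by (rule target_module)

lemma map_neg: "x \<in> carrier M \<Longrightarrow> \<pi> (\<ominus>\<^bsub>M\<^esub> x) = \<ominus>\<^bsub>Q\<^esub> \<pi> x"
  using map_add[of "\<ominus>\<^bsub>M\<^esub> x" x] map_closed by (simp add: M.l_neg map_zero Q.M.minus_equality)

lemma map_eq_iff:
  assumes "x \<in> carrier M" "y \<in> carrier M"
  shows "\<pi> x = \<pi> y \<longleftrightarrow> \<pi> (x \<ominus>\<^bsub>M\<^esub> y) = \<zero>\<^bsub>Q\<^esub>"
proof -
  have "\<pi> x = \<pi> y" if "\<pi> x \<ominus>\<^bsub>Q\<^esub> \<pi> y = \<zero>\<^bsub>Q\<^esub>"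
    using Q.minus_cancel(1)[of "\<pi> x" "\<pi> y"] that assms map_closed by simp
  moreover have "\<pi> (x \<ominus>\<^bsub>M\<^esub> y) = \<pi> x \<ominus>\<^bsub>Q\<^esub> \<pi> y"
    using assms by (simp add: M.minus_eq map_add map_neg Q.M.minus_eq)
  ultimately show ?thesis
    using assms map_closed by (auto simp: Q.M.minus_eq Q.M.r_neg)
qed

lemma map_finsum:
  "\<lbrakk>finite X; g \<in> X \<rightarrow> carrier M\<rbrakk> \<Longrightarrow> \<pi> (finsum M g X) = finsum Q (\<lambda>i. \<pi> (g i)) X"
  by (rule finsum_hom) (use M.abelian_monoid_axioms Q.M.abelian_monoid_axioms map_closed map_zero map_add in auto)

lemma span_image:
  assumes "X \<subseteq> carrier M"
  shows "module_span A Q (\<pi> ` X) = \<pi> ` module_span A M X"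
proof
  note sX = span_submodule[OF assms]
  note c = submodule_carrier[OF sX]
  have s: "submodule (\<pi> ` module_span A M X) A Q"
  proof (rule Q.submoduleI')
    show "\<pi> ` module_span A M X \<subseteq> carrier Q" using c map_closed by auto
    show "\<zero>\<^bsub>Q\<^esub> \<in> \<pi> ` module_span A M X"
      using map_zero submodule_zero[OF sX] by (metis imageI)
  next
    fix a b assume "a \<in> \<pi> ` module_span A M X" "b \<in> \<pi> ` module_span A M X"
    then show "a \<oplus>\<^bsub>Q\<^esub> b \<in> \<pi> ` module_span A M X"
      using c submodule_add[OF sX] by (auto simp: map_add[symmetric])
  next
    fix a x assume "a \<in> carrier A" "x \<in> \<pi> ` module_span A M X"
    then show "a \<odot>\<^bsub>Q\<^esub> x \<in> \<pi> ` module_span A M X"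
      using c submodule_smult[OF sX] by (auto simp: map_smult[symmetric])
  qed
  then show "module_span A Q (\<pi> ` X) \<subseteq> \<pi> ` module_span A M X"
    using span_superset by (intro Q.span_least) blast+
  have pX: "\<pi> ` X \<subseteq> carrier Q" using assms map_closed by auto
  note sQ = Q.span_submodule[OF pX]
  have "submodule {x \<in> carrier M. \<pi> x \<in> module_span A Q (\<pi> ` X)} A M"
    by (rule submoduleI')
      (auto simp: map_zero map_add map_smult intro: Q.submodule_zero[OF sQ] Q.submodule_add[OF sQ] Q.submodule_smult[OF sQ])
  then have "module_span A M X \<subseteq> {x \<in> carrier M. \<pi> x \<in> module_span A Q (\<pi> ` X)}"
    using assms Q.span_superset[of "\<pi> ` X"] by (intro span_least) auto
  then show "\<pi> ` module_span A M X \<subseteq> module_span A Q (\<pi> ` X)" by auto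
qed

text \<open>Lifting representatives turns generation of the quotient into the equation M = span +
  kernel inside \<open>M\<close>. In this form generation modulo two different ideals can be
  compared, although the elements of the two quotients have nothing in common.\<close>

lemma span_image_eq_carrier_iff:
  assumes "X \<subseteq> carrier M" and U: "\<And>x. x \<in> carrier M \<Longrightarrow> \<pi> x = \<zero>\<^bsub>Q\<^esub> \<longleftrightarrow> x \<in> U" "U \<subseteq> carrier M"
  shows "module_span A Q (\<pi> ` X) = carrier Q \<longleftrightarrow> carrier M \<subseteq> msum (module_span A M X) U"
proof
  note c = submodule_carrier[OF span_submodule[OF assms(1)]]
  assume *: "module_span A Q (\<pi> ` X) = carrier Q"
  show "carrier M \<subseteq> msum (module_span A M X) U"
  proof
    fix x assume x: "x \<in> carrier M"
    then have "\<pi> x \<in> \<pi> ` module_span A M X"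
      using * map_closed span_image[OF assms(1)] by simp
    then obtain y where y: "y \<in> module_span A M X" "\<pi> x = \<pi> y" by auto
    then have "x \<ominus>\<^bsub>M\<^esub> y \<in> U"
      using map_eq_iff[of x y] c x U(1)[of "x \<ominus>\<^bsub>M\<^esub> y"] by simp
    then show "x \<in> msum (module_span A M X) U"
      using y c x minus_cancel(1)[of x y] by (intro msumI[of y _ "x \<ominus>\<^bsub>M\<^esub> y"]) auto
  qed
next
  note c = submodule_carrier[OF span_submodule[OF assms(1)]]
  assume *: "carrier M \<subseteq> msum (module_span A M X) U"
  have "\<pi> x \<in> \<pi> ` module_span A M X" if "x \<in> carrier M" for x
  proof -
    from that * obtain y u where "y \<in> module_span A M X" "u \<in> U" "x = y \<oplus>\<^bsub>M\<^esub> u"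
      by (blast elim: msumE)
    moreover from this have "u \<in> carrier M" "\<pi> u = \<zero>\<^bsub>Q\<^esub>"
      using U by auto
    ultimately have "\<pi> x = \<pi> y"
      using map_add[of y u] c map_closed[of y] by simp
    with \<open>y \<in> _\<close> show ?thesis by simp
  qed
  then show "module_span A Q (\<pi> ` X) = carrier Q"
    unfolding span_image[OF assms(1)] surj[symmetric] using c by auto
qed

end

text \<open>Sending a basis \<open>b\<close> to the generators \<open>v\<close> defines a surjective
  endomorphism \<phi>, which is injective by \<open>surj_endo_inj\<close>. A relation among the
  \<open>v i\<close> is the image under \<phi> of the same combination of the \<open>b i\<close>,
  which must therefore vanish. So any \<open>n\<close> generators of a free module of rank
  \<open>n\<close> form a basis, and the basis hidden in \<open>free_of_rank\<close> need not be
  carried along.\<close>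

lemma (in noeth_module) free_of_rank_basis:
  assumes N: "noeth_between {\<zero>\<^bsub>M\<^esub>} (carrier M)" and free: "free_of_rank R M n"
    and v: "v \<in> {..<n} \<rightarrow> carrier M" "module_span R M (v ` {..<n}) = carrier M"
    and a: "a \<in> {..<n} \<rightarrow> carrier R" "(\<Oplus>\<^bsub>M\<^esub>i\<in>{..<n}. a i \<odot>\<^bsub>M\<^esub> v i) = \<zero>\<^bsub>M\<^esub>" and i: "i < n"
  shows "a i = \<zero>"
proof -
  from free obtain b where b: "b \<in> {..<n} \<rightarrow> carrier M"
    and bij: "bij_betw (\<lambda>a. \<Oplus>\<^bsub>M\<^esub>i\<in>{..<n}. a i \<odot>\<^bsub>M\<^esub> b i) ({..<n} \<rightarrow>\<^sub>E carrier R) (carrier M)"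
    (is "bij_betw ?F ?D _")
    by (auto simp: free_of_rank_def)
  define L where "L w a = (\<Oplus>\<^bsub>M\<^esub>i\<in>{..<n}. a i \<odot>\<^bsub>M\<^esub> w i)" for w :: "nat \<Rightarrow> 'c" and a :: "nat \<Rightarrow> 'a"
  have Lc: "(\<lambda>i. a i \<odot>\<^bsub>M\<^esub> w i) \<in> {..<n} \<rightarrow> carrier M" if "w \<in> {..<n} \<rightarrow> carrier M" "a \<in> {..<n} \<rightarrow> carrier R" for w a
    using that by (auto simp: Pi_iff)
  have Ladd: "L w (\<lambda>i\<in>{..<n}. a i \<oplus> c i) = L w a \<oplus>\<^bsub>M\<^esub> L w c"
    if "w \<in> {..<n} \<rightarrow> carrier M" "a \<in> {..<n} \<rightarrow> carrier R" "c \<in> {..<n} \<rightarrow> carrier R" for w a c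
  proof -
    have "L w (\<lambda>i\<in>{..<n}. a i \<oplus> c i) = (\<Oplus>\<^bsub>M\<^esub>i\<in>{..<n}. a i \<odot>\<^bsub>M\<^esub> w i \<oplus>\<^bsub>M\<^esub> c i \<odot>\<^bsub>M\<^esub> w i)"
      unfolding L_def using that Lc by (intro M.finsum_cong') (auto simp: smult_l_distr Pi_iff)
    then show ?thesis
      unfolding L_def using that Lc by (simp add: M.finsum_addf)
  qed
  have Lsmult: "L w (\<lambda>i\<in>{..<n}. r \<otimes> a i) = r \<odot>\<^bsub>M\<^esub> L w a"
    if "w \<in> {..<n} \<rightarrow> carrier M" "a \<in> {..<n} \<rightarrow> carrier R" "r \<in> carrier R" for w a r
  proof -
    have "L w (\<lambda>i\<in>{..<n}. r \<otimes> a i) = (\<Oplus>\<^bsub>M\<^esub>i\<in>{..<n}. r \<odot>\<^bsub>M\<^esub> (a i \<odot>\<^bsub>M\<^esub> w i))"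
      unfolding L_def using that Lc by (intro M.finsum_cong') (auto simp: smult_assoc1 Pi_iff)
    then show ?thesis
      unfolding L_def using that Lc finsum_smult_ldistr[of "{..<n}" r] by simp
  qed
  have Lcl: "L w a \<in> carrier M" if "w \<in> {..<n} \<rightarrow> carrier M" "a \<in> {..<n} \<rightarrow> carrier R" for w a
    unfolding L_def using Lc[OF that] by (rule M.finsum_closed)
  \<comment> \<open>The coordinates with respect to the basis \<open>b\<close>.\<close>
  define G where "G = inv_into ?D ?F"
  have F: "?F = L b" by (simp add: L_def fun_eq_iff)
  have G: "G x \<in> ?D" "L b (G x) = x" if "x \<in> carrier M" for x
    using that bij inv_into_into[of x "L b" ?D] f_inv_into_f[of x "L b" ?D] unfolding G_def F
    by (simp_all add: bij_betw_def)
  have GL: "G (L b c) = c" if "c \<in> ?D" for c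
    using that bij unfolding G_def F by (simp add: bij_betw_def inv_into_f_f)
  have Gr: "G x \<in> {..<n} \<rightarrow> carrier R" if "x \<in> carrier M" for x
    using G[OF that] by (auto simp: PiE_def)
  define \<phi> where "\<phi> x = L v (G x)" for x
  have img: "L v c \<in> \<phi> ` carrier M" if "c \<in> {..<n} \<rightarrow> carrier R" for c
  proof -
    have "L v c = L v (restrict c {..<n})"
      unfolding L_def using Lc[OF v(1) that] by (intro M.finsum_cong') auto
    moreover have "restrict c {..<n} \<in> ?D" using that by auto
    ultimately show ?thesis
      using GL[of "restrict c {..<n}"] Lcl[OF b, of "restrict c {..<n}"]
      by (auto simp: \<phi>_def PiE_def intro!: image_eqI[of _ _ "L b (restrict c {..<n})"])
  qed
  have eq: "carrier M = {L v c | c. c \<in> {..<n} \<rightarrow> carrier R}"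
    using v(2) unfolding span_finite_family[OF finite_lessThan v(1)] L_def by (rule sym)
  have surj: "carrier M \<subseteq> \<phi> ` carrier M"
  proof
    fix x assume x: "x \<in> carrier M"
    from subsetD[OF equalityD1[OF eq] x] obtain c where "c \<in> {..<n} \<rightarrow> carrier R" "x = L v c" by auto
    then show "x \<in> \<phi> ` carrier M" using img by simp
  qed
  have phi: "\<phi> \<in> carrier M \<rightarrow> carrier M"
    using Lcl[OF v(1) Gr] by (auto simp: \<phi>_def)
  define c where "c = restrict a {..<n}"
  have c: "c \<in> ?D" using a(1) by (auto simp: c_def)
  then have cr: "c \<in> {..<n} \<rightarrow> carrier R" by (auto simp: PiE_def)
  have "L b c = \<zero>\<^bsub>M\<^esub>"
  proof (rule surj_endo_inj[OF N phi])
    show "\<phi> ` carrier M = carrier M" using surj phi by auto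
    fix x y assume xy: "x \<in> carrier M" "y \<in> carrier M"
    have "G (x \<oplus>\<^bsub>M\<^esub> y) = (\<lambda>i\<in>{..<n}. G x i \<oplus> G y i)"
      using Ladd[OF b Gr[OF xy(1)] Gr[OF xy(2)]] G(2)[OF xy(1)] G(2)[OF xy(2)]
        GL[of "\<lambda>i\<in>{..<n}. G x i \<oplus> G y i"] Gr[OF xy(1)] Gr[OF xy(2)] by (simp add: Pi_iff)
    then show "\<phi> (x \<oplus>\<^bsub>M\<^esub> y) = \<phi> x \<oplus>\<^bsub>M\<^esub> \<phi> y"
      using Ladd[OF v(1) Gr[OF xy(1)] Gr[OF xy(2)]] by (simp add: \<phi>_def)
  next
    fix r x assume rx: "r \<in> carrier R" "x \<in> carrier M"
    have "G (r \<odot>\<^bsub>M\<^esub> x) = (\<lambda>i\<in>{..<n}. r \<otimes> G x i)"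
      using Lsmult[OF b Gr[OF rx(2)] rx(1)] G(2)[OF rx(2)]
        GL[of "\<lambda>i\<in>{..<n}. r \<otimes> G x i"] Gr[OF rx(2)] rx(1) by (simp add: Pi_iff)
    then show "\<phi> (r \<odot>\<^bsub>M\<^esub> x) = r \<odot>\<^bsub>M\<^esub> \<phi> x"
      using Lsmult[OF v(1) Gr[OF rx(2)] rx(1)] by (simp add: \<phi>_def)
  next
    show "L b c \<in> carrier M" using Lcl[OF b cr] .
    have "L v c = L v a"
      unfolding L_def c_def using Lc[OF v(1) a(1)] by (intro M.finsum_cong') auto
    then show "\<phi> (L b c) = \<zero>\<^bsub>M\<^esub>"
      using a(2) GL[OF c] by (simp add: \<phi>_def L_def)
  qed
  moreover have "L b (\<lambda>i\<in>{..<n}. \<zero>) = \<zero>\<^bsub>M\<^esub>"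
    unfolding L_def using b by (intro M.add.finprod_one_eqI) (auto simp: Pi_iff)
  ultimately have "c = (\<lambda>i\<in>{..<n}. \<zero>)"
    using GL[OF c] GL[of "\<lambda>i\<in>{..<n}. \<zero>"] by simp
  then have "c i = \<zero>" using i by simp
  then show ?thesis using i by (simp add: c_def)
qed

section \<open>Ideals of a complete local ring\<close>

lemma (in ring) set_add_upper:
  assumes "ideal I R" "ideal J R"
  shows "I \<subseteq> set_add R I J" "J \<subseteq> set_add R I J"
proof -
  interpret I: ideal I R by fact
  interpret J: ideal J R by fact
  have "x = x \<oplus> \<zero>" if "x \<in> I" for x using that I.Icarr by simp
  then show "I \<subseteq> set_add R I J" unfolding set_add_def' using J.zero_closed by blast
  have "x = \<zero> \<oplus> x" if "x \<in> J" for x using that J.Icarr by simp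
  then show "J \<subseteq> set_add R I J" unfolding set_add_def' using I.zero_closed by blast
qed

lemma (in cring) self_module_module: "module R (self_module R)"
  by (rule ring_as_module_module[OF is_cring is_cring]) (auto simp: ring_hom_def)

lemma (in cring) submodule_self_iff: "submodule I R (self_module R) \<longleftrightarrow> ideal I R"
proof
  interpret M: module R "self_module R" by (rule self_module_module)
  show "ideal I R" if I: "submodule I R (self_module R)"
  proof (rule idealI)
    show "ring R" by (rule ring_axioms)
    show "subgroup I (add_monoid R)"
    proof (rule add.subgroupI)
      show "I \<subseteq> carrier R" using M.submodule_carrier[OF I] by auto
      show "I \<noteq> {}" using M.submodule_zero[OF I] by auto
      fix a assume a: "a \<in> I"
      then show "\<ominus> a \<in> I"
        using M.submodule_smult[OF I, of "\<ominus> \<one>" a] M.submodule_carrier[OF I a] by (simp add: l_minus)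
    next
      fix a b assume "a \<in> I" "b \<in> I"
      then show "a \<oplus> b \<in> I" using M.submodule_add[OF I, of a b] by simp
    qed
    fix a x assume a: "a \<in> I" "x \<in> carrier R"
    then show "x \<otimes> a \<in> I" using M.submodule_smult[OF I, of x a] by simp
    then show "a \<otimes> x \<in> I" using a M.submodule_carrier[OF I a(1)] m_comm[of a x] by simp
  qed
  show "submodule I R (self_module R)" if I: "ideal I R"
    by (rule M.submoduleI')
      (auto simp: ideal.Icarr[OF I] ideal.I_l_closed[OF I] additive_subgroup.zero_closed[OF ideal.axioms(1)[OF I]]
        additive_subgroup.a_closed[OF ideal.axioms(1)[OF I]])
qed

section \<open>Powers of an ideal\<close>

context cring
begin

lemma ideal_power_simps: "\<one>\<^bsub>ideals_set R\<^esub> = carrier R" "I \<otimes>\<^bsub>ideals_set R\<^esub> J = ideal_prod R I J"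
  by (simp_all add: ideals_set_def)

lemma ideal_power_ideal: "ideal J R \<Longrightarrow> ideal (ideal_power R J k) R"
  by (induction k) (auto simp: ideal_power_simps oneideal ideal_prod_is_ideal)

lemma ideal_power_1: "ideal J R \<Longrightarrow> ideal_power R J 1 = J"
  using ideal_prod_one[of J] ideal_prod_commute[OF oneideal, of J] by (simp add: ideal_power_simps)

lemma ideal_power_add: "ideal J R \<Longrightarrow> ideal_power R J (i + j) = ideal_prod R (ideal_power R J i) (ideal_power R J j)"
proof -
  interpret I: semiring "ideals_set R" by (rule ideals_set_is_semiring)
  show "ideal J R \<Longrightarrow> ?thesis"
    using I.nat_pow_mult[of J i j] by (simp add: ideals_set_def)
qed

lemma ideal_prod_mono: "\<lbrakk>I \<subseteq> I'; J \<subseteq> J'\<rbrakk> \<Longrightarrow> ideal_prod R I J \<subseteq> ideal_prod R I' J'"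
proof
  fix x assume "I \<subseteq> I'" "J \<subseteq> J'" "x \<in> ideal_prod R I J"
  from this(3) show "x \<in> ideal_prod R I' J'"
    by (induction rule: ideal_prod.induct) (use \<open>I \<subseteq> I'\<close> \<open>J \<subseteq> J'\<close> in \<open>auto intro: ideal_prod.intros\<close>)
qed

lemma ideal_power_mult_subset:
  assumes "ideal \<mm> R" "ideal_power R \<mm> e \<subseteq> J"
  shows "ideal_power R \<mm> (e * t) \<subseteq> ideal_power R J t"
proof (induction t)
  case (Suc t)
  have "ideal_power R \<mm> (e * t + e) \<subseteq> ideal_prod R (ideal_power R J t) J"
    unfolding ideal_power_add[OF assms(1)] by (rule ideal_prod_mono[OF Suc assms(2)])
  then show ?case by (simp add: ideal_power_simps add.commute)
qed (simp add: ideal_power_simps)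

end

lemma (in module) ideal_power_smult_filt:
  assumes J: "ideal J R" and P: "module_pair R M W U"
    and a: "a \<in> ideal_power R J k" and x: "x \<in> W"
  shows "a \<odot>\<^bsub>M\<^esub> x \<in> filt W U J k"
  using a
proof (induction k arbitrary: a)
  case 0
  interpret module_pair R M W U by fact
  show ?case
    using 0 x submodule_smult[OF W, of a x] by (auto simp: R.ideal_power_simps filt_0)
next
  case (Suc k)
  interpret module_pair R M W U by fact
  note ip = R.ideal_power_ideal[OF J, of k]
  have xM: "x \<in> carrier M" using submodule_carrier[OF W x] .
  from Suc.prems have "a \<in> ideal_prod R (ideal_power R J k) J"
    by (simp add: R.ideal_power_simps)
  then show ?case
  proof (induction rule: ideal_prod.induct)
    case (prod i j)
    then have ij: "i \<in> carrier R" "j \<in> carrier R" using ideal.Icarr[OF ip] ideal.Icarr[OF J] by auto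
    then have "(i \<otimes> j) \<odot>\<^bsub>M\<^esub> x = j \<odot>\<^bsub>M\<^esub> (i \<odot>\<^bsub>M\<^esub> x)"
      using xM smult_assoc1[of j i x] R.m_comm[of i j] by simp
    then show ?case using filt_smult[OF prod(2) Suc.IH[OF prod(1)]] by simp
  next
    case (sum s t)
    then have "s \<in> carrier R" "t \<in> carrier R"
      using ideal.Icarr[OF R.ideal_prod_is_ideal[OF ip J]] by auto
    then show ?case using sum xM by (auto simp: smult_l_distr intro: filt_add)
  qed
qed

section \<open>Units and powers of the maximal ideal of a local ring\<close>

context complete_noetherian_local_ring
begin

sublocale self: noeth_module R "self_module R"
  by (intro noeth_module.intro self_module_module noetherian_ring_axioms)

lemma self_fin_gen: "fin_gen_module R (self_module R)"
  unfolding fin_gen_module_def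
proof (intro conjI exI)
  show "module_span R (self_module R) {\<one>} = carrier (self_module R)"
  proof
    have s: "submodule (module_span R (self_module R) {\<one>}) R (self_module R)"
      by (rule self.span_submodule) simp
    then show "module_span R (self_module R) {\<one>} \<subseteq> carrier (self_module R)"
      using self.submoduleE(1) by blast
    have "\<one> \<in> module_span R (self_module R) {\<one>}"
      using self.span_superset by auto
    then have "x \<in> module_span R (self_module R) {\<one>}" if "x \<in> carrier R" for x
      using self.submodule_smult[OF s that, of \<one>] that by simp
    then show "carrier (self_module R) \<subseteq> module_span R (self_module R) {\<one>}"
      by auto
  qed
qed (simp_all add: self_module_module)

lemma ex_maximal_ideal_in:
  assumes "I \<in> \<C>" "\<And>I. I \<in> \<C> \<Longrightarrow> ideal I R"
  obtains B where "B \<in> \<C>" "\<And>B'. \<lbrakk>B' \<in> \<C>; B \<subseteq> B'\<rbrakk> \<Longrightarrow> B' = B"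
proof (rule self.noeth_between_maximal[OF self.fin_gen_noeth[OF self_fin_gen] assms(1)])
  fix V assume "V \<in> \<C>"
  then have V: "ideal V R" using assms(2) by simp
  then show "submodule V R (self_module R) \<and> {\<zero>\<^bsub>self_module R\<^esub>} \<subseteq> V \<and> V \<subseteq> carrier (self_module R)"
    using submodule_self_iff[of V] ideal.Icarr[OF V] additive_subgroup.zero_closed[OF ideal.axioms(1)[OF V]] by auto
qed (use that in blast)

text \<open>A maximal element among the ideals that contain \<open>r\<close> but not 1 is a maximal
  ideal of \<open>R\<close>, hence equal to \<mm>. The chain condition provides it.\<close>

lemma unit_outside:
  assumes r: "r \<in> carrier R" "r \<notin> \<mm>"
  shows "r \<in> Units R"
proof (rule ccontr)
  assume nu: "r \<notin> Units R"
  let ?C = "{I. ideal I R \<and> r \<in> I \<and> \<one> \<notin> I}"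
  have "\<one> \<notin> PIdl r"
  proof
    assume "\<one> \<in> PIdl r"
    then obtain s where "s \<in> carrier R" "\<one> = s \<otimes> r" by (auto simp: cgenideal_def)
    then show False using nu r(1) m_comm[of s r] by (auto simp: Units_def)
  qed
  then have "PIdl r \<in> ?C" using cgenideal_ideal[OF r(1)] cgenideal_self[OF r(1)] by simp
  then obtain B where B: "B \<in> ?C" "\<And>B'. \<lbrakk>B' \<in> ?C; B \<subseteq> B'\<rbrakk> \<Longrightarrow> B' = B"
    by (rule ex_maximal_ideal_in) auto
  then interpret B: ideal B R by simp
  have "maximalideal B R"
  proof (rule maximalidealI)
    show "ideal B R" using B by simp
    show "carrier R \<noteq> B" using B by auto
    fix J assume J: "ideal J R" "B \<subseteq> J" "J \<subseteq> carrier R"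
    show "J = B \<or> J = carrier R"
      using B(1) B(2)[of J] J ideal.one_imp_carrier[OF J(1)] by auto
  qed
  then have "B = \<mm>" by (rule maximalideal_unique)
  with B(1) r(2) show False by simp
qed

lemma one_notin: "\<one> \<notin> \<mm>"
  using I_notcarr one_imp_carrier by auto

lemma one_minus_unit: "r \<in> \<mm> \<Longrightarrow> r \<in> carrier R \<and> (\<forall>s\<in>carrier R. \<one> \<ominus> s \<otimes> r \<in> Units R)"
proof (intro conjI ballI)
  assume r: "r \<in> \<mm>"
  then show "r \<in> carrier R" by (rule Icarr)
  fix s assume s: "s \<in> carrier R"
  then have sr: "s \<otimes> r \<in> \<mm>" using r by (rule I_l_closed[rotated])
  show "\<one> \<ominus> s \<otimes> r \<in> Units R"
  proof (rule unit_outside)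
    show "\<one> \<ominus> s \<otimes> r \<notin> \<mm>"
    proof
      assume "\<one> \<ominus> s \<otimes> r \<in> \<mm>"
      then have "(\<one> \<ominus> s \<otimes> r) \<oplus> s \<otimes> r \<in> \<mm>" using sr by (rule a_closed)
      then have "\<one> \<in> \<mm>" using s r Icarr by (simp add: minus_eq a_assoc l_neg)
      then show False using one_notin by simp
    qed
  qed (use s r Icarr in simp)
qed

text \<open>A maximal counterexample \<open>Q\<close> would contain \<open>(Q + (y)) \<cdot> (Q : y)\<close> with both factors strictly larger.\<close>

lemma ideal_power_subset:
  assumes J: "ideal J R" and pow: "\<And>x. x \<in> \<mm> \<Longrightarrow> \<exists>n::nat. x [^] n \<in> J"
  shows "\<exists>e. ideal_power R \<mm> e \<subseteq> J"
proof (rule ccontr)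
  assume no: "\<nexists>e. ideal_power R \<mm> e \<subseteq> J"
  let ?C = "{Q. ideal Q R \<and> J \<subseteq> Q \<and> (\<nexists>e. ideal_power R \<mm> e \<subseteq> Q)}"
  have "J \<in> ?C" using J no by simp
  then obtain Q where Q: "Q \<in> ?C" "\<And>B'. \<lbrakk>B' \<in> ?C; Q \<subseteq> B'\<rbrakk> \<Longrightarrow> B' = Q"
    by (rule ex_maximal_ideal_in) auto
  then interpret Q: ideal Q R by simp
  have "\<not> ideal_power R \<mm> 1 \<subseteq> Q" using Q by blast
  then obtain x where x: "x \<in> \<mm>" "x \<notin> Q" using ideal_power_1[OF is_ideal] by auto
  obtain n where n: "x [^] (n::nat) \<in> Q" using pow[OF x(1)] Q(1) by blast
  \<comment> \<open>The element \<open>y\<close> below is the last power of \<open>x\<close> outside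
    \<open>Q\<close>. Then Q + (y) contains \<open>y\<close>, and (Q : y) contains \<open>x\<close>;
    both are strictly larger than \<open>Q\<close>.\<close>
  define l where "l = (LEAST n. x [^] (n::nat) \<in> Q)"
  have l: "x [^] l \<in> Q" "\<And>i. i < l \<Longrightarrow> x [^] i \<notin> Q"
    unfolding l_def using n LeastI[of "\<lambda>n. x [^] (n::nat) \<in> Q"] not_less_Least by auto
  have "l \<noteq> 0"
  proof
    assume "l = 0"
    then have "Q = carrier R" using l(1) Q.one_imp_carrier by simp
    then have "ideal_power R \<mm> 0 \<subseteq> Q" by (simp add: ideal_power_simps)
    then show False using Q(1) by blast
  qed
  then obtain i where i: "l = Suc i" by (cases l) auto
  define y where "y = x [^] i"
  have xR: "x \<in> carrier R" using x Icarr by simp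
  have y: "y \<in> carrier R" "y \<notin> Q" "y \<otimes> x \<in> Q"
    using l i xR by (auto simp: y_def)
  have Q1: "ideal (set_add R Q (PIdl y)) R"
    using Q.is_ideal cgenideal_ideal[OF y(1)] by (rule add_ideals)
  have "Q \<subseteq> set_add R Q (PIdl y)" "y \<in> set_add R Q (PIdl y)"
    using set_add_upper[OF Q.is_ideal cgenideal_ideal[OF y(1)]] cgenideal_self[OF y(1)] by auto
  then obtain e1 where e1: "ideal_power R \<mm> e1 \<subseteq> set_add R Q (PIdl y)"
    using Q(1) Q(2)[of "set_add R Q (PIdl y)"] Q1 y(2) by blast
  let ?Q2 = "{r \<in> carrier R. \<forall>z\<in>{y}. r \<odot>\<^bsub>self_module R\<^esub> z \<in> Q}"
  have Q2: "ideal ?Q2 R"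
    by (rule self.colon_ideal) (use Q.is_ideal submodule_self_iff y in auto)
  have "Q \<subseteq> ?Q2" "x \<in> ?Q2"
    using y xR Q.Icarr Q.I_r_closed m_comm[of x y] by auto
  then obtain e2 where e2: "ideal_power R \<mm> e2 \<subseteq> ?Q2"
    using Q(1) Q(2)[of ?Q2] Q2 x(2) by blast
  have "ideal_power R \<mm> (e1 + e2) \<subseteq> Q"
    unfolding ideal_power_add[OF is_ideal]
  proof
    fix z assume "z \<in> ideal_prod R (ideal_power R \<mm> e1) (ideal_power R \<mm> e2)"
    then show "z \<in> Q"
    proof (induction rule: ideal_prod.induct)
      case (prod a b)
      from prod(1) e1 obtain q r where q: "q \<in> Q" "r \<in> carrier R" "a = q \<oplus> r \<otimes> y"
        by (auto simp: set_add_def' cgenideal_def)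
      have b: "b \<in> carrier R" "b \<otimes> y \<in> Q" using prod(2) e2 by auto
      have "a \<otimes> b = q \<otimes> b \<oplus> r \<otimes> (b \<otimes> y)"
        using q b y Q.Icarr m_comm[of b y] by (simp add: l_distr m_assoc)
      then show ?case using q b Q.I_r_closed Q.I_l_closed by simp
    qed simp
  qed
  then show False using Q(1) by blast
qed

end

section \<open>Approximation over a complete base ring\<close>

lemma a_inv_restrict_scalars [simp]: "a_inv (restrict_scalars h M) = a_inv M"
  and a_minus_restrict_scalars [simp]: "a_minus (restrict_scalars h M) = a_minus M"
  and finsum_restrict_scalars [simp]: "finsum (restrict_scalars h M) = finsum M"
  by (simp_all add: fun_eq_iff a_inv_def a_minus_def m_inv_def finsum_def finprod_def restrict_scalars_def)

lemma (in module) minus_add_cancel: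
  assumes "x \<in> carrier M" "b \<in> carrier M" "d \<in> carrier M"
  shows "x \<ominus>\<^bsub>M\<^esub> b = (x \<ominus>\<^bsub>M\<^esub> (d \<oplus>\<^bsub>M\<^esub> b)) \<oplus>\<^bsub>M\<^esub> d"
proof -
  have "(x \<ominus>\<^bsub>M\<^esub> (d \<oplus>\<^bsub>M\<^esub> b)) \<oplus>\<^bsub>M\<^esub> d = (x \<ominus>\<^bsub>M\<^esub> b) \<oplus>\<^bsub>M\<^esub> (d \<oplus>\<^bsub>M\<^esub> \<ominus>\<^bsub>M\<^esub> d)"
    using assms by (simp add: M.minus_eq M.minus_add M.a_ac)
  then show ?thesis using assms by (simp add: M.r_neg)
qed

section \<open>Modules over a local homomorphism of complete local rings\<close>

locale local_extension =
  A: complete_noetherian_local_ring A \<mm>A + R: complete_noetherian_local_ring R \<mm>R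
  for A :: "('a, 'p) ring_scheme" (structure) and \<mm>A and R :: "('r, 'q) ring_scheme" (structure) and \<mm>R +
  fixes h :: "'a \<Rightarrow> 'r"
  assumes h: "h \<in> ring_hom A R" and h_local: "h ` \<mm>A \<subseteq> \<mm>R"

locale local_extension_module = local_extension A \<mm>A R \<mm>R h
  for A :: "('a, 'p) ring_scheme" (structure) and \<mm>A and R :: "('r, 'q) ring_scheme" (structure) and \<mm>R
    and h :: "'a \<Rightarrow> 'r" +
  fixes M :: "('r, 'm, 'z) module_scheme" (structure)
  assumes M_fin_gen: "fin_gen_module R M"
begin

abbreviation "MA \<equiv> restrict_scalars h M"

sublocale M: noeth_module R M
  using M_fin_gen by (intro noeth_module.intro R.noetherian_ring_axioms) (simp add: fin_gen_module_def)

sublocale MA: noeth_module A MA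
  by (intro noeth_module.intro A.noetherian_ring_axioms restrict_scalars_module[OF A.is_cring h M.module_axioms])

lemma h_closed [simp, intro]: "a \<in> carrier A \<Longrightarrow> h a \<in> carrier R"
  using h by (auto simp: ring_hom_def)

lemma h_\<mm>A: "t \<in> \<mm>A \<Longrightarrow> h t \<in> \<mm>R" "t \<in> \<mm>A \<Longrightarrow> t \<in> carrier A"
  using h_local A.Icarr by auto

lemma msum_MA [simp]: "MA.msum = M.msum"
  by (simp add: fun_eq_iff MA.msum_def M.msum_def)

lemma submodule_MA: "submodule U R M \<Longrightarrow> submodule U A MA"
  by (rule MA.submoduleI') (use M.submodule_carrier M.submodule_zero M.submodule_add M.submodule_smult in auto)

lemma M_noeth: "M.noeth_between {\<zero>\<^bsub>M\<^esub>} (carrier M)"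
  by (rule M.fin_gen_noeth[OF M_fin_gen])

lemma M_noeth_between:
  assumes "submodule U R M" "submodule W R M" "U \<subseteq> W"
  shows "M.noeth_between U W"
  by (rule M.noeth_between_mono[OF M_noeth assms(1,2) _ assms(3)])
    (use M.submodule_zero[OF assms(1)] M.submodule_carrier[OF assms(2)] in auto)

text \<open>The action of \<open>R\<close> commutes with that of \<open>\<mm>A\<close>, so the
  m_A-adic filtration between R-submodules consists of R-submodules, although it is built over
  \<open>A\<close>.\<close>

lemma filt_MA_submodule:
  assumes W: "submodule W R M" and U: "submodule U R M" "U \<subseteq> W"
  shows "submodule (MA.filt W U \<mm>A k) R M"
proof -
  interpret F: module_pair A MA W U
    by (rule MA.module_pairI) (use assms submodule_MA in auto)
  have mA: "\<mm>A \<subseteq> carrier A" using A.Icarr by auto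
  note s = F.filt_submodule[OF mA]
  show ?thesis
  proof (rule M.submoduleI')
    show "MA.filt W U \<mm>A k \<subseteq> carrier M" using MA.submodule_carrier[OF s] by auto
    show "\<zero>\<^bsub>M\<^esub> \<in> MA.filt W U \<mm>A k" using MA.submodule_zero[OF s] by simp
    show "a \<oplus>\<^bsub>M\<^esub> b \<in> MA.filt W U \<mm>A k" if "a \<in> MA.filt W U \<mm>A k" "b \<in> MA.filt W U \<mm>A k" for a b
      using MA.submodule_add[OF s that] by simp
    fix r x assume r: "r \<in> carrier R" and x: "x \<in> MA.filt W U \<mm>A k"
    let ?X = "\<lambda>k. {x \<in> carrier M. r \<odot>\<^bsub>M\<^esub> x \<in> MA.filt W U \<mm>A k}"
    from x have "x \<in> ?X k"
    proof (rule MA.filt_least)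
      show "W \<subseteq> ?X 0" "U \<subseteq> ?X k" for k
        using M.submodule_carrier[OF W] M.submodule_carrier[OF U(1)] M.submodule_smult[OF W r] M.submodule_smult[OF U(1) r]
        by (auto intro: MA.filt_0I MA.filt_base)
      show "t \<odot>\<^bsub>MA\<^esub> x \<in> ?X (Suc k)" if "t \<in> \<mm>A" "x \<in> ?X k" for k t x
      proof -
        have "r \<odot>\<^bsub>M\<^esub> (h t \<odot>\<^bsub>M\<^esub> x) = h t \<odot>\<^bsub>M\<^esub> (r \<odot>\<^bsub>M\<^esub> x)"
          using that r h_\<mm>A M.smult_assoc1[of r "h t" x] M.smult_assoc1[of "h t" r x] R.m_comm[of r "h t"] by auto
        then show ?thesis
          using that h_\<mm>A MA.filt_smult[of t \<mm>A "r \<odot>\<^bsub>M\<^esub> x"] by auto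
      qed
      show "x \<oplus>\<^bsub>MA\<^esub> y \<in> ?X k" if "x \<in> ?X k" "y \<in> ?X k" for k x y
        using that r MA.filt_add[of "r \<odot>\<^bsub>M\<^esub> x" W U \<mm>A k "r \<odot>\<^bsub>M\<^esub> y"] by (auto simp: M.smult_r_distr)
    qed
    then show "r \<odot>\<^bsub>M\<^esub> x \<in> MA.filt W U \<mm>A k" by simp
  qed
qed

text \<open>Defined through the extended ideal m_A R, so that it is an R-submodule from the outset
  and Nakayama's lemma over \<open>R\<close> can be used for it.\<close>

definition "\<mm>AM = ideal_smult R (Idl\<^bsub>R\<^esub> (h ` \<mm>A)) M"

lemma h\<mm>A_carrier: "h ` \<mm>A \<subseteq> carrier R"
  using h_\<mm>A by auto

lemma \<mm>AM_submodule: "submodule \<mm>AM R M"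
  unfolding \<mm>AM_def
  by (rule M.ideal_smult_submodule) (use ideal.Icarr[OF R.genideal_ideal[OF h\<mm>A_carrier]] in auto)

lemma \<mm>AM_subset_filt: "\<mm>AM \<subseteq> MA.filt (carrier M) {\<zero>\<^bsub>M\<^esub>} \<mm>A 1"
  unfolding \<mm>AM_def
proof (rule M.ideal_smult_least)
  show s: "submodule (MA.filt (carrier M) {\<zero>\<^bsub>M\<^esub>} \<mm>A 1) R M"
    by (rule filt_MA_submodule[OF M.carrier_is_submodule M.zero_submodule]) auto
  fix r x assume r: "r \<in> Idl\<^bsub>R\<^esub> (h ` \<mm>A)" and x: "x \<in> carrier M"
  show "r \<odot>\<^bsub>M\<^esub> x \<in> MA.filt (carrier M) {\<zero>\<^bsub>M\<^esub>} \<mm>A 1"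
    by (rule M.genideal_smult_mem[OF h\<mm>A_carrier s order_refl _ r x])
      (use MA.filt_smult[OF _ MA.filt_0I, of _ \<mm>A _ "carrier M" "{\<zero>\<^bsub>M\<^esub>}"] in auto)
qed

text \<open>Locality of \<open>h\<close> enters here: powers of m_A act inside powers of m_R. An
  m_A-adic approximation can therefore be judged by Krull's theorem over \<open>R\<close>.\<close>

lemma filt_MA_subset_filt:
  assumes U: "submodule U R M"
  shows "MA.filt (carrier M) {\<zero>\<^bsub>M\<^esub>} \<mm>A k \<subseteq> M.filt (carrier M) U \<mm>R k"
proof
  fix x assume "x \<in> MA.filt (carrier M) {\<zero>\<^bsub>M\<^esub>} \<mm>A k"
  then show "x \<in> M.filt (carrier M) U \<mm>R k"
    by (rule MA.filt_least)
      (use M.submodule_zero[OF U] h_\<mm>A in \<open>auto intro: M.filt_0I M.filt_base M.filt_smult M.filt_add\<close>)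
qed

text \<open>Since M/U is not assumed to be finite over \<open>A\<close>, Nakayama's lemma over
  \<open>A\<close> does not apply. Instead the coefficients of \<open>x\<close> are improved
  successively modulo powers of m_A. They converge because \<open>A\<close> is complete, and their
  limit represents \<open>x\<close> modulo \<open>U\<close> because M/U is finitely generated over
  \<open>R\<close> and thus m_R-adically separated.\<close>

lemma complete_nakayama:
  assumes U: "submodule U R M" and X: "finite X" "v \<in> X \<rightarrow> carrier M"
    and gen: "carrier M \<subseteq> M.msum (M.msum (module_span A MA (v ` X)) U) \<mm>AM"
  shows "carrier M \<subseteq> M.msum (module_span A MA (v ` X)) U"
proof
  let ?C = "ideal_power A \<mm>A"
  let ?S = "\<lambda>a. \<Oplus>\<^bsub>M\<^esub>i\<in>X. h (a i) \<odot>\<^bsub>M\<^esub> v i"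
  define E where "E k = {?S a | a. a \<in> X \<rightarrow> ?C k}" for k
  define F where "F k = MA.filt (carrier M) {\<zero>\<^bsub>M\<^esub>} \<mm>A k" for k
  have vMA: "v \<in> X \<rightarrow> carrier MA" using X by simp
  have C: "ideal (?C k) A" for k by (rule A.ideal_power_ideal[OF A.is_ideal])
  have CA: "a i \<in> carrier A" if "a \<in> X \<rightarrow> ?C k" "i \<in> X" for a k i
    using that ideal.Icarr[OF C] by auto
  have E: "submodule (E k) A MA" for k
    using MA.coeff_span_submodule[OF X(1) vMA C[of k]] by (simp add: E_def)
  have E0: "module_span A MA (v ` X) = E 0"
    using MA.span_finite_family[OF X(1) vMA] by (simp add: E_def A.ideal_power_simps)
  have FR: "submodule (F k) R M" for k
    unfolding F_def by (rule filt_MA_submodule[OF M.carrier_is_submodule M.zero_submodule]) auto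
  note FA = submodule_MA[OF FR] and UA = submodule_MA[OF U]
  have smults: "h t \<odot>\<^bsub>M\<^esub> e \<in> E (Suc k)" if t: "t \<in> \<mm>A" and e: "e \<in> E k" for t e k
  proof -
    from e obtain a where a: "a \<in> X \<rightarrow> ?C k" "e = ?S a" by (auto simp: E_def)
    have cl: "(\<lambda>i. h (a i) \<odot>\<^bsub>M\<^esub> v i) \<in> X \<rightarrow> carrier M"
      using CA[OF a(1)] X by auto
    have "h t \<odot>\<^bsub>M\<^esub> ?S a = (\<Oplus>\<^bsub>M\<^esub>i\<in>X. h t \<odot>\<^bsub>M\<^esub> (h (a i) \<odot>\<^bsub>M\<^esub> v i))"
      using M.finsum_smult_ldistr[OF X(1) _ cl, of "h t"] t h_\<mm>A by auto
    also have "\<dots> = ?S (\<lambda>i. a i \<otimes>\<^bsub>A\<^esub> t)"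
    proof (rule M.M.finsum_cong')
      show "(\<lambda>i. h (a i \<otimes>\<^bsub>A\<^esub> t) \<odot>\<^bsub>M\<^esub> v i) \<in> X \<rightarrow> carrier M"
        using CA[OF a(1)] X t h_\<mm>A by auto
      fix i assume i: "i \<in> X"
      have "h (a i \<otimes>\<^bsub>A\<^esub> t) = h t \<otimes>\<^bsub>R\<^esub> h (a i)"
        using CA[OF a(1) i] t h_\<mm>A h A.m_comm[of "a i" t] by (auto simp: ring_hom_def)
      then show "h t \<odot>\<^bsub>M\<^esub> (h (a i) \<odot>\<^bsub>M\<^esub> v i) = h (a i \<otimes>\<^bsub>A\<^esub> t) \<odot>\<^bsub>M\<^esub> v i"
        using CA[OF a(1) i] t h_\<mm>A funcset_mem[OF X(2) i] M.smult_assoc1[of "h t" "h (a i)" "v i"] by simp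
    qed simp
    finally show ?thesis
      using a t by (auto simp: E_def A.ideal_power_simps intro!: exI[of _ "\<lambda>i. a i \<otimes>\<^bsub>A\<^esub> t"] ideal_prod.prod)
  qed
  \<comment> \<open>The inclusion of \<open>F k\<close> in \<open>G k\<close> is the correction
    step: an error in m_A^k M is a combination of the \<open>v i\<close> with coefficients in m_A^k,
    up to \<open>U\<close> and a new error in m_A^(k+1) M.\<close>
  define G where "G k = M.msum (M.msum (E k) U) (F (Suc k))" for k
  have G: "submodule (G k) A MA" for k
    unfolding G_def using MA.msum_submodule[OF MA.msum_submodule[OF E UA] FA] by simp
  have FG: "F k \<subseteq> G k" for k
  proof
    fix x assume "x \<in> F k"
    then show "x \<in> G k"
      unfolding F_def
    proof (rule MA.filt_least)
      have "\<mm>AM \<subseteq> F 1" using \<mm>AM_subset_filt by (simp add: F_def)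
      then have "M.msum (M.msum (E 0) U) \<mm>AM \<subseteq> G 0"
        unfolding G_def by (auto simp: M.msum_def)
      with gen show "carrier M \<subseteq> G 0" unfolding E0 by (rule subset_trans)
      show "{\<zero>\<^bsub>M\<^esub>} \<subseteq> G k" for k using MA.submodule_zero[OF G] by simp
      show "x \<oplus>\<^bsub>MA\<^esub> y \<in> G k" if "x \<in> G k" "y \<in> G k" for k x y
        using MA.submodule_add[OF G that] .
      fix k t x assume t: "t \<in> \<mm>A" and "x \<in> G k"
      then obtain e u w where x: "e \<in> E k" "u \<in> U" "w \<in> F (Suc k)" "x = e \<oplus>\<^bsub>M\<^esub> u \<oplus>\<^bsub>M\<^esub> w"
        unfolding G_def by (auto elim!: M.msumE)
      have c: "e \<in> carrier M" "u \<in> carrier M" "w \<in> carrier M" "h t \<in> carrier R"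
        using x MA.submodule_carrier[OF E] M.submodule_carrier[OF U] M.submodule_carrier[OF FR] t h_\<mm>A by auto
      have "h t \<odot>\<^bsub>M\<^esub> x = h t \<odot>\<^bsub>M\<^esub> e \<oplus>\<^bsub>M\<^esub> h t \<odot>\<^bsub>M\<^esub> u \<oplus>\<^bsub>M\<^esub> h t \<odot>\<^bsub>M\<^esub> w"
        using c by (simp add: x(4) M.smult_r_distr)
      moreover have "h t \<odot>\<^bsub>M\<^esub> u \<in> U" using M.submodule_smult[OF U c(4) x(2)] .
      moreover have "h t \<odot>\<^bsub>M\<^esub> w \<in> F (Suc (Suc k))"
        using MA.filt_smult[OF t x(3)[unfolded F_def]] by (simp add: F_def)
      ultimately show "t \<odot>\<^bsub>MA\<^esub> x \<in> G (Suc k)"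
        using smults[OF t x(1)] unfolding G_def by (auto intro!: M.msumI)
    qed
  qed
  fix x assume x: "x \<in> carrier M"
  \<comment> \<open>\<open>P k b\<close> says that the coefficients \<open>b\<close> represent
    \<open>x\<close> up to U + m_A^k M. Consecutive choices will differ by elements of m_A^k, which
    is the Cauchy condition of \<open>adically_complete\<close>.\<close>
  define P where "P k b \<longleftrightarrow> b \<in> X \<rightarrow> carrier A \<and> x \<ominus>\<^bsub>M\<^esub> ?S b \<in> M.msum U (F k)" for k b
  have Scl: "?S b \<in> carrier M" if "b \<in> X \<rightarrow> carrier A" for b
    using that X by (intro M.M.finsum_closed) auto
  have Sadd: "?S (\<lambda>i. a i \<oplus>\<^bsub>A\<^esub> b i) = ?S a \<oplus>\<^bsub>M\<^esub> ?S b" if "a \<in> X \<rightarrow> carrier A" "b \<in> X \<rightarrow> carrier A" for a b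
  proof -
    have "?S (\<lambda>i. a i \<oplus>\<^bsub>A\<^esub> b i) = (\<Oplus>\<^bsub>M\<^esub>i\<in>X. h (a i) \<odot>\<^bsub>M\<^esub> v i \<oplus>\<^bsub>M\<^esub> h (b i) \<odot>\<^bsub>M\<^esub> v i)"
      using that X h by (intro M.M.finsum_cong') (auto simp: Pi_iff ring_hom_def M.smult_l_distr)
    also have "\<dots> = ?S a \<oplus>\<^bsub>M\<^esub> ?S b"
      using that X by (intro M.M.finsum_addf) auto
    finally show ?thesis .
  qed
  have "\<exists>f. \<forall>k. P k (f k) \<and> (\<forall>i\<in>X. f (Suc k) i \<ominus>\<^bsub>A\<^esub> f k i \<in> ?C k)"
  proof (rule dependent_nat_choice[of P "\<lambda>k b c. \<forall>i\<in>X. c i \<ominus>\<^bsub>A\<^esub> b i \<in> ?C k"])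
    have "F 0 = carrier M"
      using module_pair.filt_0[OF MA.module_pairI[OF MA.carrier_is_submodule MA.zero_submodule]] by (simp add: F_def)
    then have "M.msum U (F 0) = carrier M"
      using M.msum_upper(2)[OF U FR[of 0]] M.submodule_carrier[OF M.msum_submodule[OF U FR[of 0]]] by auto
    then have "P 0 (\<lambda>_. \<zero>\<^bsub>A\<^esub>)"
      using Scl[of "\<lambda>_. \<zero>\<^bsub>A\<^esub>"] x by (simp add: P_def)
    then show "\<exists>b. P 0 b" by blast
    fix b k assume Pb: "P k b"
    then obtain u w where uw: "u \<in> U" "w \<in> F k" "x \<ominus>\<^bsub>M\<^esub> ?S b = u \<oplus>\<^bsub>M\<^esub> w" and b: "b \<in> X \<rightarrow> carrier A"
      by (auto simp: P_def elim!: M.msumE)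
    from uw(2) FG obtain e u' w' where w: "e \<in> E k" "u' \<in> U" "w' \<in> F (Suc k)" "w = e \<oplus>\<^bsub>M\<^esub> u' \<oplus>\<^bsub>M\<^esub> w'"
      unfolding G_def by (blast elim: M.msumE)
    from w(1) obtain a where a: "a \<in> X \<rightarrow> ?C k" "e = ?S a" by (auto simp: E_def)
    have aA: "a \<in> X \<rightarrow> carrier A" using CA[OF a(1)] by auto
    have c: "u \<in> carrier M" "u' \<in> carrier M" "w' \<in> carrier M" "e \<in> carrier M" "?S b \<in> carrier M"
      using uw w M.submodule_carrier[OF U] M.submodule_carrier[OF FR] MA.submodule_carrier[OF E] Scl[OF b] by auto
    have "x \<ominus>\<^bsub>M\<^esub> ?S (\<lambda>i. b i \<oplus>\<^bsub>A\<^esub> a i) = (x \<ominus>\<^bsub>M\<^esub> ?S b) \<ominus>\<^bsub>M\<^esub> e"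
      using c x by (simp add: Sadd[OF b aA] a(2)[symmetric] M.M.minus_eq M.M.minus_add M.M.a_ac)
    also have "\<dots> = (u \<oplus>\<^bsub>M\<^esub> u') \<oplus>\<^bsub>M\<^esub> w'"
    proof -
      have "u \<oplus>\<^bsub>M\<^esub> w = (u \<oplus>\<^bsub>M\<^esub> u') \<oplus>\<^bsub>M\<^esub> w' \<oplus>\<^bsub>M\<^esub> e"
        using c by (simp add: w(4) M.M.a_ac)
      then show ?thesis
        using c M.minus_cancel(3)[of "(u \<oplus>\<^bsub>M\<^esub> u') \<oplus>\<^bsub>M\<^esub> w'" e] by (simp add: uw(3))
    qed
    finally have "P (Suc k) (\<lambda>i. b i \<oplus>\<^bsub>A\<^esub> a i)"
      using b aA M.submodule_add[OF U uw(1) w(2)] w(3) by (auto simp: P_def intro!: M.msumI)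
    moreover have "\<forall>i\<in>X. b i \<oplus>\<^bsub>A\<^esub> a i \<ominus>\<^bsub>A\<^esub> b i \<in> ?C k"
    proof
      fix i assume i: "i \<in> X"
      then have "b i \<oplus>\<^bsub>A\<^esub> a i \<ominus>\<^bsub>A\<^esub> b i = a i"
        using A.self.minus_cancel(4)[of "a i" "b i"] b aA by (auto simp: a_minus_def a_inv_def m_inv_def)
      then show "b i \<oplus>\<^bsub>A\<^esub> a i \<ominus>\<^bsub>A\<^esub> b i \<in> ?C k" using a i by auto
    qed
    ultimately show "\<exists>c. P (Suc k) c \<and> (\<forall>i\<in>X. c i \<ominus>\<^bsub>A\<^esub> b i \<in> ?C k)" by blast
  qed
  then obtain f where f: "\<And>k. P k (f k)" "\<And>k i. i \<in> X \<Longrightarrow> f (Suc k) i \<ominus>\<^bsub>A\<^esub> f k i \<in> ?C k" by blast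
  have fA: "f k \<in> X \<rightarrow> carrier A" for k using f(1) by (simp add: P_def)
  have "\<exists>b. b \<in> carrier A \<and> (\<forall>k. f k i \<ominus>\<^bsub>A\<^esub> b \<in> ?C k)" if i: "i \<in> X" for i
    using A.complete[unfolded adically_complete_def, rule_format, of "\<lambda>k. f k i"] f(2) fA i by blast
  then obtain \<beta> where \<beta>: "\<And>i. i \<in> X \<Longrightarrow> \<beta> i \<in> carrier A" "\<And>i k. i \<in> X \<Longrightarrow> f k i \<ominus>\<^bsub>A\<^esub> \<beta> i \<in> ?C k" by metis
  have \<beta>A: "\<beta> \<in> X \<rightarrow> carrier A" using \<beta> by auto
  \<comment> \<open>At each level \<open>k\<close> the error of the limit is the error of the k-th
    approximation plus a combination with coefficients in m_A^k; both lie in m_R^k M + U.\<close>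
  have "x \<ominus>\<^bsub>M\<^esub> ?S \<beta> \<in> U"
  proof (rule M.krull_intersection[OF R.one_minus_unit R.is_ideal order_refl])
    show "M.noeth_between U (carrier M)"
      using M_noeth_between[OF U M.carrier_is_submodule] M.submodule_carrier[OF U] by blast
    fix k
    let ?P = "M.filt (carrier M) U \<mm>R k"
    interpret K: module_pair R M "carrier M" U
      using M.module_pairI[OF M.carrier_is_submodule U] M.submodule_carrier[OF U] by blast
    have P: "submodule ?P R M" using K.filt_submodule R.Icarr by blast
    have d: "(\<lambda>i. f k i \<ominus>\<^bsub>A\<^esub> \<beta> i) \<in> X \<rightarrow> ?C k" using \<beta>(2) by auto
    have dA: "(\<lambda>i. f k i \<ominus>\<^bsub>A\<^esub> \<beta> i) \<in> X \<rightarrow> carrier A" using CA[OF d] by blast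
    have "?S (\<lambda>i. f k i \<ominus>\<^bsub>A\<^esub> \<beta> i) \<in> ?P"
    proof (rule M.submodule_finsum[OF P X(1)])
      fix i assume i: "i \<in> X"
      have "(f k i \<ominus>\<^bsub>A\<^esub> \<beta> i) \<odot>\<^bsub>MA\<^esub> v i \<in> MA.filt (carrier M) {\<zero>\<^bsub>M\<^esub>} \<mm>A k"
      proof (rule MA.ideal_power_smult_filt[OF A.is_ideal])
        show "module_pair A MA (carrier M) {\<zero>\<^bsub>M\<^esub>}"
          using MA.module_pairI[OF MA.carrier_is_submodule MA.zero_submodule] by simp
      qed (use \<beta>(2) i X in auto)
      then show "h (f k i \<ominus>\<^bsub>A\<^esub> \<beta> i) \<odot>\<^bsub>M\<^esub> v i \<in> ?P"
        using filt_MA_subset_filt[OF U] by auto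
    qed
    moreover have "x \<ominus>\<^bsub>M\<^esub> ?S (f k) \<in> ?P"
    proof -
      have "M.msum U (F k) \<subseteq> ?P"
        by (rule M.msum_least[OF P]) (use filt_MA_subset_filt[OF U] in \<open>auto simp: F_def intro: M.filt_base\<close>)
      then show ?thesis using f(1)[of k] by (auto simp: P_def)
    qed
    moreover have "x \<ominus>\<^bsub>M\<^esub> ?S \<beta> = (x \<ominus>\<^bsub>M\<^esub> ?S (f k)) \<oplus>\<^bsub>M\<^esub> ?S (\<lambda>i. f k i \<ominus>\<^bsub>A\<^esub> \<beta> i)"
    proof -
      have "?S (f k) = ?S (\<lambda>i. (f k i \<ominus>\<^bsub>A\<^esub> \<beta> i) \<oplus>\<^bsub>A\<^esub> \<beta> i)"
      proof (rule M.M.finsum_cong')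
        fix i assume i: "i \<in> X"
        then have "(f k i \<ominus>\<^bsub>A\<^esub> \<beta> i) \<oplus>\<^bsub>A\<^esub> \<beta> i = f k i"
          using funcset_mem[OF fA i] \<beta>(1)[OF i] by (simp add: A.minus_eq A.a_assoc A.l_neg)
        then show "h (f k i) \<odot>\<^bsub>M\<^esub> v i = h ((f k i \<ominus>\<^bsub>A\<^esub> \<beta> i) \<oplus>\<^bsub>A\<^esub> \<beta> i) \<odot>\<^bsub>M\<^esub> v i" by simp
      next
        show "(\<lambda>i. h ((f k i \<ominus>\<^bsub>A\<^esub> \<beta> i) \<oplus>\<^bsub>A\<^esub> \<beta> i) \<odot>\<^bsub>M\<^esub> v i) \<in> X \<rightarrow> carrier M"
          by (intro Pi_I M.smult_closed h_closed A.add.m_closed funcset_mem[OF dA] \<beta>(1) funcset_mem[OF X(2)])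
      qed simp
      then have "?S (f k) = ?S (\<lambda>i. f k i \<ominus>\<^bsub>A\<^esub> \<beta> i) \<oplus>\<^bsub>M\<^esub> ?S \<beta>"
        using Sadd[OF dA \<beta>A] by simp
      then show ?thesis
        using M.minus_add_cancel[OF x Scl[OF \<beta>A] Scl[OF dA]] by simp
    qed
    ultimately show "x \<ominus>\<^bsub>M\<^esub> ?S \<beta> \<in> ?P"
      using M.submodule_add[OF P] by simp
  qed
  moreover have "?S \<beta> \<in> module_span A MA (v ` X)"
    unfolding E0 E_def using \<beta>A by (auto simp: A.ideal_power_simps)
  ultimately show "x \<in> M.msum (module_span A MA (v ` X)) U"
    using M.minus_cancel(1)[OF x Scl[OF \<beta>A]] by (intro M.msumI) auto
qed

end

section \<open>Reductions modulo a perturbed ideal\<close>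

context module
begin

lemma submodule_abelian_subgroup:
  assumes "submodule U R M"
  shows "abelian_subgroup U M"
  by (intro abelian_subgroupI3 additive_subgroup.intro submodule.axioms(1)[OF assms] M.abelian_group_axioms)

lemma quotient_surjection:
  assumes U: "submodule U R M"
  shows "module_surjection R M (quotient_module M U) (\<lambda>x. U +>\<^bsub>M\<^esub> x)"
proof -
  interpret U: abelian_subgroup U M by (rule submodule_abelian_subgroup[OF U])
  show ?thesis
  proof (intro module_surjection.intro module_surjection_axioms.intro module_axioms)
    show "(\<lambda>x. U +>\<^bsub>M\<^esub> x) ` carrier M = carrier (quotient_module M U)"
      by (auto simp: quotient_module_def A_RCOSETS_def')
    show "U +>\<^bsub>M\<^esub> (x \<oplus>\<^bsub>M\<^esub> y) = (U +>\<^bsub>M\<^esub> x) \<oplus>\<^bsub>quotient_module M U\<^esub> (U +>\<^bsub>M\<^esub> y)"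
      if "x \<in> carrier M" "y \<in> carrier M" for x y
      using U.a_rcos_sum[OF that] by (simp add: quotient_module_def)
    show "U +>\<^bsub>M\<^esub> \<zero>\<^bsub>M\<^esub> = \<zero>\<^bsub>quotient_module M U\<^esub>"
      using M.a_coset_add_zero[OF U.a_subset] by (simp add: quotient_module_def)
    fix r x assume r: "r \<in> carrier R" and x: "x \<in> carrier M"
    \<comment> \<open>Scalar multiplication of cosets is a union over representatives; all the
      cosets in this union coincide.\<close>
    have eq: "U +>\<^bsub>M\<^esub> (r \<odot>\<^bsub>M\<^esub> z) = U +>\<^bsub>M\<^esub> (r \<odot>\<^bsub>M\<^esub> x)" if z: "z \<in> U +>\<^bsub>M\<^esub> x" for z
    proof -
      from z obtain u where u: "u \<in> U" "z = u \<oplus>\<^bsub>M\<^esub> x" by (auto simp: a_r_coset_def')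
      then have "r \<odot>\<^bsub>M\<^esub> z = r \<odot>\<^bsub>M\<^esub> u \<oplus>\<^bsub>M\<^esub> r \<odot>\<^bsub>M\<^esub> x"
        using r x submodule_carrier[OF U] by (simp add: smult_r_distr)
      then have "r \<odot>\<^bsub>M\<^esub> z \<in> U +>\<^bsub>M\<^esub> (r \<odot>\<^bsub>M\<^esub> x)"
        using submodule_smult[OF U r u(1)] by (auto simp: a_r_coset_def')
      then show ?thesis
        using M.a_repr_independence[of "r \<odot>\<^bsub>M\<^esub> z" U "r \<odot>\<^bsub>M\<^esub> x"] r x U.a_subgroup by simp
    qed
    have "(\<Union>z\<in>U +>\<^bsub>M\<^esub> x. U +>\<^bsub>M\<^esub> (r \<odot>\<^bsub>M\<^esub> z)) = (\<Union>z\<in>U +>\<^bsub>M\<^esub> x. U +>\<^bsub>M\<^esub> (r \<odot>\<^bsub>M\<^esub> x))"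
      using eq by (rule SUP_cong[OF refl])
    also have "\<dots> = U +>\<^bsub>M\<^esub> (r \<odot>\<^bsub>M\<^esub> x)"
      using U.a_rcos_self[OF x] by (simp add: SUP_constant) blast
    finally show "U +>\<^bsub>M\<^esub> (r \<odot>\<^bsub>M\<^esub> x) = r \<odot>\<^bsub>quotient_module M U\<^esub> (U +>\<^bsub>M\<^esub> x)"
      by (simp add: quotient_module_def)
  qed
qed

lemma coset_eq_iff:
  assumes U: "submodule U R M" and x: "x \<in> carrier M"
  shows "U +>\<^bsub>M\<^esub> x = U \<longleftrightarrow> x \<in> U"
proof -
  interpret U: abelian_subgroup U M by (rule submodule_abelian_subgroup[OF U])
  show ?thesis
    using U.a_rcos_self[OF x] U.a_rcos_const[of x] by auto
qed

end

section \<open>Generators of M/IM and of M/bM over the base ring\<close>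

context local_extension_module
begin

lemma restrict_surjection:
  assumes "module_surjection R M Q \<pi>"
  shows "module_surjection A MA (restrict_scalars h Q) \<pi>"
proof -
  interpret Q: module_surjection R M Q \<pi> by fact
  show ?thesis
    by (intro module_surjection.intro module_surjection_axioms.intro MA.module_axioms)
      (simp_all add: Q.surj Q.map_add Q.map_smult Q.map_zero)
qed

lemma reduction_surjection:
  assumes "J \<subseteq> carrier R"
  shows "module_surjection A MA (reduction h R M J) (reduction_map R M J)"
  unfolding reduction_def
  using restrict_surjection[OF M.quotient_surjection[OF M.ideal_smult_submodule[OF assms]]]
  by (simp add: reduction_map_def[abs_def])

lemma reduction_kernel:
  assumes "J \<subseteq> carrier R" "x \<in> carrier M"
  shows "reduction_map R M J x = \<zero>\<^bsub>reduction h R M J\<^esub> \<longleftrightarrow> x \<in> ideal_smult R J M"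
  using M.coset_eq_iff[OF M.ideal_smult_submodule[OF assms(1)] assms(2)]
  by (simp add: reduction_map_def reduction_def quotient_module_def)

lemma reduction_span_iff:
  assumes "J \<subseteq> carrier R" "X \<subseteq> carrier M"
  shows "module_span A (reduction h R M J) (reduction_map R M J ` X) = carrier (reduction h R M J) \<longleftrightarrow>
    carrier M \<subseteq> M.msum (module_span A MA X) (ideal_smult R J M)"
proof -
  interpret Q: module_surjection A MA "reduction h R M J" "reduction_map R M J"
    by (rule reduction_surjection[OF assms(1)])
  show ?thesis
    using Q.span_image_eq_carrier_iff[of X "ideal_smult R J M"] assms reduction_kernel[OF assms(1)]
      M.submoduleE(1)[OF M.ideal_smult_submodule[OF assms(1)]] by simp
qed

text \<open>Since \<open>U\<close> lies in V + m_A M, generators modulo \<open>U\<close> are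
  generators modulo V + m_A M, and \<open>complete_nakayama\<close> removes the summand m_A
  M.\<close>

lemma generation_transfer:
  assumes U: "submodule U R M" and V: "submodule V R M" and UV: "U \<subseteq> M.msum V \<mm>AM"
    and X: "finite X" "X \<subseteq> carrier M" and gen: "carrier M \<subseteq> M.msum (module_span A MA X) U"
  shows "carrier M \<subseteq> M.msum (module_span A MA X) V"
proof -
  have X': "X \<subseteq> carrier MA" using X(2) by simp
  note s = MA.span_submodule[OF X']
  note VA = submodule_MA[OF V] and mA = submodule_MA[OF \<mm>AM_submodule]
  let ?B = "M.msum (M.msum (module_span A MA X) V) \<mm>AM"
  have B: "submodule ?B A MA"
    using MA.msum_submodule[OF MA.msum_submodule[OF s VA] mA] by simp
  note u = MA.msum_upper[OF MA.msum_submodule[OF s VA] mA] and u' = MA.msum_upper[OF s VA]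
  have "M.msum V \<mm>AM \<subseteq> ?B"
    using MA.msum_least[OF B, of V \<mm>AM] u u' by auto
  then have "M.msum (module_span A MA X) U \<subseteq> ?B"
    using MA.msum_least[OF B, of "module_span A MA X" U] u u' UV by auto
  with gen have "carrier M \<subseteq> ?B" by (rule subset_trans)
  then show ?thesis
    using complete_nakayama[OF V X(1), of "\<lambda>x. x"] X(2) by auto
qed

text \<open>With J = I + m_A R, both inclusions come from JM = bM + m_A M and JM = IM + m_A M. The
  first equation is Nakayama's lemma over \<open>R\<close>: for each generator f_i x = (f_i + eps_i)
  x - eps_i x, and eps_i x lies in m_R J M.\<close>

lemma perturbed_smult:
  assumes I: "ideal I R" and f: "ideal_generators R I c f"
    and \<epsilon>: "\<epsilon> \<in> {..<c} \<rightarrow> ideal_prod R \<mm>R (set_add R I (Idl\<^bsub>R\<^esub> (h ` \<mm>A)))"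
  defines "\<bb> \<equiv> perturbed_ideal R c f \<epsilon>"
  shows "ideal \<bb> R"
    and "ideal_smult R I M \<subseteq> M.msum (ideal_smult R \<bb> M) \<mm>AM"
    and "ideal_smult R \<bb> M \<subseteq> M.msum (ideal_smult R I M) \<mm>AM"
proof -
  let ?Y = "Idl\<^bsub>R\<^esub> (h ` \<mm>A)"
  let ?J = "set_add R I ?Y"
  have Y: "ideal ?Y R" by (rule R.genideal_ideal[OF h\<mm>A_carrier])
  have J: "ideal ?J R" by (rule R.add_ideals[OF I Y])
  note up = R.set_add_upper[OF I Y]
  interpret J: ideal ?J R by (rule J)
  have IR: "I \<subseteq> carrier R" and JR: "?J \<subseteq> carrier R" and YR: "?Y \<subseteq> carrier R"
    using ideal.Icarr[OF I] ideal.Icarr[OF J] ideal.Icarr[OF Y] by auto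
  have fR: "f i \<in> carrier R" "f i \<in> I" if "i < c" for i
    using f that R.genideal_self[of "f ` {..<c}"] by (auto simp: ideal_generators_def)
  have e: "\<epsilon> i \<in> ideal_prod R \<mm>R ?J" if "i < c" for i using \<epsilon> that by auto
  have eJ: "\<epsilon> i \<in> ?J" if "i < c" for i
    using e[OF that] R.ideal_prod_inter[OF R.is_ideal J] by auto
  have eR: "\<epsilon> i \<in> carrier R" if "i < c" for i using eJ[OF that] JR by auto
  have F: "(\<lambda>i. f i \<oplus>\<^bsub>R\<^esub> \<epsilon> i) ` {..<c} \<subseteq> carrier R" using fR eR by auto
  then show b: "ideal \<bb> R"
    unfolding \<bb>_def perturbed_ideal_def by (rule R.genideal_ideal)
  have bR: "\<bb> \<subseteq> carrier R" using ideal.Icarr[OF b] by auto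
  have "f i \<oplus>\<^bsub>R\<^esub> \<epsilon> i \<in> ?J" if "i < c" for i
    using J.a_closed fR(2)[OF that] eJ[OF that] up by auto
  then have bJ: "\<bb> \<subseteq> ?J"
    unfolding \<bb>_def perturbed_ideal_def by (intro R.genideal_minimal[OF J]) auto
  note sI = M.ideal_smult_submodule[OF IR] and sb = M.ideal_smult_submodule[OF bR]
    and sJ = M.ideal_smult_submodule[OF JR]
  have JB: "ideal_smult R ?J M \<subseteq> B"
    if B: "submodule B R M" "\<And>i x. \<lbrakk>i < c; x \<in> carrier M\<rbrakk> \<Longrightarrow> f i \<odot>\<^bsub>M\<^esub> x \<in> B" "\<mm>AM \<subseteq> B" for B
  proof (rule M.ideal_smult_least[OF B(1)])
    fix r x assume r: "r \<in> ?J" and x: "x \<in> carrier M"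
    from r obtain i y where iy: "i \<in> I" "y \<in> ?Y" "r = i \<oplus>\<^bsub>R\<^esub> y"
      by (auto simp: set_add_def')
    have "i \<odot>\<^bsub>M\<^esub> x \<in> B"
      by (rule M.genideal_smult_mem[of "f ` {..<c}", OF _ B(1) order_refl _ _ x])
        (use f iy(1) B(2) in \<open>auto simp: ideal_generators_def\<close>)
    moreover have "y \<odot>\<^bsub>M\<^esub> x \<in> B"
      using M.ideal_smultI[OF iy(2) x] B(3) by (auto simp: \<mm>AM_def)
    ultimately show "r \<odot>\<^bsub>M\<^esub> x \<in> B"
      using M.submodule_add[OF B(1)] iy IR YR x by (simp add: M.smult_l_distr subset_iff)
  qed
  let ?U = "M.msum (ideal_smult R \<bb> M) \<mm>AM"
  have U: "submodule ?U R M" by (rule M.msum_submodule[OF sb \<mm>AM_submodule])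
  note uU = M.msum_upper[OF sb \<mm>AM_submodule]
  have YJ: "\<mm>AM \<subseteq> ideal_smult R ?J M"
    unfolding \<mm>AM_def by (rule M.ideal_smult_mono[OF up(2) JR])
  have UJ: "?U \<subseteq> ideal_smult R ?J M"
    by (rule M.msum_least[OF sJ M.ideal_smult_mono[OF bJ JR] YJ])
  have "ideal_smult R ?J M \<subseteq> ?U"
  proof (rule M.nakayama[OF R.one_minus_unit])
    show "M.noeth_between ?U (ideal_smult R ?J M)" by (rule M_noeth_between[OF U sJ UJ])
    fix B assume B: "submodule B R M" "?U \<subseteq> B"
      "\<And>r x. \<lbrakk>r \<in> \<mm>R; x \<in> ideal_smult R ?J M\<rbrakk> \<Longrightarrow> r \<odot>\<^bsub>M\<^esub> x \<in> B"
    show "ideal_smult R ?J M \<subseteq> B"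
    proof (rule JB[OF B(1)])
      show "\<mm>AM \<subseteq> B" using uU B(2) by auto
      fix i x assume i: "i < c" and x: "x \<in> carrier M"
      have "r \<odot>\<^bsub>M\<^esub> x \<in> B" if "r \<in> ideal_prod R \<mm>R ?J" for r
        using that
      proof (induction rule: ideal_prod.induct)
        case (prod a b)
        then show ?case
          using B(3)[OF prod(1) M.ideal_smultI[OF prod(2) x]] x R.Icarr JR by (simp add: M.smult_assoc1 subset_iff)
      next
        case (sum a b)
        then show ?case
          using M.submodule_add[OF B(1)] x ideal.Icarr[OF R.ideal_prod_is_ideal[OF R.is_ideal J]]
          by (simp add: M.smult_l_distr)
      qed
      then have 1: "\<epsilon> i \<odot>\<^bsub>M\<^esub> x \<in> B" using e[OF i] by simp
      have "f i \<oplus>\<^bsub>R\<^esub> \<epsilon> i \<in> \<bb>"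
        unfolding \<bb>_def perturbed_ideal_def using R.genideal_self[OF F] i by auto
      then have "(f i \<oplus>\<^bsub>R\<^esub> \<epsilon> i) \<odot>\<^bsub>M\<^esub> x \<in> B"
        using M.ideal_smultI[OF _ x] uU B(2) by blast
      then have "f i \<odot>\<^bsub>M\<^esub> x \<oplus>\<^bsub>M\<^esub> \<epsilon> i \<odot>\<^bsub>M\<^esub> x \<in> B"
        using fR[OF i] eR[OF i] x by (simp add: M.smult_l_distr)
      then show "f i \<odot>\<^bsub>M\<^esub> x \<in> B"
        using M.submodule_mem_cancel[OF B(1) _ 1] fR[OF i] x by simp
    qed
  qed
  then show "ideal_smult R I M \<subseteq> ?U"
    using M.ideal_smult_mono[OF up(1) JR] by blast
  have "ideal_smult R ?J M \<subseteq> M.msum (ideal_smult R I M) \<mm>AM"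
  proof (rule JB)
    show "submodule (M.msum (ideal_smult R I M) \<mm>AM) R M"
      by (rule M.msum_submodule[OF sI \<mm>AM_submodule])
    show "\<mm>AM \<subseteq> M.msum (ideal_smult R I M) \<mm>AM"
      using M.msum_upper[OF sI \<mm>AM_submodule] by simp
    show "f i \<odot>\<^bsub>M\<^esub> x \<in> M.msum (ideal_smult R I M) \<mm>AM" if "i < c" "x \<in> carrier M" for i x
      using M.msum_upper[OF sI \<mm>AM_submodule] M.ideal_smultI[OF fR(2)[OF that(1)] that(2)] by blast
  qed
  then show "ideal_smult R \<bb> M \<subseteq> M.msum (ideal_smult R I M) \<mm>AM"
    using M.ideal_smult_mono[OF bJ JR] by blast
qed

text \<open>For every index set \<open>K\<close> the classes of the \<open>m i\<close> with
  \<open>i\<close> in \<open>K\<close> generate M/IM if and only if they generate M/bM, because the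
  inclusions of \<open>perturbed_smult\<close> go both ways. The full index set gives generation,
  the proper subsets give minimality.\<close>

theorem perturbed_minimal_generators:
  assumes I: "ideal I R" and f: "ideal_generators R I c f"
    and \<epsilon>: "\<epsilon> \<in> {..<c} \<rightarrow> ideal_prod R \<mm>R (set_add R I (Idl\<^bsub>R\<^esub> (h ` \<mm>A)))"
    and m: "m \<in> {..<\<mu>} \<rightarrow> carrier M"
    and gen: "minimal_generating_family A (reduction h R M I) \<mu> (\<lambda>i. reduction_map R M I (m i))"
  defines "\<bb> \<equiv> perturbed_ideal R c f \<epsilon>"
  shows "minimal_generating_family A (reduction h R M \<bb>) \<mu> (\<lambda>i. reduction_map R M \<bb> (m i))"
proof -
  note p = perturbed_smult[OF I f \<epsilon>, folded \<bb>_def]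
  have R: "I \<subseteq> carrier R" "\<bb> \<subseteq> carrier R"
    using ideal.Icarr[OF I] ideal.Icarr[OF p(1)] by auto
  note s = M.ideal_smult_submodule[OF R(1)] M.ideal_smult_submodule[OF R(2)]
  have iff: "module_span A (reduction h R M \<bb>) ((\<lambda>i. reduction_map R M \<bb> (m i)) ` K) = carrier (reduction h R M \<bb>) \<longleftrightarrow>
      module_span A (reduction h R M I) ((\<lambda>i. reduction_map R M I (m i)) ` K) = carrier (reduction h R M I)"
    if "K \<subseteq> {..<\<mu>}" for K
  proof -
    have X: "finite (m ` K)" "m ` K \<subseteq> carrier M"
      using that m finite_subset[OF that] by auto
    show ?thesis
      using reduction_span_iff[OF R(1) X(2)] reduction_span_iff[OF R(2) X(2)]
        generation_transfer[OF s p(2) X] generation_transfer[OF s(2,1) p(3) X]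
      by (simp add: image_image) blast
  qed
  interpret Q: module_surjection A MA "reduction h R M \<bb>" "reduction_map R M \<bb>"
    by (rule reduction_surjection[OF R(2)])
  have "(\<lambda>i. reduction_map R M \<bb> (m i)) \<in> {..<\<mu>} \<rightarrow> carrier (reduction h R M \<bb>)"
    using m Q.map_closed by auto
  with gen iff show ?thesis
    unfolding minimal_generating_family_def generating_family_def by (auto simp: psubset_eq)
qed

end

section \<open>Module finiteness of the quotient by the perturbed ideal\<close>

context local_extension
begin

sublocale self: local_extension_module A \<mm>A R \<mm>R h "self_module R"
  by (intro local_extension_module.intro local_extension_axioms local_extension_module_axioms.intro R.self_fin_gen)

lemma ideal_smult_self:
  assumes "ideal I R"
  shows "ideal_smult R I (self_module R) = I"
proof
  show "ideal_smult R I (self_module R) \<subseteq> I"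
    by (rule R.self.ideal_smult_least) (use assms R.submodule_self_iff ideal.I_r_closed[OF assms] in auto)
  show "I \<subseteq> ideal_smult R I (self_module R)"
  proof
    fix x assume "x \<in> I"
    then show "x \<in> ideal_smult R I (self_module R)"
      using R.self.ideal_smultI[of x I "\<one>\<^bsub>R\<^esub>"] ideal.Icarr[OF assms] by simp
  qed
qed

lemma quotient_ring_surjection:
  assumes "ideal I R"
  shows "module_surjection A self.MA (ring_as_module (\<lambda>a. I +>\<^bsub>R\<^esub> h a) (R Quot I)) (\<lambda>x. I +>\<^bsub>R\<^esub> x)"
proof -
  interpret I: ideal I R by fact
  show ?thesis
  proof (intro module_surjection.intro module_surjection_axioms.intro self.MA.module_axioms)
    show "(\<lambda>x. I +>\<^bsub>R\<^esub> x) ` carrier self.MA = carrier (ring_as_module (\<lambda>a. I +>\<^bsub>R\<^esub> h a) (R Quot I))"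
      by (auto simp: FactRing_def A_RCOSETS_def')
  qed (simp_all add: FactRing_def I.a_rcos_sum I.rcoset_mult_add R.a_coset_add_zero[OF I.a_subset])
qed

lemma quotient_ring_kernel:
  assumes "ideal I R" "x \<in> carrier R"
  shows "I +>\<^bsub>R\<^esub> x = \<zero>\<^bsub>ring_as_module \<phi> (R Quot I)\<^esub> \<longleftrightarrow> x \<in> I"
proof -
  interpret I: ideal I R by fact
  show ?thesis
    using I.a_rcos_self[OF assms(2)] I.a_rcos_const[of x] by (auto simp: FactRing_def)
qed

text \<open>Lifting generators of R/I makes finiteness a statement about \<open>R\<close> as an
  A-module, so that \<open>generation_transfer\<close> can be applied to the module M = R.\<close>

lemma module_finite_iff:
  assumes I: "ideal I R"
  shows "module_finite A (\<lambda>a. I +>\<^bsub>R\<^esub> h a) (R Quot I) \<longleftrightarrow>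
    (\<exists>X. finite X \<and> X \<subseteq> carrier R \<and> carrier R \<subseteq> R.self.msum (module_span A self.MA X) I)"
proof -
  interpret Q: module_surjection A self.MA "ring_as_module (\<lambda>a. I +>\<^bsub>R\<^esub> h a) (R Quot I)" "\<lambda>x. I +>\<^bsub>R\<^esub> x"
    by (rule quotient_ring_surjection[OF I])
  let ?Q = "ring_as_module (\<lambda>a. I +>\<^bsub>R\<^esub> h a) (R Quot I)"
  have iff: "module_span A ?Q ((\<lambda>x. I +>\<^bsub>R\<^esub> x) ` X) = carrier ?Q \<longleftrightarrow> carrier R \<subseteq> R.self.msum (module_span A self.MA X) I"
    if "X \<subseteq> carrier R" for X
    using Q.span_image_eq_carrier_iff[of X I] that quotient_ring_kernel[OF I] ideal.Icarr[OF I]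
    by (simp add: subset_iff)
  show ?thesis
  proof
    assume "module_finite A (\<lambda>a. I +>\<^bsub>R\<^esub> h a) (R Quot I)"
    then obtain S where S: "finite S" "S \<subseteq> carrier ?Q" "module_span A ?Q S = carrier ?Q"
      by (auto simp: module_finite_def fin_gen_module_def)
    then have "S \<subseteq> (\<lambda>x. I +>\<^bsub>R\<^esub> x) ` carrier R"
      using Q.surj by simp
    then obtain X where "X \<subseteq> carrier R" "finite X" "S = (\<lambda>x. I +>\<^bsub>R\<^esub> x) ` X"
      using finite_subset_image[OF S(1)] by metis
    then show "\<exists>X. finite X \<and> X \<subseteq> carrier R \<and> carrier R \<subseteq> R.self.msum (module_span A self.MA X) I"
      using iff S(3) by blast
  next
    assume "\<exists>X. finite X \<and> X \<subseteq> carrier R \<and> carrier R \<subseteq> R.self.msum (module_span A self.MA X) I"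
    then obtain X where X: "finite X" "X \<subseteq> carrier R" "carrier R \<subseteq> R.self.msum (module_span A self.MA X) I" by blast
    then show "module_finite A (\<lambda>a. I +>\<^bsub>R\<^esub> h a) (R Quot I)"
      unfolding module_finite_def fin_gen_module_def
      using iff[OF X(2)] Q.target_module Q.map_closed
      by (intro conjI exI[of _ "(\<lambda>x. I +>\<^bsub>R\<^esub> x) ` X"]) auto
  qed
qed

theorem perturbed_module_finite:
  assumes I: "ideal I R" and f: "ideal_generators R I c f"
    and \<epsilon>: "\<epsilon> \<in> {..<c} \<rightarrow> ideal_prod R \<mm>R (set_add R I (Idl\<^bsub>R\<^esub> (h ` \<mm>A)))"
    and fin: "module_finite A (\<lambda>a. I +>\<^bsub>R\<^esub> h a) (R Quot I)"
  defines "\<bb> \<equiv> perturbed_ideal R c f \<epsilon>"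
  shows "module_finite A (\<lambda>a. \<bb> +>\<^bsub>R\<^esub> h a) (R Quot \<bb>)"
proof -
  note p = self.perturbed_smult[OF I f \<epsilon>, folded \<bb>_def]
  note q = p(2)[unfolded ideal_smult_self[OF I] ideal_smult_self[OF p(1)]]
  from fin obtain X where X: "finite X" "X \<subseteq> carrier R" "carrier R \<subseteq> R.self.msum (module_span A self.MA X) I"
    unfolding module_finite_iff[OF I] by blast
  have "carrier (self_module R) \<subseteq> R.self.msum (module_span A self.MA X) \<bb>"
    by (rule self.generation_transfer[OF _ _ q X(1)]) (use X I p(1) R.submodule_self_iff in auto)
  then show ?thesis
    unfolding module_finite_iff[OF p(1)] using X by auto
qed

end

section \<open>Finiteness over the base and change of generators\<close>

lemma a_inv_ring_as_module [simp]: "a_inv (ring_as_module h S) = a_inv S"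
  and a_minus_ring_as_module [simp]: "a_minus (ring_as_module h S) = a_minus S"
  and finsum_ring_as_module [simp]: "finsum (ring_as_module h S) = finsum S"
  by (simp_all add: fun_eq_iff a_inv_def a_minus_def m_inv_def finsum_def finprod_def ring_as_module_def)

lemma (in cring) add_sub_split:
  assumes "p \<in> carrier R" "v \<in> carrier R" "q \<in> carrier R"
  shows "p \<oplus> q = (p \<oplus> v) \<oplus> (q \<oplus> \<ominus> \<one> \<otimes> v)"
  using assms by algebra

text \<open>The computation behind \<open>power_mem_of_span\<close>: if \<open>b\<close> is inverse
  to \<open>a\<close>, then a w + j = r w x becomes (1 - b r x) w = - b j, and in the application 1
  - b r x is a unit.\<close>

lemma (in cring) unit_relation:
  assumes "a \<in> carrier R" "b \<in> carrier R" "b \<otimes> a = \<one>" "w \<in> carrier R" "v \<in> carrier R" "j \<in> carrier R"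
    "r \<in> carrier R" "x \<in> carrier R" and e: "(a \<otimes> w \<oplus> v) \<oplus> j \<ominus> v = r \<otimes> (w \<otimes> x)"
  shows "(\<one> \<ominus> (b \<otimes> r) \<otimes> x) \<otimes> w = \<ominus> (b \<otimes> j)"
proof -
  have "(a \<otimes> w \<oplus> v) \<oplus> j \<ominus> v = a \<otimes> w \<oplus> j"
    using assms(1-8) by algebra
  then have "b \<otimes> (r \<otimes> (w \<otimes> x)) = b \<otimes> (a \<otimes> w \<oplus> j)"
    using e by simp
  also have "\<dots> = (b \<otimes> a) \<otimes> w \<oplus> b \<otimes> j"
    using assms(1,2,4,6) m_assoc[of b a w] by (simp add: r_distr del: assms(3))
  also have "\<dots> = w \<oplus> b \<otimes> j"
    using assms(1-8) by simp
  finally have *: "b \<otimes> (r \<otimes> (w \<otimes> x)) = w \<oplus> b \<otimes> j" .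
  have "(\<one> \<ominus> (b \<otimes> r) \<otimes> x) \<otimes> w = w \<ominus> b \<otimes> (r \<otimes> (w \<otimes> x))"
    using assms(2,4,7,8) by algebra
  also have "\<dots> = \<ominus> (b \<otimes> j)"
    unfolding * using assms(2,4,6) by algebra
  finally show ?thesis .
qed

section \<open>A power of m_R inside I + m_A R\<close>

context local_extension
begin

lemma power_mem_of_span:
  assumes J: "ideal J R" "h ` \<mm>A \<subseteq> J" and x: "x \<in> \<mm>R"
    and "l \<le> (N::nat)" "x [^]\<^bsub>R\<^esub> N \<in> R.self.msum (module_span A self.MA ((\<lambda>i. x [^]\<^bsub>R\<^esub> i) ` {l..<N})) J"
  shows "\<exists>n::nat. x [^]\<^bsub>R\<^esub> n \<in> J"
  using assms(4,5)
proof (induction "N - l" arbitrary: l)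
  case 0
  then have "x [^]\<^bsub>R\<^esub> N \<in> J"
    using self.MA.span_empty ideal.Icarr[OF J(1)] by (auto elim!: R.self.msumE)
  then show ?case by blast
next
  case (Suc k)
  interpret J: ideal J R by (rule J(1))
  have xR: "x \<in> carrier R" using x R.Icarr by simp
  let ?X = "(\<lambda>i. x [^]\<^bsub>R\<^esub> i) ` {Suc l..<N}"
  have X: "?X \<subseteq> carrier self.MA" "x [^]\<^bsub>R\<^esub> l \<in> carrier self.MA" using xR by auto
  have ins: "(\<lambda>i. x [^]\<^bsub>R\<^esub> i) ` {l..<N} = insert (x [^]\<^bsub>R\<^esub> l) ?X"
  proof -
    have "{l..<N} = insert l {Suc l..<N}"
      using Suc.hyps(2) by auto
    then show ?thesis by simp
  qed
  note s = self.MA.span_submodule[OF X(1)]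
  obtain a v j where a: "a \<in> carrier A" and v: "v \<in> module_span A self.MA ?X" and j: "j \<in> J"
    and e: "x [^]\<^bsub>R\<^esub> N = (h a \<otimes>\<^bsub>R\<^esub> x [^]\<^bsub>R\<^esub> l \<oplus>\<^bsub>R\<^esub> v) \<oplus>\<^bsub>R\<^esub> j"
    using Suc.prems(2) unfolding ins self.MA.span_insert[OF X(2,1)] by (auto elim!: R.self.msumE)
  have vR: "v \<in> carrier R" using self.MA.submodule_carrier[OF s v] by simp
  have hR: "h a \<in> carrier R" using a by simp
  have xl: "x [^]\<^bsub>R\<^esub> l \<in> carrier R" using xR by simp
  show ?case
  proof (cases "a \<in> \<mm>A")
    case True
    then have "h a \<otimes>\<^bsub>R\<^esub> x [^]\<^bsub>R\<^esub> l \<in> J"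
      using J(2) J.I_r_closed xR by auto
    moreover have "x [^]\<^bsub>R\<^esub> N = v \<oplus>\<^bsub>R\<^esub> (h a \<otimes>\<^bsub>R\<^esub> x [^]\<^bsub>R\<^esub> l \<oplus>\<^bsub>R\<^esub> j)"
      using e vR hR xl J.Icarr[OF j] by (simp add: R.a_ac)
    ultimately have "x [^]\<^bsub>R\<^esub> N \<in> R.self.msum (module_span A self.MA ?X) J"
      using v j J.a_closed by (intro R.self.msumI[of v _ "h a \<otimes>\<^bsub>R\<^esub> x [^]\<^bsub>R\<^esub> l \<oplus>\<^bsub>R\<^esub> j"]) auto
    then show ?thesis
      using Suc.hyps(1)[of "Suc l"] Suc.hyps(2) by auto
  next
    case False
    then have "a \<in> Units A" using A.unit_outside a by simp
    then obtain b where b: "b \<in> carrier A" "b \<otimes>\<^bsub>A\<^esub> a = \<one>\<^bsub>A\<^esub>" by (auto simp: Units_def)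
    then have hb: "h b \<in> carrier R" "h b \<otimes>\<^bsub>R\<^esub> h a = \<one>\<^bsub>R\<^esub>"
      using ring_hom_mult[OF h b(1) a] ring_hom_one[OF h] by simp_all
    let ?P = "PIdl\<^bsub>R\<^esub> (x [^]\<^bsub>R\<^esub> Suc l)"
    have P: "ideal ?P R" using R.cgenideal_ideal xR by simp
    have pw: "x [^]\<^bsub>R\<^esub> i \<in> ?P" if "i \<ge> Suc l" for i
    proof -
      have "x [^]\<^bsub>R\<^esub> i = x [^]\<^bsub>R\<^esub> (i - Suc l) \<otimes>\<^bsub>R\<^esub> x [^]\<^bsub>R\<^esub> Suc l"
        using that xR R.nat_pow_mult[of x "i - Suc l" "Suc l"] by simp
      then show ?thesis using xR unfolding cgenideal_def by blast
    qed
    have "submodule ?P A self.MA"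
      using P R.submodule_self_iff self.submodule_MA by blast
    then have "module_span A self.MA ?X \<subseteq> ?P"
      using pw by (intro self.MA.span_least) auto
    then have vP: "v \<in> ?P" using v by auto
    interpret P: ideal ?P R by (rule P)
    have "x [^]\<^bsub>R\<^esub> N \<in> ?P" using pw Suc.hyps(2) by auto
    then have "x [^]\<^bsub>R\<^esub> N \<ominus>\<^bsub>R\<^esub> v \<in> ?P"
      unfolding R.minus_eq by (rule P.a_closed[OF _ P.a_inv_closed[OF vP]])
    then obtain r where r: "r \<in> carrier R" "x [^]\<^bsub>R\<^esub> N \<ominus>\<^bsub>R\<^esub> v = r \<otimes>\<^bsub>R\<^esub> (x [^]\<^bsub>R\<^esub> l \<otimes>\<^bsub>R\<^esub> x)"
      unfolding cgenideal_def R.nat_pow_Suc by blast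
    have jR: "j \<in> carrier R" using J.Icarr[OF j] .
    have "(\<one>\<^bsub>R\<^esub> \<ominus>\<^bsub>R\<^esub> (h b \<otimes>\<^bsub>R\<^esub> r) \<otimes>\<^bsub>R\<^esub> x) \<otimes>\<^bsub>R\<^esub> x [^]\<^bsub>R\<^esub> l = \<ominus>\<^bsub>R\<^esub> (h b \<otimes>\<^bsub>R\<^esub> j)"
      by (rule R.unit_relation[OF hR hb xl vR jR r(1) xR r(2)[unfolded e]])
    moreover have "\<ominus>\<^bsub>R\<^esub> (h b \<otimes>\<^bsub>R\<^esub> j) \<in> J"
      using hb(1) j by (simp add: J.I_l_closed)
    moreover have "\<one>\<^bsub>R\<^esub> \<ominus>\<^bsub>R\<^esub> (h b \<otimes>\<^bsub>R\<^esub> r) \<otimes>\<^bsub>R\<^esub> x \<in> Units R" (is "?u \<in> _")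
      using R.one_minus_unit[OF x] hb(1) r(1) by simp
    ultimately have "inv\<^bsub>R\<^esub> ?u \<otimes>\<^bsub>R\<^esub> (?u \<otimes>\<^bsub>R\<^esub> x [^]\<^bsub>R\<^esub> l) \<in> J" "?u \<in> Units R"
      using J.I_l_closed by auto
    then have "x [^]\<^bsub>R\<^esub> l \<in> J"
      using xl R.m_assoc[of "inv\<^bsub>R\<^esub> ?u" ?u "x [^]\<^bsub>R\<^esub> l", symmetric] R.Units_closed[of ?u] by simp
    then show ?thesis by blast
  qed
qed

text \<open>As R/I is Noetherian over \<open>A\<close>, the A-spans of 1, x, ..., x^(k-1) modulo
  \<open>I\<close> become stationary, which yields a relation as in
  \<open>power_mem_of_span\<close>. For J = I + m_A R this is the fact that \<open>J\<close> is
  m_R-primary; the exponent found here later converts m_R-adic depth into J-adic depth.\<close>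

lemma ex_ideal_power_subset:
  assumes I: "ideal I R" and fin: "module_finite A (\<lambda>a. I +>\<^bsub>R\<^esub> h a) (R Quot I)"
    and J: "ideal J R" "I \<subseteq> J" "h ` \<mm>A \<subseteq> J"
  shows "\<exists>e. ideal_power R \<mm>R e \<subseteq> J"
proof (rule R.ideal_power_subset[OF J(1)])
  fix x assume x: "x \<in> \<mm>R"
  then have xR: "x \<in> carrier R" using R.Icarr by simp
  obtain X where X: "finite X" "X \<subseteq> carrier R" "carrier R \<subseteq> R.self.msum (module_span A self.MA X) I"
    using fin unfolding module_finite_iff[OF I] by blast
  have IA: "submodule I A self.MA"
    using I R.submodule_self_iff self.submodule_MA by blast
  have N: "self.MA.noeth_between I (carrier self.MA)"
    by (rule self.MA.noeth_between_span[OF IA X(1) _ self.MA.carrier_is_submodule])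
      (use X ideal.Icarr[OF I] in auto)
  define D where "D k = module_span A self.MA ((\<lambda>i. x [^]\<^bsub>R\<^esub> i) ` {0..<k})" for k :: nat
  have D: "submodule (D k) A self.MA" for k
    unfolding D_def by (rule self.MA.span_submodule) (use xR in auto)
  have DS: "D k \<subseteq> D (Suc k)" for k
    unfolding D_def[of k]
    by (rule self.MA.span_least[OF D]) (use self.MA.span_superset in \<open>fastforce simp: D_def\<close>)
  have DI: "submodule (R.self.msum (D k) I) A self.MA" for k
    using self.MA.msum_submodule[OF D IA] by simp
  obtain p where p: "\<And>k. k \<ge> p \<Longrightarrow> R.self.msum (D k) I = R.self.msum (D p) I"
  proof (rule self.MA.noeth_between_chain[OF N, of "\<lambda>k. R.self.msum (D k) I"])
    show "I \<subseteq> R.self.msum (D k) I" for k using self.MA.msum_upper(2)[OF D IA] by simp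
    show "R.self.msum (D k) I \<subseteq> carrier self.MA" for k
      using self.MA.submodule_carrier[OF DI] by auto
    show "R.self.msum (D k) I \<subseteq> R.self.msum (D (Suc k)) I" for k
      using DS by (auto simp: R.self.msum_def)
  qed (use DI in auto)
  \<comment> \<open>\<open>D k\<close> is spanned by the powers with exponent below
    \<open>k\<close>; stationarity at \<open>p\<close> therefore puts x^p into the span of lower
    powers modulo \<open>I\<close>.\<close>
  have "x [^]\<^bsub>R\<^esub> p \<in> D (Suc p)"
    unfolding D_def using self.MA.span_superset by fastforce
  then have "x [^]\<^bsub>R\<^esub> p \<in> R.self.msum (D p) I"
    using p[of "Suc p"] self.MA.msum_upper(1)[OF D IA, of "Suc p"] by auto
  then have "x [^]\<^bsub>R\<^esub> p \<in> R.self.msum (D p) J"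
    using J(2) by (auto simp: R.self.msum_def)
  then show "\<exists>n::nat. x [^]\<^bsub>R\<^esub> n \<in> J"
    using power_mem_of_span[OF J(1,3) x, of 0 p] by (simp add: D_def)
qed

end

section \<open>Finiteness of M/IM over the base ring\<close>

context local_extension_module
begin

text \<open>The products of A-generators of R/I with R-generators of \<open>M\<close> generate M/IM
  over \<open>A\<close>.\<close>

lemma finite_over_base:
  assumes I: "ideal I R" and fin: "module_finite A (\<lambda>a. I +>\<^bsub>R\<^esub> h a) (R Quot I)"
  shows "MA.noeth_between (ideal_smult R I M) (carrier M)"
proof -
  obtain X where X: "finite X" "X \<subseteq> carrier R" "carrier R \<subseteq> R.self.msum (module_span A self.MA X) I"
    using fin unfolding module_finite_iff[OF I] by blast
  obtain S where S: "finite S" "S \<subseteq> carrier M" "module_span R M S = carrier M"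
    using M_fin_gen by (auto simp: fin_gen_module_def)
  let ?Y = "(\<lambda>(x, s). x \<odot>\<^bsub>M\<^esub> s) ` (X \<times> S)"
  have IR: "I \<subseteq> carrier R" using ideal.Icarr[OF I] by auto
  note IM = M.ideal_smult_submodule[OF IR] and IA = submodule_MA[OF M.ideal_smult_submodule[OF IR]]
  have Y: "?Y \<subseteq> carrier MA" using X S by auto
  let ?V = "M.msum (module_span A MA ?Y) (ideal_smult R I M)"
  have V: "submodule ?V A MA"
    using MA.msum_submodule[OF MA.span_submodule[OF Y] IA] by simp
  note u = MA.msum_upper[OF MA.span_submodule[OF Y] IA]
  have rs: "r \<odot>\<^bsub>M\<^esub> s \<in> ?V" if r: "r \<in> carrier R" and s: "s \<in> S" for r s
  proof -
    let ?K = "{r \<in> carrier R. r \<odot>\<^bsub>M\<^esub> s \<in> ?V}"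
    have sM: "s \<in> carrier M" using s S by auto
    have K: "submodule ?K A self.MA"
    proof (rule self.MA.submoduleI')
      show "\<zero>\<^bsub>self.MA\<^esub> \<in> ?K" using sM MA.submodule_zero[OF V] by simp
      show "a \<oplus>\<^bsub>self.MA\<^esub> b \<in> ?K" if "a \<in> ?K" "b \<in> ?K" for a b
        using that sM MA.submodule_add[OF V, of "a \<odot>\<^bsub>M\<^esub> s" "b \<odot>\<^bsub>M\<^esub> s"] by (simp add: M.smult_l_distr)
      show "a \<odot>\<^bsub>self.MA\<^esub> b \<in> ?K" if "a \<in> carrier A" "b \<in> ?K" for a b
        using that sM MA.submodule_smult[OF V that(1), of "b \<odot>\<^bsub>M\<^esub> s"] by (simp add: M.smult_assoc1)
    qed auto
    have "x \<odot>\<^bsub>M\<^esub> s \<in> ?V" if "x \<in> X" for x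
      using that s u(1) MA.span_superset[of ?Y] by auto
    then have "module_span A self.MA X \<subseteq> ?K"
      using X(2) by (intro self.MA.span_least[OF K]) auto
    moreover have "I \<subseteq> ?K"
      using IR sM u(2) M.ideal_smultI[of _ I s] by auto
    ultimately have "R.self.msum (module_span A self.MA X) I \<subseteq> ?K"
      using self.MA.msum_least[OF K] by simp
    then show ?thesis using X(3) r by blast
  qed
  have "carrier M \<subseteq> ?V"
  proof
    fix z assume "z \<in> carrier M"
    then have "z \<in> module_span R M ((\<lambda>s. s) ` S)" using S(3) by simp
    then obtain a where a: "a \<in> S \<rightarrow> carrier R" "z = (\<Oplus>\<^bsub>M\<^esub>s\<in>S. a s \<odot>\<^bsub>M\<^esub> s)"
      using S M.span_finite_family[OF S(1), of "\<lambda>s. s"] by auto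
    have "finsum MA (\<lambda>s. a s \<odot>\<^bsub>M\<^esub> s) S \<in> ?V"
      by (rule MA.submodule_finsum[OF V S(1)]) (use a rs in auto)
    then show "z \<in> ?V" using a by simp
  qed
  then show ?thesis
    using MA.noeth_between_span[OF IA _ Y MA.carrier_is_submodule] X(1) S(1) M.submoduleE(1)[OF IM] by simp
qed

end

section \<open>Perturbed ideals under a change of generators\<close>

context complete_noetherian_local_ring
begin

text \<open>A coefficient outside \<mm> would be a unit and would express one generator through the
  others.\<close>

lemma minimal_generators_syzygy:
  assumes f: "minimal_ideal_generators R I c f" and y: "y \<in> {..<c} \<rightarrow> carrier R"
    and 0: "(\<Oplus>i\<in>{..<c}. y i \<otimes> f i) = \<zero>" and k: "k < c"
  shows "y k \<in> \<mm>"
proof (rule ccontr)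
  assume "y k \<notin> \<mm>"
  then have u: "y k \<in> Units R" using unit_outside y k by auto
  let ?K = "{..<c} - {k}"
  have fR: "f \<in> {..<c} \<rightarrow> carrier R" and gen: "Idl (f ` {..<c}) = I"
    using f by (auto simp: minimal_ideal_generators_def ideal_generators_def)
  have sub: "f ` ?K \<subseteq> carrier R" "f ` {..<c} \<subseteq> carrier R" using fR by auto
  interpret J: ideal "Idl (f ` ?K)" R by (rule genideal_ideal[OF sub(1)])
  have J: "submodule (Idl (f ` ?K)) R (self_module R)" using J.is_ideal submodule_self_iff by simp
  have "finsum (self_module R) (\<lambda>i. y i \<otimes> f i) ?K \<in> Idl (f ` ?K)"
    by (rule self.submodule_finsum[OF J])
      (use y genideal_self[OF sub(1)] in \<open>auto intro!: J.I_l_closed\<close>)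
  then have s: "(\<Oplus>i\<in>?K. y i \<otimes> f i) \<in> Idl (f ` ?K)" (is "?s \<in> _") by simp
  have ck: "{..<c} = insert k ?K" using k by auto
  have yk: "y k \<in> carrier R" "f k \<in> carrier R" using y fR k by auto
  have "(\<Oplus>i\<in>insert k ?K. y i \<otimes> f i) = y k \<otimes> f k \<oplus> ?s"
    using y fR k by (intro finsum_insert) auto
  then have "y k \<otimes> f k \<oplus> ?s = \<zero>" using 0 ck by simp
  then have "y k \<otimes> f k = \<ominus> ?s"
    using J.Icarr[OF s] yk by (simp add: minus_equality[symmetric] minus_equality)
  then have "y k \<otimes> f k \<in> Idl (f ` ?K)" using s J.a_inv_closed by simp
  then have "inv (y k) \<otimes> (y k \<otimes> f k) \<in> Idl (f ` ?K)" using u J.I_l_closed by simp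
  then have fk: "f k \<in> Idl (f ` ?K)"
    using u yk by (simp add: m_assoc[symmetric])
  have "f ` {..<c} \<subseteq> Idl (f ` ?K)"
    using fk genideal_self[OF sub(1)] by auto
  then have "I \<subseteq> Idl (f ` ?K)"
    using genideal_minimal[OF J.is_ideal] gen by auto
  moreover have "Idl (f ` ?K) \<subseteq> I"
    unfolding gen[symmetric] using sub genideal_self[OF sub(2)] by (intro genideal_minimal genideal_ideal) auto
  ultimately show False
    using f psubsetI[of ?K "{..<c}"] k unfolding minimal_ideal_generators_def by blast
qed

lemma genideal_lincomb:
  assumes "finite X" "f \<in> X \<rightarrow> carrier R" "x \<in> Idl (f ` X)"
  obtains y where "y \<in> X \<rightarrow> carrier R" "x = (\<Oplus>i\<in>X. y i \<otimes> f i)"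
proof -
  have fX: "f ` X \<subseteq> carrier R" using assms(2) by auto
  have i: "ideal (Idl (f ` X)) R" by (rule genideal_ideal[OF fX])
  have "x \<in> ideal_smult R (Idl (f ` X)) (self_module R)"
    using self.ideal_smultI[of x "Idl (f ` X)" \<one>] assms(3) ideal.Icarr[OF i assms(3)] by simp
  then obtain y where y: "y \<in> X \<rightarrow> carrier R" "x = (\<Oplus>i\<in>X. f i \<otimes> y i)"
    unfolding self.ideal_smult_genideal[OF assms(1,2)] by auto
  have "(\<Oplus>i\<in>X. f i \<otimes> y i) = (\<Oplus>i\<in>X. y i \<otimes> f i)"
    using y assms(2) by (intro finsum_cong') (auto simp: Pi_iff m_comm)
  with y show thesis using that by auto
qed

text \<open>If \<open>g = W f\<close> and \<open>f = V g\<close> with \<open>f\<close> minimal, then \<open>1 - V W\<close> has entries in \<open>\<mm>\<close>; hence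
  \<open>(f + \<epsilon>) = (g + W \<epsilon>)\<close> by Nakayama's lemma, and invertibility of \<open>W\<close> is not needed.\<close>

lemma perturbed_ideal_change_generators:
  assumes f: "minimal_ideal_generators R I c f" and g: "ideal_generators R I c' g"
    and \<epsilon>: "\<epsilon> \<in> {..<c} \<rightarrow> E" and E: "ideal E R"
  obtains \<epsilon>' where "\<epsilon>' \<in> {..<c'} \<rightarrow> E" "perturbed_ideal R c f \<epsilon> = perturbed_ideal R c' g \<epsilon>'"
proof -
  interpret E: ideal E R by (rule E)
  have fR: "f \<in> {..<c} \<rightarrow> carrier R" and fI: "Idl (f ` {..<c}) = I"
    using f by (auto simp: minimal_ideal_generators_def ideal_generators_def)
  have gR: "g \<in> {..<c'} \<rightarrow> carrier R" and gI: "Idl (g ` {..<c'}) = I"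
    using g by (auto simp: ideal_generators_def)
  have eR: "\<epsilon> \<in> {..<c} \<rightarrow> carrier R" using \<epsilon> by (auto intro!: E.Icarr)
  define L where "L u y = (\<Oplus>i\<in>{..<c}. y i \<otimes> u i)" for u y :: "nat \<Rightarrow> 'a"
  \<comment> \<open>\<open>G\<close> is the module of pairs generated by all (f_j, eps_j). It stands
    in for a linear map sending f_j to eps_j, which the syzygies of \<open>f\<close> may prevent
    from being well defined.\<close>
  define G where "G u v \<longleftrightarrow> (\<exists>y\<in>{..<c} \<rightarrow> carrier R. u = L f y \<and> v = L \<epsilon> y)" for u v
  have Lc: "(\<lambda>i. y i \<otimes> u i) \<in> {..<c} \<rightarrow> carrier R" if "u \<in> {..<c} \<rightarrow> carrier R" "y \<in> {..<c} \<rightarrow> carrier R" for u y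
    using that by auto
  have Lcl: "L u y \<in> carrier R" if "u \<in> {..<c} \<rightarrow> carrier R" "y \<in> {..<c} \<rightarrow> carrier R" for u y
    unfolding L_def by (rule finsum_closed[OF Lc[OF that]])
  have Ladd: "L u (\<lambda>i. y i \<oplus> z i) = L u y \<oplus> L u z"
    if "u \<in> {..<c} \<rightarrow> carrier R" "y \<in> {..<c} \<rightarrow> carrier R" "z \<in> {..<c} \<rightarrow> carrier R" for u y z
  proof -
    have "L u (\<lambda>i. y i \<oplus> z i) = (\<Oplus>i\<in>{..<c}. y i \<otimes> u i \<oplus> z i \<otimes> u i)"
      unfolding L_def using that by (intro finsum_cong') (auto simp: Pi_iff l_distr)
    then show ?thesis unfolding L_def using finsum_addf[OF Lc[OF that(1,2)] Lc[OF that(1,3)]] by simp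
  qed
  have Lsm: "L u (\<lambda>i. r \<otimes> y i) = r \<otimes> L u y"
    if "u \<in> {..<c} \<rightarrow> carrier R" "y \<in> {..<c} \<rightarrow> carrier R" "r \<in> carrier R" for u y r
  proof -
    have "L u (\<lambda>i. r \<otimes> y i) = (\<Oplus>i\<in>{..<c}. r \<otimes> (y i \<otimes> u i))"
      unfolding L_def using that by (intro finsum_cong') (auto simp: Pi_iff m_assoc)
    then show ?thesis unfolding L_def using finsum_rdistr[OF _ that(3) Lc[OF that(1,2)]] by simp
  qed
  have Gc: "u \<in> carrier R" "v \<in> carrier R" if "G u v" for u v
    using that Lcl[OF fR] Lcl[OF eR] by (auto simp: G_def)
  have Gadd: "G (u \<oplus> u') (v \<oplus> v')" if "G u v" "G u' v'" for u v u' v'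
  proof -
    from that obtain y z where "y \<in> {..<c} \<rightarrow> carrier R" "u = L f y" "v = L \<epsilon> y"
      "z \<in> {..<c} \<rightarrow> carrier R" "u' = L f z" "v' = L \<epsilon> z" by (auto simp: G_def)
    then show ?thesis
      unfolding G_def using Ladd[OF fR] Ladd[OF eR] by (intro bexI[of _ "\<lambda>i. y i \<oplus> z i"]) auto
  qed
  have Gsm: "G (r \<otimes> u) (r \<otimes> v)" if "G u v" "r \<in> carrier R" for u v r
  proof -
    from that obtain y where "y \<in> {..<c} \<rightarrow> carrier R" "u = L f y" "v = L \<epsilon> y" by (auto simp: G_def)
    then show ?thesis
      unfolding G_def using Lsm[OF fR] Lsm[OF eR] that(2) by (intro bexI[of _ "\<lambda>i. r \<otimes> y i"]) auto
  qed
  have G0: "G \<zero> \<zero>"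
  proof -
    have "L u (\<lambda>_. \<zero>) = \<zero>" if "u \<in> {..<c} \<rightarrow> carrier R" for u
      unfolding L_def using that by (intro add.finprod_one_eqI) (auto simp: Pi_iff)
    then show ?thesis unfolding G_def using fR eR by (intro bexI[of _ "\<lambda>_. \<zero>"]) auto
  qed
  have Gsum: "G (finsum R u X) (finsum R v X)" if "finite X" "\<And>i. i \<in> X \<Longrightarrow> G (u i) (v i)" for u v and X :: "nat set"
    using that
  proof (induction X rule: finite_induct)
    case (insert i X)
    then have "G (u i \<oplus> finsum R u X) (v i \<oplus> finsum R v X)" by (intro Gadd) auto
    moreover have "u \<in> X \<rightarrow> carrier R" "v \<in> X \<rightarrow> carrier R" "u i \<in> carrier R" "v i \<in> carrier R"
      using Gc(1)[OF insert.prems] Gc(2)[OF insert.prems] by auto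
    ultimately show ?case using insert.hyps by simp
  qed (simp add: G0)
  have Gf: "G (f j) (\<epsilon> j)" if j: "j < c" for j
  proof -
    have "L u (\<lambda>i. if i = j then \<one> else \<zero>) = u j" if u: "u \<in> {..<c} \<rightarrow> carrier R" for u
    proof -
      have "L u (\<lambda>i. if i = j then \<one> else \<zero>) = (\<Oplus>i\<in>{..<c}. if j = i then u i else \<zero>)"
        unfolding L_def using u by (intro finsum_cong') (auto simp: Pi_iff)
      also have "\<dots> = u j" using u j by (intro add.finprod_singleton) auto
      finally show ?thesis .
    qed
    then show ?thesis unfolding G_def using fR eR by (intro bexI[of _ "\<lambda>i. if i = j then \<one> else \<zero>"]) auto
  qed
  have GE: "v \<in> E" if "G u v" for u v
  proof -
    from that obtain y where y: "y \<in> {..<c} \<rightarrow> carrier R" "v = L \<epsilon> y" by (auto simp: G_def)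
    have "submodule E R (self_module R)" using E submodule_self_iff by simp
    from self.submodule_finsum[OF this, of "{..<c}" "\<lambda>i. y i \<otimes> \<epsilon> i"]
    show ?thesis using y \<epsilon> E.I_l_closed by (auto simp: L_def)
  qed
  have "\<exists>v. G (g i) v" if "i < c'" for i
  proof -
    have "g i \<in> Idl (f ` {..<c})"
      using that gR gI fI genideal_self[of "g ` {..<c'}"] by auto
    then obtain y where "y \<in> {..<c} \<rightarrow> carrier R" "g i = L f y"
      unfolding L_def by (rule genideal_lincomb[OF finite_lessThan fR])
    then show ?thesis by (auto simp: G_def)
  qed
  \<comment> \<open>If g = W f, this chooses eps' = W eps, so that g + eps' = W (f + eps). The
    entries of eps' lie in the same ideal \<open>E\<close> as those of eps.\<close>
  then obtain \<epsilon>' where \<epsilon>': "\<And>i. i < c' \<Longrightarrow> G (g i) (\<epsilon>' i)" by metis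
  have e'R: "\<epsilon>' i \<in> carrier R" if "i < c'" for i using Gc \<epsilon>' that by blast
  define b where "b = perturbed_ideal R c f \<epsilon>"
  define b' where "b' = perturbed_ideal R c' g \<epsilon>'"
  have bs: "(\<lambda>i. f i \<oplus> \<epsilon> i) ` {..<c} \<subseteq> carrier R" "(\<lambda>i. g i \<oplus> \<epsilon>' i) ` {..<c'} \<subseteq> carrier R"
    using fR eR gR e'R by auto
  have b: "ideal b R" and b': "ideal b' R"
    unfolding b_def b'_def perturbed_ideal_def using bs by (auto intro: genideal_ideal)
  interpret b: ideal b R by (rule b)
  interpret b': ideal b' R by (rule b')
  have bsub: "submodule b R (self_module R)" "submodule b' R (self_module R)"
    using b b' submodule_self_iff by auto
  have bgen: "f i \<oplus> \<epsilon> i \<in> b" if "i < c" for i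
    unfolding b_def perturbed_ideal_def using genideal_self[OF bs(1)] that by auto
  have b'gen: "g i \<oplus> \<epsilon>' i \<in> b'" if "i < c'" for i
    unfolding b'_def perturbed_ideal_def using genideal_self[OF bs(2)] that by auto
  have split: "L f y \<oplus> L \<epsilon> y = (\<Oplus>i\<in>{..<c}. y i \<otimes> (f i \<oplus> \<epsilon> i))" if y: "y \<in> {..<c} \<rightarrow> carrier R" for y
  proof -
    have "(\<Oplus>i\<in>{..<c}. y i \<otimes> (f i \<oplus> \<epsilon> i)) = (\<Oplus>i\<in>{..<c}. y i \<otimes> f i \<oplus> y i \<otimes> \<epsilon> i)"
      using y fR eR by (intro finsum_cong') (auto simp: Pi_iff r_distr)
    then show ?thesis unfolding L_def using finsum_addf[OF Lc[OF fR y] Lc[OF eR y]] by simp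
  qed
  have Gb: "u \<oplus> v \<in> b" if "G u v" for u v
  proof -
    from that obtain y where y: "y \<in> {..<c} \<rightarrow> carrier R" "u = L f y" "v = L \<epsilon> y" by (auto simp: G_def)
    have "finsum (self_module R) (\<lambda>i. y i \<otimes> (f i \<oplus> \<epsilon> i)) {..<c} \<in> b"
      by (rule self.submodule_finsum[OF bsub(1)]) (use y bgen b.I_l_closed in auto)
    then show ?thesis using y split by simp
  qed
  have b'b: "b' \<subseteq> b"
    unfolding b'_def perturbed_ideal_def
    by (rule genideal_minimal[OF b]) (use Gb \<epsilon>' in auto)
  have "b \<subseteq> b'"
  proof (rule self.nakayama[OF one_minus_unit])
    have "self.noeth_between {\<zero>\<^bsub>self_module R\<^esub>} (carrier (self_module R))"
      by (rule self.fin_gen_noeth[OF self_fin_gen])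
    then show "self.noeth_between b' b"
      by (rule self.noeth_between_mono) (use bsub b'b b'.zero_closed b.Icarr in auto)
    fix B assume B: "submodule B R (self_module R)" "b' \<subseteq> B"
      "\<And>r x. \<lbrakk>r \<in> \<mm>; x \<in> b\<rbrakk> \<Longrightarrow> r \<odot>\<^bsub>self_module R\<^esub> x \<in> B"
    then have Bi: "ideal B R" using submodule_self_iff by simp
    interpret B: ideal B R by (rule Bi)
    show "b \<subseteq> B"
      unfolding b_def perturbed_ideal_def
    proof (rule genideal_minimal[OF Bi], safe)
      fix j assume j: "j < c"
      have "f j \<in> Idl (g ` {..<c'})"
        using j fR gI fI genideal_self[of "f ` {..<c}"] by auto
      then obtain w where w: "w \<in> {..<c'} \<rightarrow> carrier R" "f j = (\<Oplus>i\<in>{..<c'}. w i \<otimes> g i)"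
        by (rule genideal_lincomb[OF finite_lessThan gR])
      let ?v = "\<Oplus>i\<in>{..<c'}. w i \<otimes> \<epsilon>' i"
      have Gv: "G (f j) ?v"
        unfolding w(2) by (intro Gsum Gsm \<epsilon>' finite_lessThan funcset_mem[OF w(1)]) auto
      have c: "f j \<in> carrier R" "?v \<in> carrier R" "\<epsilon> j \<in> carrier R"
        using Gc[OF Gv] eR j by auto
      \<comment> \<open>Both eps_j and \<open>?v\<close>, the j-th entry of V W eps, are paired with
        f_j. Their difference is therefore y eps for a syzygy \<open>y\<close> of \<open>f\<close>,
        whose entries lie in \<mm> by minimality. As y f = 0, this equals y (f + eps), an element of
        \<mm> b.\<close>
      have "G (f j \<oplus> \<ominus> \<one> \<otimes> f j) (\<epsilon> j \<oplus> \<ominus> \<one> \<otimes> ?v)"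
        using Gadd[OF Gf[OF j] Gsm[OF Gv, of "\<ominus> \<one>"]] by simp
      moreover have "f j \<oplus> \<ominus> \<one> \<otimes> f j = \<zero>" using c by (simp add: l_minus r_neg)
      ultimately obtain y where y: "y \<in> {..<c} \<rightarrow> carrier R" "L f y = \<zero>" "\<epsilon> j \<oplus> \<ominus> \<one> \<otimes> ?v = L \<epsilon> y"
        by (auto simp: G_def)
      have ym: "y i \<in> \<mm>" if "i < c" for i
        using minimal_generators_syzygy[OF f y(1) y(2)[unfolded L_def] that] .
      have "finsum (self_module R) (\<lambda>i. y i \<otimes> (f i \<oplus> \<epsilon> i)) {..<c} \<in> B"
        by (rule self.submodule_finsum[OF B(1)]) (use ym bgen B(3) in auto)
      moreover have "L \<epsilon> y = (\<Oplus>i\<in>{..<c}. y i \<otimes> (f i \<oplus> \<epsilon> i))"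
        using split[OF y(1)] y(2) Lcl[OF eR y(1)] by simp
      ultimately have 1: "L \<epsilon> y \<in> B" by simp
      have "finsum (self_module R) (\<lambda>i. w i \<otimes> (g i \<oplus> \<epsilon>' i)) {..<c'} \<in> B"
        by (rule self.submodule_finsum[OF B(1)]) (use w(1) b'gen B(2) in \<open>auto intro!: B.I_l_closed\<close>)
      moreover have "(\<Oplus>i\<in>{..<c'}. w i \<otimes> (g i \<oplus> \<epsilon>' i)) = f j \<oplus> ?v"
      proof -
        have "(\<Oplus>i\<in>{..<c'}. w i \<otimes> (g i \<oplus> \<epsilon>' i)) = (\<Oplus>i\<in>{..<c'}. w i \<otimes> g i \<oplus> w i \<otimes> \<epsilon>' i)"
          using w(1) gR e'R by (intro finsum_cong') (auto simp: Pi_iff r_distr)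
        also have "\<dots> = (\<Oplus>i\<in>{..<c'}. w i \<otimes> g i) \<oplus> ?v"
          using w(1) gR e'R by (intro finsum_addf) auto
        finally show ?thesis by (simp only: w(2))
      qed
      ultimately have 2: "f j \<oplus> ?v \<in> B" by simp
      have "f j \<oplus> \<epsilon> j = (f j \<oplus> ?v) \<oplus> (\<epsilon> j \<oplus> \<ominus> \<one> \<otimes> ?v)"
        by (rule add_sub_split[OF c])
      also have "\<dots> \<in> B" using 1 2 y(3) B.a_closed by simp
      finally show "f j \<oplus> \<epsilon> j \<in> B" .
    qed
  qed
  with b'b have "b = b'" by simp
  moreover have "\<epsilon>' \<in> {..<c'} \<rightarrow> E" using GE \<epsilon>' by blast
  ultimately show thesis using that by (simp add: b_def b'_def)
qed

end

section \<open>Alternating families\<close>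

text \<open>The direct power M^c. It is the ambient module in which the Artin-Rees lemma is applied
  to the Koszul boundaries of degree 1.\<close>

definition fun_module :: "nat \<Rightarrow> ('r, 'm, 'x) module_scheme \<Rightarrow> ('r, nat \<Rightarrow> 'm) module"
  where "fun_module c M =
    \<lparr>carrier = {..<c} \<rightarrow>\<^sub>E carrier M, monoid.mult = (\<lambda>_ _. undefined), one = undefined,
     zero = (\<lambda>i\<in>{..<c}. \<zero>\<^bsub>M\<^esub>), add = (\<lambda>x y. \<lambda>i\<in>{..<c}. x i \<oplus>\<^bsub>M\<^esub> y i),
     smult = (\<lambda>r x. \<lambda>i\<in>{..<c}. r \<odot>\<^bsub>M\<^esub> x i)\<rparr>"

lemma fun_module_simps [simp]:
  "carrier (fun_module c M) = {..<c} \<rightarrow>\<^sub>E carrier M"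
  "\<zero>\<^bsub>fun_module c M\<^esub> = (\<lambda>i\<in>{..<c}. \<zero>\<^bsub>M\<^esub>)"
  "x \<oplus>\<^bsub>fun_module c M\<^esub> y = (\<lambda>i\<in>{..<c}. x i \<oplus>\<^bsub>M\<^esub> y i)"
  "r \<odot>\<^bsub>fun_module c M\<^esub> x = (\<lambda>i\<in>{..<c}. r \<odot>\<^bsub>M\<^esub> x i)"
  by (simp_all add: fun_module_def)

section \<open>The filtration of M^c and Koszul boundaries of degree one\<close>

context module
begin

lemma fun_module_module: "module R (fun_module c M)"
proof (rule moduleI[OF R.is_cring])
  have mem: "x i \<in> carrier M" if "x \<in> {..<c} \<rightarrow>\<^sub>E carrier M" "i < c" for x i
    using that by auto
  note ext = PiE_ext[of _ "{..<c}" "\<lambda>_. carrier M"]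
  show "abelian_group (fun_module c M)"
  proof (rule abelian_groupI; unfold fun_module_simps)
    show "(\<lambda>i\<in>{..<c}. \<zero>\<^bsub>M\<^esub>) \<in> {..<c} \<rightarrow>\<^sub>E carrier M" by auto
    show "(\<lambda>i\<in>{..<c}. x i \<oplus>\<^bsub>M\<^esub> y i) \<in> {..<c} \<rightarrow>\<^sub>E carrier M"
      if "x \<in> {..<c} \<rightarrow>\<^sub>E carrier M" "y \<in> {..<c} \<rightarrow>\<^sub>E carrier M" for x y
      using mem[OF that(1)] mem[OF that(2)] by auto
    show "(\<lambda>i\<in>{..<c}. (\<lambda>i\<in>{..<c}. x i \<oplus>\<^bsub>M\<^esub> y i) i \<oplus>\<^bsub>M\<^esub> z i) =
        (\<lambda>i\<in>{..<c}. x i \<oplus>\<^bsub>M\<^esub> (\<lambda>i\<in>{..<c}. y i \<oplus>\<^bsub>M\<^esub> z i) i)"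
      if "x \<in> {..<c} \<rightarrow>\<^sub>E carrier M" "y \<in> {..<c} \<rightarrow>\<^sub>E carrier M" "z \<in> {..<c} \<rightarrow>\<^sub>E carrier M" for x y z
      using mem[OF that(1)] mem[OF that(2)] mem[OF that(3)] by (intro restrict_ext) (simp add: M.a_assoc)
    show "(\<lambda>i\<in>{..<c}. x i \<oplus>\<^bsub>M\<^esub> y i) = (\<lambda>i\<in>{..<c}. y i \<oplus>\<^bsub>M\<^esub> x i)"
      if "x \<in> {..<c} \<rightarrow>\<^sub>E carrier M" "y \<in> {..<c} \<rightarrow>\<^sub>E carrier M" for x y
      using mem[OF that(1)] mem[OF that(2)] by (intro restrict_ext) (simp add: M.a_comm)
    show "(\<lambda>i\<in>{..<c}. (\<lambda>i\<in>{..<c}. \<zero>\<^bsub>M\<^esub>) i \<oplus>\<^bsub>M\<^esub> x i) = x" if "x \<in> {..<c} \<rightarrow>\<^sub>E carrier M" for x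
      by (rule ext[OF _ that]) (use mem[OF that] in auto)
    show "\<exists>y\<in>{..<c} \<rightarrow>\<^sub>E carrier M. (\<lambda>i\<in>{..<c}. y i \<oplus>\<^bsub>M\<^esub> x i) = (\<lambda>i\<in>{..<c}. \<zero>\<^bsub>M\<^esub>)"
      if "x \<in> {..<c} \<rightarrow>\<^sub>E carrier M" for x
      using mem[OF that] by (intro bexI[of _ "\<lambda>i\<in>{..<c}. \<ominus>\<^bsub>M\<^esub> x i"] restrict_ext) (auto simp: M.l_neg)
  qed
  show "a \<odot>\<^bsub>fun_module c M\<^esub> x \<in> carrier (fun_module c M)" if "a \<in> carrier R" "x \<in> carrier (fun_module c M)" for a x
    using that mem[of x] by auto
  show "(a \<oplus> b) \<odot>\<^bsub>fun_module c M\<^esub> x = a \<odot>\<^bsub>fun_module c M\<^esub> x \<oplus>\<^bsub>fun_module c M\<^esub> b \<odot>\<^bsub>fun_module c M\<^esub> x"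
    if "a \<in> carrier R" "b \<in> carrier R" "x \<in> carrier (fun_module c M)" for a b x
    using that mem[of x] by (simp add: smult_l_distr fun_eq_iff restrict_def)
  show "a \<odot>\<^bsub>fun_module c M\<^esub> (x \<oplus>\<^bsub>fun_module c M\<^esub> y) = a \<odot>\<^bsub>fun_module c M\<^esub> x \<oplus>\<^bsub>fun_module c M\<^esub> a \<odot>\<^bsub>fun_module c M\<^esub> y"
    if "a \<in> carrier R" "x \<in> carrier (fun_module c M)" "y \<in> carrier (fun_module c M)" for a x y
    using that mem[of x] mem[of y] by (simp add: smult_r_distr fun_eq_iff restrict_def)
  show "(a \<otimes> b) \<odot>\<^bsub>fun_module c M\<^esub> x = a \<odot>\<^bsub>fun_module c M\<^esub> (b \<odot>\<^bsub>fun_module c M\<^esub> x)"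
    if "a \<in> carrier R" "b \<in> carrier R" "x \<in> carrier (fun_module c M)" for a b x
    using that mem[of x] by (simp add: smult_assoc1 fun_eq_iff restrict_def)
  show "\<one> \<odot>\<^bsub>fun_module c M\<^esub> x = x" if "x \<in> carrier (fun_module c M)" for x
    by (rule ext[of _ x]) (use that mem[of x] in auto)
qed

definition single :: "nat \<Rightarrow> nat \<Rightarrow> 'c \<Rightarrow> nat \<Rightarrow> 'c"
  where "single c j x = (\<lambda>i\<in>{..<c}. if i = j then x else \<zero>\<^bsub>M\<^esub>)"

lemma single_closed: "x \<in> carrier M \<Longrightarrow> single c j x \<in> {..<c} \<rightarrow>\<^sub>E carrier M"
  by (auto simp: single_def)

lemma single_add:
  "\<lbrakk>x \<in> carrier M; y \<in> carrier M\<rbrakk> \<Longrightarrow> single c j (x \<oplus>\<^bsub>M\<^esub> y) = single c j x \<oplus>\<^bsub>fun_module c M\<^esub> single c j y"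
  by (auto simp: single_def fun_eq_iff restrict_def)

lemma single_smult:
  "\<lbrakk>r \<in> carrier R; x \<in> carrier M\<rbrakk> \<Longrightarrow> single c j (r \<odot>\<^bsub>M\<^esub> x) = r \<odot>\<^bsub>fun_module c M\<^esub> single c j x"
  by (auto simp: single_def fun_eq_iff restrict_def)

lemma fun_module_mem_singles:
  assumes V: "submodule V R (fun_module c M)" and y: "y \<in> {..<c} \<rightarrow>\<^sub>E carrier M"
    and s: "\<And>j. j < c \<Longrightarrow> single c j (y j) \<in> V"
  shows "y \<in> V"
proof -
  interpret F: module R "fun_module c M" by (rule fun_module_module)
  have mem: "y i \<in> carrier M" if "i < c" for i using y that by auto
  have "(\<lambda>i\<in>{..<c}. if i < k then y i else \<zero>\<^bsub>M\<^esub>) \<in> V" if "k \<le> c" for k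
    using that
  proof (induction k)
    case 0
    then show ?case using F.submodule_zero[OF V] by (simp add: restrict_def)
  next
    case (Suc k)
    then have "(\<lambda>i\<in>{..<c}. if i < k then y i else \<zero>\<^bsub>M\<^esub>) \<oplus>\<^bsub>fun_module c M\<^esub> single c k (y k) \<in> V"
      using s[of k] Suc.prems by (intro F.submodule_add[OF V] Suc.IH) simp_all
    moreover have "(\<lambda>i\<in>{..<c}. if i < k then y i else \<zero>\<^bsub>M\<^esub>) \<oplus>\<^bsub>fun_module c M\<^esub> single c k (y k) =
        (\<lambda>i\<in>{..<c}. if i < Suc k then y i else \<zero>\<^bsub>M\<^esub>)"
      using mem by (auto simp: single_def fun_eq_iff restrict_def)
    ultimately show ?case by (simp only:)
  qed
  from this[of c] have "(\<lambda>i\<in>{..<c}. if i < c then y i else \<zero>\<^bsub>M\<^esub>) \<in> V" by simp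
  moreover have "(\<lambda>i\<in>{..<c}. if i < c then y i else \<zero>\<^bsub>M\<^esub>) = y"
    using y by (auto simp: fun_eq_iff restrict_def PiE_def extensional_def)
  ultimately show ?thesis by simp
qed

lemma fun_module_fin_gen:
  assumes "fin_gen_module R M"
  shows "fin_gen_module R (fun_module c M)"
proof -
  interpret F: module R "fun_module c M" by (rule fun_module_module)
  obtain S where S: "finite S" "S \<subseteq> carrier M" "module_span R M S = carrier M"
    using assms by (auto simp: fin_gen_module_def)
  let ?T = "(\<lambda>(j, s). single c j s) ` ({..<c} \<times> S)"
  have T: "?T \<subseteq> carrier (fun_module c M)"
  proof (rule image_subsetI)
    fix q assume "q \<in> {..<c} \<times> S"
    then obtain j s where "q = (j, s)" "s \<in> carrier M" using S(2) by auto
    then show "(case q of (j, s) \<Rightarrow> single c j s) \<in> carrier (fun_module c M)"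
      using single_closed[of s c j] by simp
  qed
  note V = F.span_submodule[OF T]
  have "single c j x \<in> module_span R (fun_module c M) ?T" if j: "j < c" and x: "x \<in> carrier M" for j x
  proof -
    let ?K = "{x \<in> carrier M. single c j x \<in> module_span R (fun_module c M) ?T}"
    have "submodule ?K R M"
    proof (rule submoduleI')
      have "single c j \<zero>\<^bsub>M\<^esub> = \<zero>\<^bsub>fun_module c M\<^esub>" by (auto simp: single_def)
      then show "\<zero>\<^bsub>M\<^esub> \<in> ?K" using F.submodule_zero[OF V] by simp
      show "a \<oplus>\<^bsub>M\<^esub> b \<in> ?K" if "a \<in> ?K" "b \<in> ?K" for a b
        using that F.submodule_add[OF V, of "single c j a" "single c j b"] single_add[of a b c j] by simp
      show "r \<odot>\<^bsub>M\<^esub> a \<in> ?K" if "r \<in> carrier R" "a \<in> ?K" for r a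
        using that F.submodule_smult[OF V, of r "single c j a"] single_smult[of r a c j] by simp
    qed auto
    moreover have "S \<subseteq> ?K"
      using S(2) j F.span_superset[of ?T] by auto
    ultimately have "module_span R M S \<subseteq> ?K" by (rule span_least)
    then show ?thesis using x S(3) by auto
  qed
  note sing = this
  have "carrier (fun_module c M) \<subseteq> module_span R (fun_module c M) ?T"
  proof
    fix y assume "y \<in> carrier (fun_module c M)"
    then have y: "y \<in> {..<c} \<rightarrow>\<^sub>E carrier M" by simp
    show "y \<in> module_span R (fun_module c M) ?T"
      by (rule fun_module_mem_singles[OF V y], rule sing) (use y in auto)
  qed
  then have "module_span R (fun_module c M) ?T = carrier (fun_module c M)"
    using F.submoduleE(1)[OF V] by blast
  then show ?thesis
    unfolding fin_gen_module_def using T S(1) fun_module_module by (intro conjI exI[of _ ?T]) auto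
qed

text \<open>Each coordinate embedding \<open>single c j\<close> is linear and so preserves depth; a
  family is the sum of its coordinates.\<close>

lemma filt_fun_moduleI:
  assumes J: "J \<subseteq> carrier R" and y: "y \<in> {..<c} \<rightarrow>\<^sub>E carrier M"
    and yk: "\<And>j. j < c \<Longrightarrow> y j \<in> filt (carrier M) {\<zero>\<^bsub>M\<^esub>} J k"
  shows "y \<in> module.filt (fun_module c M) (carrier (fun_module c M)) {\<zero>\<^bsub>fun_module c M\<^esub>} J k"
proof -
  interpret F: module R "fun_module c M" by (rule fun_module_module)
  let ?P = "F.filt (carrier (fun_module c M)) {\<zero>\<^bsub>fun_module c M\<^esub>} J"
  interpret FP: module_pair R "fun_module c M" "carrier (fun_module c M)" "{\<zero>\<^bsub>fun_module c M\<^esub>}"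
    using F.submodule_zero[OF F.carrier_is_submodule]
    by (intro F.module_pairI[OF F.carrier_is_submodule F.zero_submodule]) blast
  have s0: "single c j \<zero>\<^bsub>M\<^esub> = \<zero>\<^bsub>fun_module c M\<^esub>" for j by (auto simp: single_def)
  have "single c j x \<in> ?P k" if x: "x \<in> filt (carrier M) {\<zero>\<^bsub>M\<^esub>} J k" for j x
  proof -
    have "x \<in> {x \<in> carrier M. single c j x \<in> ?P k}"
      using x
    proof (rule filt_least)
      show "carrier M \<subseteq> {x \<in> carrier M. single c j x \<in> ?P 0}"
        using single_closed by (auto intro!: F.filt_0I)
      show "{\<zero>\<^bsub>M\<^esub>} \<subseteq> {x \<in> carrier M. single c j x \<in> ?P k}" for k
        using s0[of j] by (auto intro!: F.filt_base)
      show "r \<odot>\<^bsub>M\<^esub> x \<in> {x \<in> carrier M. single c j x \<in> ?P (Suc k)}"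
        if "r \<in> J" "x \<in> {x \<in> carrier M. single c j x \<in> ?P k}" for k r x
        using that J F.filt_smult[of r J "single c j x"] single_smult[of r x c j] by auto
      show "x \<oplus>\<^bsub>M\<^esub> y \<in> {x \<in> carrier M. single c j x \<in> ?P k}"
        if "x \<in> {x \<in> carrier M. single c j x \<in> ?P k}" "y \<in> {x \<in> carrier M. single c j x \<in> ?P k}" for k x y
        using that F.filt_add[of "single c j x" _ _ J k "single c j y"] single_add[of x y c j] by auto
    qed
    then show ?thesis by simp
  qed
  then show ?thesis
    using yk by (intro fun_module_mem_singles[OF FP.filt_submodule[OF J] y]) auto
qed

definition dot :: "nat \<Rightarrow> (nat \<Rightarrow> 'a) \<Rightarrow> (nat \<Rightarrow> 'c) \<Rightarrow> 'c"
  where "dot c g y = (\<Oplus>\<^bsub>M\<^esub>i\<in>{..<c}. g i \<odot>\<^bsub>M\<^esub> y i)"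

text \<open>Alternating families model the elements of degree 2 of the Koszul complex.\<close>

definition alternating :: "nat \<Rightarrow> 'c set \<Rightarrow> (nat \<Rightarrow> nat \<Rightarrow> 'c) \<Rightarrow> bool"
  where "alternating c P z \<longleftrightarrow> (\<forall>i<c. z i i = \<zero>\<^bsub>M\<^esub> \<and> (\<forall>j<c. z i j \<in> P \<and> z j i = \<ominus>\<^bsub>M\<^esub> z i j))"

lemma alternatingD:
  assumes "alternating c P z" "i < c"
  shows "z i i = \<zero>\<^bsub>M\<^esub>" "j < c \<Longrightarrow> z i j \<in> P" "j < c \<Longrightarrow> z j i = \<ominus>\<^bsub>M\<^esub> z i j"
  using assms unfolding alternating_def by blast+

lemma minus_zero_eq: "\<ominus>\<^bsub>M\<^esub> \<zero>\<^bsub>M\<^esub> = \<zero>\<^bsub>M\<^esub>"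
  using M.r_neg[OF M.zero_closed] by simp

lemma dot_cong: "\<lbrakk>\<And>i. i < (c::nat) \<Longrightarrow> y i = y' i; \<And>i. i < c \<Longrightarrow> g i \<in> carrier R \<and> y' i \<in> carrier M\<rbrakk> \<Longrightarrow> dot c g y = dot c g y'"
  unfolding dot_def by (intro M.finsum_cong') auto

context
  fixes c :: nat and g :: "nat \<Rightarrow> 'a"
  assumes g: "g \<in> {..<c} \<rightarrow> carrier R"
begin

lemma dot_terms: "y \<in> {..<c} \<rightarrow> carrier M \<Longrightarrow> (\<lambda>i. g i \<odot>\<^bsub>M\<^esub> y i) \<in> {..<c} \<rightarrow> carrier M"
  using g by auto

lemma dot_closed: "y \<in> {..<c} \<rightarrow> carrier M \<Longrightarrow> dot c g y \<in> carrier M"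
  unfolding dot_def by (rule M.finsum_closed[OF dot_terms])

lemma dot_add:
  assumes "y \<in> {..<c} \<rightarrow> carrier M" "z \<in> {..<c} \<rightarrow> carrier M"
  shows "dot c g (\<lambda>i. y i \<oplus>\<^bsub>M\<^esub> z i) = dot c g y \<oplus>\<^bsub>M\<^esub> dot c g z"
proof -
  have "dot c g (\<lambda>i. y i \<oplus>\<^bsub>M\<^esub> z i) = (\<Oplus>\<^bsub>M\<^esub>i\<in>{..<c}. g i \<odot>\<^bsub>M\<^esub> y i \<oplus>\<^bsub>M\<^esub> g i \<odot>\<^bsub>M\<^esub> z i)"
    unfolding dot_def using assms g by (intro M.finsum_cong') (auto simp: Pi_iff smult_r_distr)
  then show ?thesis
    unfolding dot_def using M.finsum_addf[OF dot_terms[OF assms(1)] dot_terms[OF assms(2)]] by simp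
qed

lemma dot_smult:
  assumes "y \<in> {..<c} \<rightarrow> carrier M" "r \<in> carrier R"
  shows "dot c g (\<lambda>i. r \<odot>\<^bsub>M\<^esub> y i) = r \<odot>\<^bsub>M\<^esub> dot c g y"
proof -
  have "dot c g (\<lambda>i. r \<odot>\<^bsub>M\<^esub> y i) = (\<Oplus>\<^bsub>M\<^esub>i\<in>{..<c}. r \<odot>\<^bsub>M\<^esub> (g i \<odot>\<^bsub>M\<^esub> y i))"
    unfolding dot_def
  proof (rule M.finsum_cong')
    show "(\<lambda>i. r \<odot>\<^bsub>M\<^esub> (g i \<odot>\<^bsub>M\<^esub> y i)) \<in> {..<c} \<rightarrow> carrier M" using assms g by auto
    fix i assume "i \<in> {..<c}"
    then have "g i \<in> carrier R" "y i \<in> carrier M" using assms g by auto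
    then show "g i \<odot>\<^bsub>M\<^esub> (r \<odot>\<^bsub>M\<^esub> y i) = r \<odot>\<^bsub>M\<^esub> (g i \<odot>\<^bsub>M\<^esub> y i)"
      using assms(2) smult_assoc1[of r "g i" "y i"] smult_assoc1[of "g i" r "y i"] R.m_comm[of r "g i"] by simp
  qed simp
  then show ?thesis
    unfolding dot_def using finsum_smult_ldistr[OF _ assms(2) dot_terms[OF assms(1)]] by simp
qed

lemma dot_minus:
  assumes "y \<in> {..<c} \<rightarrow> carrier M" "z \<in> {..<c} \<rightarrow> carrier M"
  shows "dot c g (\<lambda>i. y i \<ominus>\<^bsub>M\<^esub> z i) = dot c g y \<ominus>\<^bsub>M\<^esub> dot c g z"
proof -
  have m: "(\<lambda>i. \<ominus> \<one> \<odot>\<^bsub>M\<^esub> z i) \<in> {..<c} \<rightarrow> carrier M" using assms by auto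
  have n: "\<ominus> \<one> \<odot>\<^bsub>M\<^esub> x = \<ominus>\<^bsub>M\<^esub> x" if "x \<in> carrier M" for x using that smult_l_minus[of \<one> x] by simp
  have "dot c g (\<lambda>i. y i \<ominus>\<^bsub>M\<^esub> z i) = dot c g (\<lambda>i. y i \<oplus>\<^bsub>M\<^esub> \<ominus> \<one> \<odot>\<^bsub>M\<^esub> z i)"
    by (rule dot_cong) (use assms g n in \<open>auto simp: M.minus_eq Pi_iff\<close>)
  also have "\<dots> = dot c g y \<oplus>\<^bsub>M\<^esub> \<ominus> \<one> \<odot>\<^bsub>M\<^esub> dot c g z"
    using dot_add[OF assms(1) m] dot_smult[OF assms(2), of "\<ominus> \<one>"] by simp
  finally show ?thesis using n dot_closed[OF assms(2)] by (simp add: M.minus_eq)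
qed

lemma dot_mem:
  assumes "submodule B R M" "\<And>i. i < c \<Longrightarrow> g i \<odot>\<^bsub>M\<^esub> y i \<in> B"
  shows "dot c g y \<in> B"
  unfolding dot_def by (rule submodule_finsum[OF assms(1)]) (use assms(2) in auto)

lemma dot_coeff_add:
  assumes "e \<in> {..<c} \<rightarrow> carrier R" "y \<in> {..<c} \<rightarrow> carrier M"
  shows "dot c (\<lambda>i. g i \<oplus> e i) y = dot c g y \<oplus>\<^bsub>M\<^esub> dot c e y"
proof -
  have "dot c (\<lambda>i. g i \<oplus> e i) y = (\<Oplus>\<^bsub>M\<^esub>i\<in>{..<c}. g i \<odot>\<^bsub>M\<^esub> y i \<oplus>\<^bsub>M\<^esub> e i \<odot>\<^bsub>M\<^esub> y i)"
    unfolding dot_def using assms g by (intro M.finsum_cong') (auto simp: Pi_iff smult_l_distr)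
  also have "\<dots> = dot c g y \<oplus>\<^bsub>M\<^esub> dot c e y"
    unfolding dot_def using assms by (intro M.finsum_addf dot_terms) auto
  finally show ?thesis .
qed

text \<open>Two successive Koszul differentials compose to zero. In the induction, passing from an
  n-by-n square to the next one adds a row and a column, whose terms cancel in pairs because
  \<open>z\<close> is alternating, and one diagonal entry. That entry has to be zero by definition,
  since z_ii = - z_ii does not force it when 2 is a zero divisor.\<close>

lemma dot_alternating_zero:
  assumes z: "alternating c (carrier M) z"
  shows "dot c g (\<lambda>j. dot c g (\<lambda>i. z i j)) = \<zero>\<^bsub>M\<^esub>"
proof -
  have gz: "g i \<in> carrier R" "z i j \<in> carrier M" if "i < c" "j < c" for i j
    using that g alternatingD(2)[OF z] by auto
  define D where "D n j = (\<Oplus>\<^bsub>M\<^esub>i\<in>{..<n}. g i \<odot>\<^bsub>M\<^esub> z i j)" for n j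
  have Dc: "D n j \<in> carrier M" if "n \<le> c" "j < c" for n j
    unfolding D_def using that gz by (intro M.finsum_closed) auto
  have DS: "D (Suc n) j = g n \<odot>\<^bsub>M\<^esub> z n j \<oplus>\<^bsub>M\<^esub> D n j" if "Suc n \<le> c" "j < c" for n j
    unfolding D_def lessThan_Suc using that gz by (intro M.finsum_insert) auto
  have "(\<Oplus>\<^bsub>M\<^esub>j\<in>{..<n}. g j \<odot>\<^bsub>M\<^esub> D n j) = \<zero>\<^bsub>M\<^esub>" if "n \<le> c" for n
    using that
  proof (induction n)
    case (Suc n)
    then have n: "n < c" by simp
    have t: "(\<lambda>j. g j \<odot>\<^bsub>M\<^esub> D (Suc n) j) \<in> {..<n} \<rightarrow> carrier M" "g n \<odot>\<^bsub>M\<^esub> D (Suc n) n \<in> carrier M"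
      "(\<lambda>j. g j \<odot>\<^bsub>M\<^esub> (g n \<odot>\<^bsub>M\<^esub> z n j)) \<in> {..<n} \<rightarrow> carrier M" "(\<lambda>j. g j \<odot>\<^bsub>M\<^esub> D n j) \<in> {..<n} \<rightarrow> carrier M"
      using Suc.prems gz Dc n by auto
    have "(\<Oplus>\<^bsub>M\<^esub>j\<in>{..<Suc n}. g j \<odot>\<^bsub>M\<^esub> D (Suc n) j) =
        g n \<odot>\<^bsub>M\<^esub> D (Suc n) n \<oplus>\<^bsub>M\<^esub> (\<Oplus>\<^bsub>M\<^esub>j\<in>{..<n}. g j \<odot>\<^bsub>M\<^esub> D (Suc n) j)"
      unfolding lessThan_Suc using t by (intro M.finsum_insert) auto
    also have "(\<Oplus>\<^bsub>M\<^esub>j\<in>{..<n}. g j \<odot>\<^bsub>M\<^esub> D (Suc n) j) =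
        (\<Oplus>\<^bsub>M\<^esub>j\<in>{..<n}. g j \<odot>\<^bsub>M\<^esub> (g n \<odot>\<^bsub>M\<^esub> z n j) \<oplus>\<^bsub>M\<^esub> g j \<odot>\<^bsub>M\<^esub> D n j)"
    proof (rule M.finsum_cong')
      show "(\<lambda>j. g j \<odot>\<^bsub>M\<^esub> (g n \<odot>\<^bsub>M\<^esub> z n j) \<oplus>\<^bsub>M\<^esub> g j \<odot>\<^bsub>M\<^esub> D n j) \<in> {..<n} \<rightarrow> carrier M"
        using t(3,4) by auto
      fix j assume "j \<in> {..<n}"
      then show "g j \<odot>\<^bsub>M\<^esub> D (Suc n) j = g j \<odot>\<^bsub>M\<^esub> (g n \<odot>\<^bsub>M\<^esub> z n j) \<oplus>\<^bsub>M\<^esub> g j \<odot>\<^bsub>M\<^esub> D n j"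
        using n gz[of j n] gz[of n j] Dc[of n j] DS[of n j] by (simp add: smult_r_distr)
    qed simp
    also have "\<dots> = (\<Oplus>\<^bsub>M\<^esub>j\<in>{..<n}. g j \<odot>\<^bsub>M\<^esub> (g n \<odot>\<^bsub>M\<^esub> z n j)) \<oplus>\<^bsub>M\<^esub> (\<Oplus>\<^bsub>M\<^esub>j\<in>{..<n}. g j \<odot>\<^bsub>M\<^esub> D n j)"
      by (rule M.finsum_addf[OF t(3,4)])
    also have "(\<Oplus>\<^bsub>M\<^esub>j\<in>{..<n}. g j \<odot>\<^bsub>M\<^esub> D n j) = \<zero>\<^bsub>M\<^esub>" using Suc by simp
    also have "D (Suc n) n = D n n"
      using n gz[of n n] alternatingD(1)[OF z n] Dc[of n n] DS[of n n] by simp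
    also have "g n \<odot>\<^bsub>M\<^esub> D n n = (\<Oplus>\<^bsub>M\<^esub>j\<in>{..<n}. g n \<odot>\<^bsub>M\<^esub> (g j \<odot>\<^bsub>M\<^esub> z j n))"
      unfolding D_def using n gz by (intro finsum_smult_ldistr) auto
    also have "(\<Oplus>\<^bsub>M\<^esub>j\<in>{..<n}. g j \<odot>\<^bsub>M\<^esub> (g n \<odot>\<^bsub>M\<^esub> z n j)) = (\<Oplus>\<^bsub>M\<^esub>j\<in>{..<n}. \<ominus>\<^bsub>M\<^esub> (g n \<odot>\<^bsub>M\<^esub> (g j \<odot>\<^bsub>M\<^esub> z j n)))"
    proof (rule M.finsum_cong')
      show "(\<lambda>j. \<ominus>\<^bsub>M\<^esub> (g n \<odot>\<^bsub>M\<^esub> (g j \<odot>\<^bsub>M\<^esub> z j n))) \<in> {..<n} \<rightarrow> carrier M" using n gz by auto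
      fix j assume "j \<in> {..<n}"
      then have j: "j < c" using n by simp
      have e: "z n j = \<ominus>\<^bsub>M\<^esub> z j n" by (rule alternatingD(3)[OF z j n])
      show "g j \<odot>\<^bsub>M\<^esub> (g n \<odot>\<^bsub>M\<^esub> z n j) = \<ominus>\<^bsub>M\<^esub> (g n \<odot>\<^bsub>M\<^esub> (g j \<odot>\<^bsub>M\<^esub> z j n))"
        using gz[OF n j] gz[OF j n] smult_assoc1[of "g j" "g n" "z j n"] smult_assoc1[of "g n" "g j" "z j n"]
          R.m_comm[of "g j" "g n"] by (simp add: e smult_r_minus)
    qed simp
    also have "(\<Oplus>\<^bsub>M\<^esub>j\<in>{..<n}. g n \<odot>\<^bsub>M\<^esub> (g j \<odot>\<^bsub>M\<^esub> z j n)) \<oplus>\<^bsub>M\<^esub>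
        ((\<Oplus>\<^bsub>M\<^esub>j\<in>{..<n}. \<ominus>\<^bsub>M\<^esub> (g n \<odot>\<^bsub>M\<^esub> (g j \<odot>\<^bsub>M\<^esub> z j n))) \<oplus>\<^bsub>M\<^esub> \<zero>\<^bsub>M\<^esub>) =
        (\<Oplus>\<^bsub>M\<^esub>j\<in>{..<n}. g n \<odot>\<^bsub>M\<^esub> (g j \<odot>\<^bsub>M\<^esub> z j n) \<oplus>\<^bsub>M\<^esub> \<ominus>\<^bsub>M\<^esub> (g n \<odot>\<^bsub>M\<^esub> (g j \<odot>\<^bsub>M\<^esub> z j n)))"
      using n gz by (subst M.finsum_addf) auto
    also have "\<dots> = \<zero>\<^bsub>M\<^esub>"
      using n gz by (intro M.add.finprod_one_eqI) (auto simp: M.r_neg)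
    finally show ?case .
  qed simp
  from this[of c] show ?thesis by (simp add: dot_def D_def)
qed

end

end

context noeth_module
begin

text \<open>The boundaries of degree 1 form a submodule \<open>X 0\<close> of M^c, and J^k X 0
  consists of boundaries of alternating families with entries in J^k M. The Artin-Rees lemma in M^c
  thus provides a preimage of depth s - p for a boundary of depth \<open>s\<close>. For s < p the
  truncated difference is 0 and the given preimage will do.\<close>

lemma alternating_artin_rees:
  assumes fg: "fin_gen_module R M" and J: "ideal J R" and g: "g \<in> {..<c} \<rightarrow> carrier R"
  obtains p where "\<And>s y z. \<lbrakk>alternating c (carrier M) z; \<And>j. j < c \<Longrightarrow> y j = dot c g (\<lambda>i. z i j);
      \<And>j. j < c \<Longrightarrow> y j \<in> filt (carrier M) {\<zero>\<^bsub>M\<^esub>} J s\<rbrakk> \<Longrightarrow>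
    \<exists>z. alternating c (filt (carrier M) {\<zero>\<^bsub>M\<^esub>} J (s - p)) z \<and> (\<forall>j<c. y j = dot c g (\<lambda>i. z i j))"
proof -
  interpret F: noeth_module R "fun_module c M"
    by (rule noeth_module.intro[OF fun_module_module noetherian_ring_axioms])
  interpret module_pair R M "carrier M" "{\<zero>\<^bsub>M\<^esub>}"
    by (rule module_pairI[OF carrier_is_submodule zero_submodule]) simp
  have JR: "J \<subseteq> carrier R" using ideal.Icarr[OF J] by auto
  let ?P = "filt (carrier M) {\<zero>\<^bsub>M\<^esub>} J"
  define X where "X k = {\<lambda>j\<in>{..<c}. dot c g (\<lambda>i. z i j) | z. alternating c (?P k) z}" for k
  have P: "submodule (?P k) R M" for k by (rule filt_submodule[OF JR])
  have alt_car: "alternating c (carrier M) z" if "alternating c (?P k) z" for z k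
    using that submodule_carrier[OF P] unfolding alternating_def by blast
  have zc: "(\<lambda>i. z i j) \<in> {..<c} \<rightarrow> carrier M" if "alternating c (carrier M) z" "j < c" for z j
    using alternatingD(2)[OF that(1)] that(2) by auto
  have X0: "(\<lambda>j\<in>{..<c}. \<zero>\<^bsub>M\<^esub>) \<in> X k" for k
  proof -
    have "alternating c (?P k) (\<lambda>_ _. \<zero>\<^bsub>M\<^esub>)"
      using submodule_zero[OF P] by (simp add: alternating_def minus_zero_eq)
    moreover have "dot c g (\<lambda>_. \<zero>\<^bsub>M\<^esub>) = \<zero>\<^bsub>M\<^esub>"
      unfolding dot_def using g by (intro M.add.finprod_one_eqI) (auto simp: Pi_iff)
    ultimately show ?thesis by (auto simp: X_def intro!: exI[of _ "\<lambda>_ _. \<zero>\<^bsub>M\<^esub>"])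
  qed
  have Xadd: "x \<oplus>\<^bsub>fun_module c M\<^esub> y \<in> X k" if "x \<in> X k" "y \<in> X k" for x y k
  proof -
    from that obtain v w where v: "alternating c (?P k) v" "x = (\<lambda>j\<in>{..<c}. dot c g (\<lambda>i. v i j))"
      and w: "alternating c (?P k) w" "y = (\<lambda>j\<in>{..<c}. dot c g (\<lambda>i. w i j))" by (auto simp: X_def)
    have "alternating c (?P k) (\<lambda>i j. v i j \<oplus>\<^bsub>M\<^esub> w i j)"
      unfolding alternating_def
    proof (intro allI impI conjI)
      fix i j assume i: "i < c" and j: "j < c"
      show "v i j \<oplus>\<^bsub>M\<^esub> w i j \<in> ?P k"
        using alternatingD(2)[OF v(1) i j] alternatingD(2)[OF w(1) i j] by (rule filt_add)
      show "v j i \<oplus>\<^bsub>M\<^esub> w j i = \<ominus>\<^bsub>M\<^esub> (v i j \<oplus>\<^bsub>M\<^esub> w i j)"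
        using alternatingD(2,3)[OF alt_car[OF v(1)] i j] alternatingD(2,3)[OF alt_car[OF w(1)] i j] j by (simp add: M.minus_add)
    next
      fix i assume "i < c"
      then show "v i i \<oplus>\<^bsub>M\<^esub> w i i = \<zero>\<^bsub>M\<^esub>" using alternatingD(1)[OF v(1)] alternatingD(1)[OF w(1)] by simp
    qed
    moreover have "x \<oplus>\<^bsub>fun_module c M\<^esub> y = (\<lambda>j\<in>{..<c}. dot c g (\<lambda>i. v i j \<oplus>\<^bsub>M\<^esub> w i j))"
      unfolding v(2) w(2) using dot_add[OF g zc[OF alt_car[OF v(1)]] zc[OF alt_car[OF w(1)]]]
      by (auto simp: fun_eq_iff restrict_def)
    ultimately show ?thesis by (auto simp: X_def)
  qed
  have Xsm: "r \<odot>\<^bsub>fun_module c M\<^esub> x \<in> X l"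
    if r: "r \<in> carrier R" and x: "x \<in> X k" and rP: "\<And>v. v \<in> ?P k \<Longrightarrow> r \<odot>\<^bsub>M\<^esub> v \<in> ?P l" for r x k l
  proof -
    from x obtain v where v: "alternating c (?P k) v" "x = (\<lambda>j\<in>{..<c}. dot c g (\<lambda>i. v i j))" by (auto simp: X_def)
    have "alternating c (?P l) (\<lambda>i j. r \<odot>\<^bsub>M\<^esub> v i j)"
      unfolding alternating_def
    proof (intro allI impI conjI)
      fix i j assume i: "i < c" and j: "j < c"
      show "r \<odot>\<^bsub>M\<^esub> v i j \<in> ?P l" using rP alternatingD(2)[OF v(1) i j] .
      show "r \<odot>\<^bsub>M\<^esub> v j i = \<ominus>\<^bsub>M\<^esub> (r \<odot>\<^bsub>M\<^esub> v i j)"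
        using alternatingD(2,3)[OF alt_car[OF v(1)] i j] j r by (simp add: smult_r_minus)
    next
      fix i assume "i < c"
      then show "r \<odot>\<^bsub>M\<^esub> v i i = \<zero>\<^bsub>M\<^esub>" using alternatingD(1)[OF v(1)] r by simp
    qed
    moreover have "r \<odot>\<^bsub>fun_module c M\<^esub> x = (\<lambda>j\<in>{..<c}. dot c g (\<lambda>i. r \<odot>\<^bsub>M\<^esub> v i j))"
      unfolding v(2) using dot_smult[OF g zc[OF alt_car[OF v(1)]] r] by (auto simp: fun_eq_iff restrict_def)
    ultimately show ?thesis by (auto simp: X_def)
  qed
  have Xc: "X k \<subseteq> carrier (fun_module c M)" for k
  proof
    fix x assume "x \<in> X k"
    then obtain z where z: "alternating c (?P k) z" "x = (\<lambda>j\<in>{..<c}. dot c g (\<lambda>i. z i j))" by (auto simp: X_def)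
    show "x \<in> carrier (fun_module c M)"
      unfolding z(2) fun_module_simps restrict_PiE_iff
      using dot_closed[OF g zc[OF alt_car[OF z(1)]]] by simp
  qed
  have XS: "submodule (X k) R (fun_module c M)" for k
  proof (rule F.submoduleI')
    show "a \<odot>\<^bsub>fun_module c M\<^esub> x \<in> X k" if "a \<in> carrier R" "x \<in> X k" for a x
      by (rule Xsm[OF that]) (rule submodule_smult[OF P that(1)])
  qed (use Xc X0 Xadd in simp_all)
  have zero: "{\<zero>\<^bsub>fun_module c M\<^esub>} \<subseteq> X k" for k using X0 by simp
  have N: "F.noeth_between {\<zero>\<^bsub>fun_module c M\<^esub>} (carrier (fun_module c M))"
    by (rule F.fin_gen_noeth[OF fun_module_fin_gen[OF fg]])
  obtain p where p: "\<And>k. X 0 \<inter> F.filt (carrier (fun_module c M)) {\<zero>\<^bsub>fun_module c M\<^esub>} J (k + p) \<subseteq>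
      F.filt (X 0) {\<zero>\<^bsub>fun_module c M\<^esub>} J k"
    by (rule F.artin_rees[OF N J XS zero Xc]) blast
  have FX: "F.filt (X 0) {\<zero>\<^bsub>fun_module c M\<^esub>} J k \<subseteq> X k" for k
  proof
    fix x assume "x \<in> F.filt (X 0) {\<zero>\<^bsub>fun_module c M\<^esub>} J k"
    then show "x \<in> X k"
    proof (rule F.filt_least)
      show "s \<odot>\<^bsub>fun_module c M\<^esub> x \<in> X (Suc k)" if "s \<in> J" "x \<in> X k" for k s x
        using Xsm[OF _ that(2), of s "Suc k"] that(1) JR filt_smult[OF that(1)] by blast
    qed (use zero Xadd in simp_all)
  qed
  show thesis
  proof (rule that[of p])
    fix s y z
    assume z: "alternating c (carrier M) z" "\<And>j. j < c \<Longrightarrow> y j = dot c g (\<lambda>i. z i j)"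
      and y: "\<And>j. j < c \<Longrightarrow> y j \<in> ?P s"
    define y' where "y' = (\<lambda>j\<in>{..<c}. y j)"
    have y'0: "y' \<in> X 0"
      using z unfolding X_def y'_def filt_0 by (auto intro!: exI[of _ z] restrict_ext)
    have y'X: "y' \<in> X (s - p)"
    proof (cases "p \<le> s")
      case True
      have yc: "y' \<in> {..<c} \<rightarrow>\<^sub>E carrier M"
        unfolding y'_def restrict_PiE_iff by (intro ballI submodule_carrier[OF P y]) simp
      have "y' \<in> F.filt (carrier (fun_module c M)) {\<zero>\<^bsub>fun_module c M\<^esub>} J s"
        by (rule filt_fun_moduleI[OF JR yc]) (simp add: y'_def y)
      then show ?thesis
        using y'0 p[of "s - p"] FX[of "s - p"] True by auto
    qed (use y'0 in simp)
    then obtain w where w: "alternating c (?P (s - p)) w" "y' = (\<lambda>j\<in>{..<c}. dot c g (\<lambda>i. w i j))"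
      by (auto simp: X_def)
    have "y j = dot c g (\<lambda>i. w i j)" if "j < c" for j
      using fun_cong[OF w(2), of j] that by (simp add: y'_def)
    with w(1) show "\<exists>z. alternating c (?P (s - p)) z \<and> (\<forall>j<c. y j = dot c g (\<lambda>i. z i j))" by blast
  qed
qed

end

section \<open>Perturbation and free submodules\<close>

context local_extension_module
begin

text \<open>Depth in \<open>M\<close> is measured by J^k M (\<open>P k\<close>), depth in
  \<open>N\<close> by m_A^k N (\<open>Nf k\<close>). The two agree up to a shift on
  \<open>N\<close>, since \<open>N\<close> embeds into M/IM and \<open>J\<close> acts there through
  m_A. The premise \<open>H1\<close> is the vanishing of d H_1 in terms of alternating families, and
  \<open>indep\<close> is the freeness of the image of \<open>N\<close> modulo
  \<open>I\<close>.\<close>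

theorem perturbed_span_inter_zero:
  assumes I: "ideal I R" and fin: "module_finite A (\<lambda>a. I +>\<^bsub>R\<^esub> h a) (R Quot I)"
    and g: "ideal_generators R I c g"
    and d: "d \<in> carrier A" "nonzerodivisor_on (self_module A) d"
    and H1: "\<And>y. \<lbrakk>y \<in> {..<c} \<rightarrow> carrier M; M.dot c g y = \<zero>\<^bsub>M\<^esub>\<rbrakk> \<Longrightarrow>
      \<exists>z. M.alternating c (carrier M) z \<and> (\<forall>j<c. h d \<odot>\<^bsub>M\<^esub> y j = M.dot c g (\<lambda>i. z i j))"
    and m: "m \<in> {..<n::nat} \<rightarrow> carrier M" and N: "N = module_span A MA (m ` {..<n})"
    and indep: "\<And>a i. \<lbrakk>a \<in> {..<n} \<rightarrow> carrier A; (\<Oplus>\<^bsub>M\<^esub>i\<in>{..<n}. h (a i) \<odot>\<^bsub>M\<^esub> m i) \<in> ideal_smult R I M; i < n\<rbrakk> \<Longrightarrow>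
      a i = \<zero>\<^bsub>A\<^esub>"
  obtains T where "\<And>\<epsilon> v. \<lbrakk>\<epsilon> \<in> {..<c} \<rightarrow> ideal_power R \<mm>R T; v \<in> N;
    v \<in> ideal_smult R (perturbed_ideal R c g \<epsilon>) M\<rbrakk> \<Longrightarrow> v = \<zero>\<^bsub>M\<^esub>"
proof -
  define J where "J = set_add R I (Idl\<^bsub>R\<^esub> (h ` \<mm>A))"
  have Y: "ideal (Idl\<^bsub>R\<^esub> (h ` \<mm>A)) R" by (rule R.genideal_ideal[OF h\<mm>A_carrier])
  have J: "ideal J R" unfolding J_def by (rule R.add_ideals[OF I Y])
  have up: "I \<subseteq> J" "h ` \<mm>A \<subseteq> J"
    unfolding J_def using R.set_add_upper[OF I Y] R.genideal_self[OF h\<mm>A_carrier] by auto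
  have IR: "I \<subseteq> carrier R" and JR: "J \<subseteq> carrier R"
    using ideal.Icarr[OF I] ideal.Icarr[OF J] by auto
  have mA: "\<mm>A \<subseteq> carrier A" using A.Icarr by auto
  obtain e where e: "ideal_power R \<mm>R e \<subseteq> J"
    using ex_ideal_power_subset[OF I fin J up] by blast
  have gR: "g \<in> {..<c} \<rightarrow> carrier R" and gI: "Idl\<^bsub>R\<^esub> (g ` {..<c}) = I"
    using g by (auto simp: ideal_generators_def)
  let ?IM = "ideal_smult R I M"
  have IM: "submodule ?IM R M" by (rule M.ideal_smult_submodule[OF IR])
  note IMc = M.submodule_carrier[OF IM] and IMA = submodule_MA[OF IM]
  have IM_dot: "?IM = {M.dot c g y | y. y \<in> {..<c} \<rightarrow> carrier M}"
    using M.ideal_smult_genideal[OF finite_lessThan gR] unfolding gI M.dot_def .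
  define P where "P k = M.filt (carrier M) {\<zero>\<^bsub>M\<^esub>} J k" for k
  interpret MP: module_pair R M "carrier M" "{\<zero>\<^bsub>M\<^esub>}"
    by (rule M.module_pairI[OF M.carrier_is_submodule M.zero_submodule]) simp
  have Ps: "submodule (P k) R M" for k unfolding P_def by (rule MP.filt_submodule[OF JR])
  note Pc = M.submodule_carrier[OF Ps]
  have Panti: "x \<in> P k" if "x \<in> P l" "k \<le> l" for x k l
    using that MP.filt_antimono[OF JR that(2)] by (auto simp: P_def)
  have P0: "P 0 = carrier M" unfolding P_def by (rule MP.filt_0)
  have PJ: "r \<odot>\<^bsub>M\<^esub> x \<in> P (Suc k)" if "r \<in> J" "x \<in> P k" for r x k
    using that M.filt_smult unfolding P_def by blast
  have mMA: "m ` {..<n} \<subseteq> carrier MA" "m \<in> {..<n} \<rightarrow> carrier MA" using m by auto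
  have Ns: "submodule N A MA" unfolding N by (rule MA.span_submodule[OF mMA(1)])
  have Nc: "x \<in> carrier M" if "x \<in> N" for x using MA.submodule_carrier[OF Ns that] by simp
  have Nrep: "\<exists>a. a \<in> {..<n} \<rightarrow> carrier A \<and> v = (\<Oplus>\<^bsub>M\<^esub>i\<in>{..<n}. h (a i) \<odot>\<^bsub>M\<^esub> m i)" if "v \<in> N" for v
    using that unfolding N MA.span_finite_family[OF finite_lessThan mMA(2)] by auto
  have sum0: "(\<Oplus>\<^bsub>M\<^esub>i\<in>{..<n}. h (a i) \<odot>\<^bsub>M\<^esub> m i) = \<zero>\<^bsub>M\<^esub>" if "\<And>i. i < n \<Longrightarrow> a i = \<zero>\<^bsub>A\<^esub>" for a
  proof (rule M.M.add.finprod_one_eqI)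
    fix i assume "i \<in> {..<n}"
    moreover from this have "\<zero>\<^bsub>A\<^esub> \<odot>\<^bsub>MA\<^esub> m i = \<zero>\<^bsub>M\<^esub>"
      using MA.smult_l_null[of "m i"] m by auto
    ultimately show "h (a i) \<odot>\<^bsub>M\<^esub> m i = \<zero>\<^bsub>M\<^esub>" using that by simp
  qed
  \<comment> \<open>Freeness modulo \<open>I\<close> is used in two ways: \<open>N\<close> meets IM
    only in 0, and \<open>d\<close> stays a non-zero-divisor on \<open>N\<close>.\<close>
  have NI: "v = \<zero>\<^bsub>M\<^esub>" if v: "v \<in> N" "v \<in> ?IM" for v
  proof -
    from Nrep[OF v(1)] obtain a where a: "a \<in> {..<n} \<rightarrow> carrier A" "v = (\<Oplus>\<^bsub>M\<^esub>i\<in>{..<n}. h (a i) \<odot>\<^bsub>M\<^esub> m i)" by blast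
    show ?thesis
      unfolding a(2) by (rule sum0, rule indep[OF a(1)]) (use v(2) a(2) in auto)
  qed
  have Nd: "v = \<zero>\<^bsub>M\<^esub>" if v: "v \<in> N" "h d \<odot>\<^bsub>M\<^esub> v = \<zero>\<^bsub>M\<^esub>" for v
  proof -
    from Nrep[OF v(1)] obtain a where a: "a \<in> {..<n} \<rightarrow> carrier A" "v = (\<Oplus>\<^bsub>M\<^esub>i\<in>{..<n}. h (a i) \<odot>\<^bsub>M\<^esub> m i)" by blast
    have cl: "(\<lambda>i. h (a i) \<odot>\<^bsub>M\<^esub> m i) \<in> {..<n} \<rightarrow> carrier M" using a m by auto
    have da: "(\<lambda>i. d \<otimes>\<^bsub>A\<^esub> a i) \<in> {..<n} \<rightarrow> carrier A" using a d by auto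
    have "(\<Oplus>\<^bsub>M\<^esub>i\<in>{..<n}. h (d \<otimes>\<^bsub>A\<^esub> a i) \<odot>\<^bsub>M\<^esub> m i) = (\<Oplus>\<^bsub>M\<^esub>i\<in>{..<n}. h d \<odot>\<^bsub>M\<^esub> (h (a i) \<odot>\<^bsub>M\<^esub> m i))"
    proof (rule M.M.finsum_cong')
      show "(\<lambda>i. h d \<odot>\<^bsub>M\<^esub> (h (a i) \<odot>\<^bsub>M\<^esub> m i)) \<in> {..<n} \<rightarrow> carrier M" using cl d(1) by auto
      fix i assume "i \<in> {..<n}"
      then have "a i \<in> carrier A" "m i \<in> carrier M" using a m by auto
      then show "h (d \<otimes>\<^bsub>A\<^esub> a i) \<odot>\<^bsub>M\<^esub> m i = h d \<odot>\<^bsub>M\<^esub> (h (a i) \<odot>\<^bsub>M\<^esub> m i)"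
        using d(1) ring_hom_mult[OF h d(1), of "a i"] by (simp add: M.smult_assoc1)
    qed simp
    also have "\<dots> = h d \<odot>\<^bsub>M\<^esub> v"
      unfolding a(2) using M.finsum_smult_ldistr[OF _ _ cl, of "h d"] d(1) by simp
    finally have "(\<Oplus>\<^bsub>M\<^esub>i\<in>{..<n}. h (d \<otimes>\<^bsub>A\<^esub> a i) \<odot>\<^bsub>M\<^esub> m i) \<in> ?IM"
      using v(2) M.submodule_zero[OF IM] by simp
    then have "d \<otimes>\<^bsub>A\<^esub> a i = \<zero>\<^bsub>A\<^esub>" if "i < n" for i using indep[OF da _ that] by simp
    then have "a i = \<zero>\<^bsub>A\<^esub>" if "i < n" for i
      using that d(2) a(1) by (auto simp: nonzerodivisor_on_def)
    then show ?thesis unfolding a(2) by (rule sum0)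
  qed
  define Nf where "Nf k = MA.filt N {\<zero>\<^bsub>M\<^esub>} \<mm>A k" for k
  define Q where "Q k = MA.filt (carrier M) ?IM \<mm>A k" for k
  have z0: "\<zero>\<^bsub>M\<^esub> \<in> N" using MA.submodule_zero[OF Ns] by simp
  interpret MN: module_pair A MA N "{\<zero>\<^bsub>M\<^esub>}"
    using MA.module_pairI[OF Ns MA.zero_submodule] z0 by simp
  have Nfs: "submodule (Nf k) A MA" for k unfolding Nf_def by (rule MN.filt_submodule[OF mA])
  have NfN: "Nf k \<subseteq> N" for k unfolding Nf_def by (rule MN.filt_subset[OF mA])
  have Qs: "submodule (Q k) R M" for k
    unfolding Q_def using filt_MA_submodule[OF M.carrier_is_submodule IM] IMc by blast
  note Qc = M.submodule_carrier[OF Qs]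
  have IQ: "?IM \<subseteq> Q k" for k unfolding Q_def by (auto intro: MA.filt_base)
  \<comment> \<open>A factor from \<open>I\<close> leads into IM, so modulo IM the ideal J = I + m_A
    R acts through m_A alone.\<close>
  have PQ: "P k \<subseteq> Q k" for k
  proof
    fix x assume "x \<in> P k"
    then show "x \<in> Q k"
      unfolding P_def
    proof (rule M.filt_least)
      show "carrier M \<subseteq> Q 0" unfolding Q_def by (auto intro: MA.filt_0I)
      show "{\<zero>\<^bsub>M\<^esub>} \<subseteq> Q k" for k using M.submodule_zero[OF Qs] by simp
      show "x \<oplus>\<^bsub>M\<^esub> y \<in> Q k" if "x \<in> Q k" "y \<in> Q k" for x y k using M.submodule_add[OF Qs that] .
      fix k r x assume r: "r \<in> J" and x: "x \<in> Q k"
      from r obtain i y where iy: "i \<in> I" "y \<in> Idl\<^bsub>R\<^esub> (h ` \<mm>A)" "r = i \<oplus>\<^bsub>R\<^esub> y"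
        by (auto simp: J_def set_add_def')
      have xc: "x \<in> carrier M" using Qc[OF x] .
      have "i \<odot>\<^bsub>M\<^esub> x \<in> Q (Suc k)" using M.ideal_smultI[OF iy(1) xc] IQ by blast
      moreover have "y \<odot>\<^bsub>M\<^esub> x \<in> Q (Suc k)"
      proof (rule M.genideal_smult_mem[OF h\<mm>A_carrier Qs _ _ iy(2) x])
        show "Q k \<subseteq> carrier M" using Qc by blast
        show "s \<odot>\<^bsub>M\<^esub> x \<in> Q (Suc k)" if s: "s \<in> h ` \<mm>A" and x: "x \<in> Q k" for s x
        proof -
          from s obtain t where t: "t \<in> \<mm>A" "s = h t" by blast
          show ?thesis
            using MA.filt_smult[OF t(1) x[unfolded Q_def]] t(2) by (simp add: Q_def)
        qed
      qed
      ultimately show "r \<odot>\<^bsub>M\<^esub> x \<in> Q (Suc k)"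
        using M.submodule_add[OF Qs] iy IR ideal.Icarr[OF Y] xc by (simp add: M.smult_l_distr subset_iff)
    qed
  qed
  have NP: "Nf k \<subseteq> P k" for k
  proof
    fix x assume "x \<in> Nf k"
    then show "x \<in> P k"
      unfolding Nf_def
    proof (rule MA.filt_least)
      show "N \<subseteq> P 0" using Nc P0 by auto
      show "{\<zero>\<^bsub>M\<^esub>} \<subseteq> P k" for k using M.submodule_zero[OF Ps] by simp
      show "x \<oplus>\<^bsub>MA\<^esub> y \<in> P k" if "x \<in> P k" "y \<in> P k" for x y k using M.submodule_add[OF Ps that] by simp
      show "t \<odot>\<^bsub>MA\<^esub> x \<in> P (Suc k)" if "t \<in> \<mm>A" "x \<in> P k" for t x k
        using PJ[OF _ that(2), of "h t"] up(2) that(1) by auto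
    qed
  qed
  \<comment> \<open>The Artin-Rees lemma over \<open>A\<close> in M/IM, which is Noetherian over
    \<open>A\<close>, for the image of \<open>N\<close>. Since \<open>N\<close> meets IM only in 0,
    its conclusion modulo IM becomes one inside \<open>N\<close>.\<close>
  obtain q2 where q2: "\<And>v k. \<lbrakk>v \<in> N; v \<in> Q (k + q2)\<rbrakk> \<Longrightarrow> v \<in> Nf k"
  proof -
    let ?B = "M.msum N ?IM"
    have B: "submodule ?B A MA" using MA.msum_submodule[OF Ns IMA] by simp
    note u = MA.msum_upper[OF Ns IMA]
    obtain q where q: "\<And>k. ?B \<inter> MA.filt (carrier M) ?IM \<mm>A (k + q) \<subseteq> MA.filt ?B ?IM \<mm>A k"
      by (rule MA.artin_rees[OF finite_over_base[OF I fin] A.is_ideal B])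
        (use u MA.submodule_carrier[OF B] in auto)
    have fB: "MA.filt ?B ?IM \<mm>A k \<subseteq> M.msum (Nf k) ?IM" for k
    proof
      have s: "submodule (M.msum (Nf k) ?IM) A MA" for k using MA.msum_submodule[OF Nfs IMA] by simp
      fix x assume "x \<in> MA.filt ?B ?IM \<mm>A k"
      then show "x \<in> M.msum (Nf k) ?IM"
      proof (rule MA.filt_least)
        show "?B \<subseteq> M.msum (Nf 0) ?IM" using MN.filt_0 by (simp add: Nf_def)
        show "?IM \<subseteq> M.msum (Nf k) ?IM" for k using MA.msum_upper(2)[OF Nfs IMA] by simp
        show "x \<oplus>\<^bsub>MA\<^esub> y \<in> M.msum (Nf k) ?IM" if "x \<in> M.msum (Nf k) ?IM" "y \<in> M.msum (Nf k) ?IM" for x y k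
          using MA.submodule_add[OF s that] .
        fix k t x assume t: "t \<in> \<mm>A" and "x \<in> M.msum (Nf k) ?IM"
        then obtain v w where vw: "v \<in> Nf k" "w \<in> ?IM" "x = v \<oplus>\<^bsub>M\<^esub> w" by (auto elim: M.msumE)
        have hv: "h t \<odot>\<^bsub>M\<^esub> v \<in> Nf (Suc k)"
          using MA.filt_smult[OF t vw(1)[unfolded Nf_def]] by (simp add: Nf_def)
        have hw: "h t \<odot>\<^bsub>M\<^esub> w \<in> ?IM" using M.submodule_smult[OF IM _ vw(2)] h_\<mm>A[OF t] by simp
        have "h t \<odot>\<^bsub>M\<^esub> x = h t \<odot>\<^bsub>M\<^esub> v \<oplus>\<^bsub>M\<^esub> h t \<odot>\<^bsub>M\<^esub> w"
          using vw Nc NfN IMc h_\<mm>A[OF t] by (simp add: M.smult_r_distr subset_iff)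
        then show "t \<odot>\<^bsub>MA\<^esub> x \<in> M.msum (Nf (Suc k)) ?IM"
          using M.msumI[OF hv hw] by simp
      qed
    qed
    show thesis
    proof (rule that[of q])
      fix v k assume v: "v \<in> N" "v \<in> Q (k + q)"
      then have "v \<in> M.msum (Nf k) ?IM"
        using q[of k] fB[of k] u(1) by (auto simp: Q_def)
      then obtain v' w where w: "v' \<in> Nf k" "w \<in> ?IM" "v = v' \<oplus>\<^bsub>M\<^esub> w" by (auto elim: M.msumE)
      have v': "v' \<in> N" using w(1) NfN by blast
      have "w \<in> N"
        using MA.submodule_mem_cancel[OF Ns _ v', of w] v(1) w M.M.a_comm[of v' w] IMc Nc[OF v'] by simp
      then have "w = \<zero>\<^bsub>M\<^esub>" using NI w(2) by simp
      then show "v \<in> Nf k" using w Nc[OF v'] by simp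
    qed
  qed
  have noethN: "MA.noeth_between {\<zero>\<^bsub>M\<^esub>} N"
  proof -
    have "N \<subseteq> MA.msum (module_span A MA (m ` {..<n})) {\<zero>\<^bsub>MA\<^esub>}"
      using MA.msum_upper(1)[OF Ns MA.zero_submodule] unfolding N .
    then show ?thesis
      using MA.noeth_between_span[OF MA.zero_submodule _ mMA(1) Ns] z0 by simp
  qed
  \<comment> \<open>The Artin-Rees lemma in \<open>N\<close> for the submodule dN: division by
    \<open>d\<close> loses at most \<open>q3\<close>.\<close>
  obtain q3 where q3: "\<And>v k. \<lbrakk>v \<in> N; h d \<odot>\<^bsub>M\<^esub> v \<in> Nf (k + q3)\<rbrakk> \<Longrightarrow> v \<in> Nf k"
  proof -
    let ?B = "(\<lambda>x. h d \<odot>\<^bsub>M\<^esub> x) ` N"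
    have img: "submodule ((\<lambda>x. h d \<odot>\<^bsub>M\<^esub> x) ` V) A MA" if "submodule V A MA" for V
      using MA.image_submodule[OF d(1) that] by simp
    have zB: "{\<zero>\<^bsub>M\<^esub>} \<subseteq> (\<lambda>x. h d \<odot>\<^bsub>M\<^esub> x) ` V" if "submodule V A MA" for V
      using MA.submodule_zero[OF img[OF that]] by simp
    have BN: "?B \<subseteq> N" using MA.image_submodule_mono[OF Ns d(1)] by simp
    obtain q where q: "\<And>k. ?B \<inter> MA.filt N {\<zero>\<^bsub>M\<^esub>} \<mm>A (k + q) \<subseteq> MA.filt ?B {\<zero>\<^bsub>M\<^esub>} \<mm>A k"
      by (rule MA.artin_rees[OF noethN A.is_ideal img[OF Ns] zB[OF Ns] BN]) blast
    have fB: "MA.filt ?B {\<zero>\<^bsub>M\<^esub>} \<mm>A k \<subseteq> (\<lambda>x. h d \<odot>\<^bsub>M\<^esub> x) ` Nf k" for k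
    proof
      fix x assume "x \<in> MA.filt ?B {\<zero>\<^bsub>M\<^esub>} \<mm>A k"
      then show "x \<in> (\<lambda>x. h d \<odot>\<^bsub>M\<^esub> x) ` Nf k"
      proof (rule MA.filt_least)
        show "?B \<subseteq> (\<lambda>x. h d \<odot>\<^bsub>M\<^esub> x) ` Nf 0" using MN.filt_0 by (simp add: Nf_def)
        show "{\<zero>\<^bsub>M\<^esub>} \<subseteq> (\<lambda>x. h d \<odot>\<^bsub>M\<^esub> x) ` Nf k" for k by (rule zB[OF Nfs])
        show "x \<oplus>\<^bsub>MA\<^esub> y \<in> (\<lambda>x. h d \<odot>\<^bsub>M\<^esub> x) ` Nf k"
          if "x \<in> (\<lambda>x. h d \<odot>\<^bsub>M\<^esub> x) ` Nf k" "y \<in> (\<lambda>x. h d \<odot>\<^bsub>M\<^esub> x) ` Nf k" for x y k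
          using MA.submodule_add[OF img[OF Nfs] that] .
        fix k t x assume t: "t \<in> \<mm>A" and "x \<in> (\<lambda>x. h d \<odot>\<^bsub>M\<^esub> x) ` Nf k"
        then obtain v where v: "v \<in> Nf k" "x = h d \<odot>\<^bsub>M\<^esub> v" by blast
        have "h t \<odot>\<^bsub>M\<^esub> v \<in> Nf (Suc k)"
          using MA.filt_smult[OF t v(1)[unfolded Nf_def]] by (simp add: Nf_def)
        moreover have "h t \<odot>\<^bsub>M\<^esub> x = h d \<odot>\<^bsub>M\<^esub> (h t \<odot>\<^bsub>M\<^esub> v)"
        proof -
          have "h t \<in> carrier R" "h d \<in> carrier R" "v \<in> carrier M" using h_\<mm>A[OF t] d(1) Nc NfN v(1) by auto
          then show ?thesis
            unfolding v(2) using M.smult_assoc1[of "h t" "h d" v] M.smult_assoc1[of "h d" "h t" v] R.m_comm[of "h d" "h t"] by simp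
        qed
        ultimately show "t \<odot>\<^bsub>MA\<^esub> x \<in> (\<lambda>x. h d \<odot>\<^bsub>M\<^esub> x) ` Nf (Suc k)" by simp
      qed
    qed
    show thesis
    proof (rule that[of q])
      fix v k assume v: "v \<in> N" "h d \<odot>\<^bsub>M\<^esub> v \<in> Nf (k + q)"
      then have "h d \<odot>\<^bsub>M\<^esub> v \<in> (\<lambda>x. h d \<odot>\<^bsub>M\<^esub> x) ` Nf k"
        using q[of k] fB[of k] by (auto simp: Nf_def)
      then obtain v' where v': "v' \<in> Nf k" "h d \<odot>\<^bsub>M\<^esub> v = h d \<odot>\<^bsub>M\<^esub> v'" by blast
      have v'N: "v' \<in> N" using v'(1) NfN by blast
      note c = Nc[OF v(1)] Nc[OF v'N]
      have "v \<ominus>\<^bsub>M\<^esub> v' \<in> N" using MA.submodule_minus[OF Ns v(1) v'N] by simp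
      moreover have "h d \<odot>\<^bsub>M\<^esub> (v \<ominus>\<^bsub>M\<^esub> v') = \<zero>\<^bsub>M\<^esub>"
        using c d(1) v'(2) by (simp add: M.smult_minus_distr) (simp add: M.M.minus_eq M.M.r_neg)
      ultimately have "v \<ominus>\<^bsub>M\<^esub> v' = \<zero>\<^bsub>M\<^esub>" by (rule Nd)
      then have "v = v'" using M.minus_cancel(2)[OF c] c by simp
      with v'(1) show "v \<in> Nf k" by simp
    qed
  qed
  \<comment> \<open>The Artin-Rees lemma for IM in \<open>M\<close>: an element of IM of depth k +
    q1 is a combination of the \<open>g i\<close> with coefficients of depth
    \<open>k\<close>.\<close>
  obtain q1 where q1: "\<And>v k. \<lbrakk>v \<in> ?IM; v \<in> P (k + q1)\<rbrakk> \<Longrightarrow> \<exists>y\<in>{..<c} \<rightarrow> P k. v = M.dot c g y"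
  proof -
    have zI: "{\<zero>\<^bsub>M\<^esub>} \<subseteq> ?IM" using M.submodule_zero[OF IM] by simp
    have Ic: "?IM \<subseteq> carrier M" using IMc by blast
    obtain q where q: "\<And>k. ?IM \<inter> M.filt (carrier M) {\<zero>\<^bsub>M\<^esub>} J (k + q) \<subseteq> M.filt ?IM {\<zero>\<^bsub>M\<^esub>} J k"
      by (rule M.artin_rees[OF M_noeth J IM zI Ic]) blast
    define E where "E k = {M.dot c g y | y. y \<in> {..<c} \<rightarrow> P k}" for k
    have Es: "submodule (E k) R M" for k
      unfolding E_def M.dot_def by (rule M.lincomb_submodule[OF finite_lessThan gR Ps])
    have "M.filt ?IM {\<zero>\<^bsub>M\<^esub>} J k \<subseteq> E k" for k
    proof
      fix x assume "x \<in> M.filt ?IM {\<zero>\<^bsub>M\<^esub>} J k"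
      then show "x \<in> E k"
      proof (rule M.filt_least)
        show "?IM \<subseteq> E 0" unfolding IM_dot E_def P0 by (rule order_refl)
        show "{\<zero>\<^bsub>M\<^esub>} \<subseteq> E k" for k using M.submodule_zero[OF Es] by simp
        show "x \<oplus>\<^bsub>M\<^esub> y \<in> E k" if "x \<in> E k" "y \<in> E k" for x y k using M.submodule_add[OF Es that] .
        fix k r x assume r: "r \<in> J" and "x \<in> E k"
        then obtain y where y: "y \<in> {..<c} \<rightarrow> P k" "x = M.dot c g y" by (auto simp: E_def)
        have "y \<in> {..<c} \<rightarrow> carrier M" using y(1) Pc by blast
        then have "r \<odot>\<^bsub>M\<^esub> x = M.dot c g (\<lambda>i. r \<odot>\<^bsub>M\<^esub> y i)"
          using M.dot_smult[OF gR] r JR y(2) by auto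
        moreover have "(\<lambda>i. r \<odot>\<^bsub>M\<^esub> y i) \<in> {..<c} \<rightarrow> P (Suc k)" using y(1) PJ[OF r] by auto
        ultimately show "r \<odot>\<^bsub>M\<^esub> x \<in> E (Suc k)" unfolding E_def by blast
      qed
    qed
    then show thesis
      using that[of q] q unfolding E_def P_def by blast
  qed
  obtain p where p: "\<And>s y z. \<lbrakk>M.alternating c (carrier M) z; \<And>j. j < c \<Longrightarrow> y j = M.dot c g (\<lambda>i. z i j);
      \<And>j. j < c \<Longrightarrow> y j \<in> P s\<rbrakk> \<Longrightarrow>
    \<exists>z. M.alternating c (P (s - p)) z \<and> (\<forall>j<c. y j = M.dot c g (\<lambda>i. z i j))"
    unfolding P_def by (rule M.alternating_artin_rees[OF M_fin_gen J gR]) blast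
  \<comment> \<open>The summands pay for the losses of one round: \<open>q2\<close> for passing from
    M/IM to \<open>N\<close>, \<open>q1\<close> for rewriting the combination of the
    \<open>g i\<close> with deeper coefficients, \<open>p\<close> for the depth of the alternating
    family. What remains is the gain \<open>Suc q3\<close>, one more than a division by
    \<open>d\<close> costs. The factor \<open>e\<close> below turns m_R-depth into J-depth, as m_R^e
    lies in \<open>J\<close>.\<close>
  define T' where "T' = q1 + q2 + p + Suc q3"
  show thesis
  proof (rule that[of "e * T'"])
    fix \<epsilon> v
    assume eps: "\<epsilon> \<in> {..<c} \<rightarrow> ideal_power R \<mm>R (e * T')" and vN: "v \<in> N"
      and vb: "v \<in> ideal_smult R (perturbed_ideal R c g \<epsilon>) M"
    have epsJ: "\<epsilon> i \<in> ideal_power R J T'" if "i < c" for i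
      using eps that R.ideal_power_mult_subset[OF R.is_ideal e, of T'] by auto
    have epsR: "\<epsilon> \<in> {..<c} \<rightarrow> carrier R"
      using epsJ ideal.Icarr[OF R.ideal_power_ideal[OF J]] by auto
    have epsP: "\<epsilon> i \<odot>\<^bsub>M\<^esub> x \<in> P (k + T')" if "i < c" "x \<in> P k" for i x k
    proof -
      have "module_pair R M (P k) {\<zero>\<^bsub>M\<^esub>}"
        using M.module_pairI[OF Ps M.zero_submodule] M.submodule_zero[OF Ps] by simp
      from M.ideal_power_smult_filt[OF J this epsJ[OF that(1)] that(2)]
      show ?thesis unfolding P_def using M.filt_trans by blast
    qed
    define F where "F i = g i \<oplus>\<^bsub>R\<^esub> \<epsilon> i" for i
    have FR: "F \<in> {..<c} \<rightarrow> carrier R" unfolding F_def by (intro Pi_I R.add.m_closed funcset_mem[OF gR] funcset_mem[OF epsR])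
    have dotF: "M.dot c F y = M.dot c g y \<oplus>\<^bsub>M\<^esub> M.dot c \<epsilon> y" if "y \<in> {..<c} \<rightarrow> carrier M" for y
      unfolding F_def[abs_def] by (rule M.dot_coeff_add[OF gR epsR that])
    have epsdot: "M.dot c \<epsilon> y \<in> P (k + T')" if "y \<in> {..<c} \<rightarrow> P k" for y k
      by (rule M.dot_mem[OF epsR Ps]) (use epsP that in auto)
    have PM: "y \<in> {..<c} \<rightarrow> carrier M" if "y \<in> {..<c} \<rightarrow> P k" for y k using that Pc by blast
    \<comment> \<open>Modulo IM the combination of the \<open>g i\<close> disappears, and the
      combination of the eps_i has depth s + T'.\<close>
    have deep: "u \<in> Nf (s + T' - q2)" if u: "u \<in> N" "u = M.dot c F y" and y: "y \<in> {..<c} \<rightarrow> P s" for u y s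
    proof (rule q2[OF u(1)])
      have "M.dot c g y \<in> Q (s + T')" using PM[OF y] IQ unfolding IM_dot by blast
      moreover have "M.dot c \<epsilon> y \<in> Q (s + T')" using epsdot[OF y] PQ by blast
      moreover have "s + T' - q2 + q2 = s + T'" by (simp add: T'_def)
      ultimately show "u \<in> Q (s + T' - q2 + q2)"
        using M.submodule_add[OF Qs] unfolding u(2) dotF[OF PM[OF y]] by simp
    qed
    have step: "\<exists>y''\<in>{..<c} \<rightarrow> P (s + Suc q3). h d \<odot>\<^bsub>M\<^esub> u = M.dot c F y''"
      if u: "u \<in> N" "u = M.dot c F y" and y: "y \<in> {..<c} \<rightarrow> P s" for u y s
    proof -
      note yM = PM[OF y]
      have gy: "M.dot c g y \<in> ?IM" unfolding IM_dot using yM by blast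
      have gyc: "M.dot c g y \<in> carrier M" "M.dot c \<epsilon> y \<in> carrier M"
        using M.dot_closed[OF gR yM] M.dot_closed[OF epsR yM] .
      have uP: "u \<in> P (s + T' - q2)" using deep[OF u y] NP by blast
      have "M.dot c g y \<in> P (s + T' - q2)"
      proof (rule M.submodule_mem_cancel[OF Ps gyc(1)])
        show "M.dot c \<epsilon> y \<in> P (s + T' - q2)" by (rule Panti[OF epsdot[OF y]]) simp
        show "M.dot c g y \<oplus>\<^bsub>M\<^esub> M.dot c \<epsilon> y \<in> P (s + T' - q2)"
          using uP unfolding u(2) dotF[OF yM] .
      qed
      moreover have "s + T' - q2 = s + p + Suc q3 + q1" by (simp add: T'_def)
      ultimately have "M.dot c g y \<in> P (s + p + Suc q3 + q1)" by simp
      from q1[OF gy this] obtain y' where y': "y' \<in> {..<c} \<rightarrow> P (s + p + Suc q3)" "M.dot c g y = M.dot c g y'" by blast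
      note y'M = PM[OF y'(1)]
      define w where "w i = y i \<ominus>\<^bsub>M\<^esub> y' i" for i
      have wM: "w \<in> {..<c} \<rightarrow> carrier M" unfolding w_def by (intro Pi_I M.M.minus_closed funcset_mem[OF yM] funcset_mem[OF y'M])
      have "M.dot c g w = \<zero>\<^bsub>M\<^esub>"
        unfolding w_def[abs_def] M.dot_minus[OF gR yM y'M] y'(2)[symmetric] using gyc by (simp add: M.M.minus_eq M.M.r_neg)
      from H1[OF wM this] obtain z0 where z0: "M.alternating c (carrier M) z0"
        "\<And>j. j < c \<Longrightarrow> h d \<odot>\<^bsub>M\<^esub> w j = M.dot c g (\<lambda>i. z0 i j)" by blast
      have hd: "h d \<in> carrier R" using d(1) by simp
      \<comment> \<open>The difference y - y' is only known to have depth \<open>s\<close>, because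
        \<open>y\<close> need not be any deeper. The further loss \<open>p\<close> in
        \<open>z\<close> is made up for by the factor eps, of depth T'.\<close>
      have "h d \<odot>\<^bsub>M\<^esub> w j \<in> P s" if "j < c" for j
      proof -
        have "y' j \<in> P s" using Panti[of "y' j" "s + p + Suc q3" s] y'(1) that by auto
        then show ?thesis
          unfolding w_def using y that by (intro M.submodule_smult[OF Ps hd] M.submodule_minus[OF Ps]) auto
      qed
      from p[OF z0 this] obtain z where z: "M.alternating c (P (s - p)) z"
        "\<And>j. j < c \<Longrightarrow> h d \<odot>\<^bsub>M\<^esub> w j = M.dot c g (\<lambda>i. z i j)" by blast
      have zc: "M.alternating c (carrier M) z" using z(1) Pc unfolding M.alternating_def by blast
      have zP: "(\<lambda>i. z i j) \<in> {..<c} \<rightarrow> P (s - p)" if "j < c" for j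
        using M.alternatingD(2)[OF z(1)] that by auto
      note zM = PM[OF zP]
      \<comment> \<open>The family \<open>z\<close> has the boundary d (y - y') with respect to
        \<open>g\<close>. With respect to F = g + eps its boundary exceeds this by eps z, and that
        F-boundary is annihilated when combined with \<open>F\<close> again. Hence d y may be
        replaced by d y' - eps z as the coefficients of d u.\<close>
      define y'' where "y'' j = h d \<odot>\<^bsub>M\<^esub> y' j \<ominus>\<^bsub>M\<^esub> M.dot c \<epsilon> (\<lambda>i. z i j)" for j
      have y''P: "y'' \<in> {..<c} \<rightarrow> P (s + Suc q3)"
      proof
        fix j assume "j \<in> {..<c}"
        then have j: "j < c" by simp
        have "h d \<odot>\<^bsub>M\<^esub> y' j \<in> P (s + Suc q3)"
          using M.submodule_smult[OF Ps hd Panti[of "y' j" "s + p + Suc q3" "s + Suc q3"]] y'(1) j by auto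
        moreover have "M.dot c \<epsilon> (\<lambda>i. z i j) \<in> P (s + Suc q3)"
          by (rule Panti[OF epsdot[OF zP[OF j]]]) (simp add: T'_def)
        ultimately show "y'' j \<in> P (s + Suc q3)" unfolding y''_def by (rule M.submodule_minus[OF Ps])
      qed
      note y''M = PM[OF y''P]
      have eq: "h d \<odot>\<^bsub>M\<^esub> y j = y'' j \<oplus>\<^bsub>M\<^esub> M.dot c F (\<lambda>i. z i j)" if j: "j < c" for j
      proof -
        have c: "y j \<in> carrier M" "y' j \<in> carrier M" using yM y'M j by auto
        let ?a = "h d \<odot>\<^bsub>M\<^esub> y' j" and ?b = "M.dot c \<epsilon> (\<lambda>i. z i j)" and ?g = "M.dot c g (\<lambda>i. z i j)"
        have ab: "?a \<in> carrier M" "?b \<in> carrier M" "?g \<in> carrier M"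
          using hd c M.dot_closed[OF epsR zM[OF j]] M.dot_closed[OF gR zM[OF j]] by auto
        have "h d \<odot>\<^bsub>M\<^esub> y j = ?a \<oplus>\<^bsub>M\<^esub> h d \<odot>\<^bsub>M\<^esub> w j"
          unfolding w_def using c hd M.minus_cancel(1)[of "h d \<odot>\<^bsub>M\<^esub> y j" ?a] by (simp add: M.smult_minus_distr)
        also have "\<dots> = ?a \<oplus>\<^bsub>M\<^esub> ?g" using z(2)[OF j] by simp
        also have "\<dots> = (?a \<ominus>\<^bsub>M\<^esub> ?b) \<oplus>\<^bsub>M\<^esub> (?b \<oplus>\<^bsub>M\<^esub> ?g)"
          using ab M.minus_cancel(2)[of ?a ?b] M.M.a_assoc[of "?a \<ominus>\<^bsub>M\<^esub> ?b" ?b ?g] by simp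
        also have "\<dots> = y'' j \<oplus>\<^bsub>M\<^esub> M.dot c F (\<lambda>i. z i j)"
          unfolding dotF[OF zM[OF j]] y''_def using ab M.M.a_comm[of ?b ?g] by simp
        finally show ?thesis .
      qed
      have Fz: "(\<lambda>j. M.dot c F (\<lambda>i. z i j)) \<in> {..<c} \<rightarrow> carrier M"
        using M.dot_closed[OF FR zM] by auto
      have "h d \<odot>\<^bsub>M\<^esub> u = M.dot c F (\<lambda>j. h d \<odot>\<^bsub>M\<^esub> y j)"
        unfolding u(2) by (rule M.dot_smult[OF FR yM hd, symmetric])
      also have "\<dots> = M.dot c F (\<lambda>j. y'' j \<oplus>\<^bsub>M\<^esub> M.dot c F (\<lambda>i. z i j))"
        by (rule M.dot_cong) (use eq FR y''M Fz in auto)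
      also have "\<dots> = M.dot c F y'' \<oplus>\<^bsub>M\<^esub> \<zero>\<^bsub>M\<^esub>"
        unfolding M.dot_add[OF FR y''M Fz] M.dot_alternating_zero[OF FR zc] ..
      also have "\<dots> = M.dot c F y''" using M.dot_closed[OF FR y''M] by simp
      finally show ?thesis using y''P by blast
    qed
    let ?D = "\<lambda>x. h d \<odot>\<^bsub>M\<^esub> x"
    have DN: "(?D ^^ j) x \<in> N" if "x \<in> N" for j x
      using that MA.submodule_smult[OF Ns d(1)] by (induction j) auto
    have base: "\<exists>y\<in>{..<c} \<rightarrow> P 0. v = M.dot c F y"
    proof -
      have "perturbed_ideal R c g \<epsilon> = Idl\<^bsub>R\<^esub> (F ` {..<c})" by (simp add: perturbed_ideal_def F_def)
      then show ?thesis
        using vb unfolding P0 M.dot_def by (auto simp: M.ideal_smult_genideal[OF finite_lessThan FR])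
    qed
    have iter: "\<exists>y\<in>{..<c} \<rightarrow> P (j * Suc q3). (?D ^^ j) v = M.dot c F y" for j
    proof (induction j)
      case (Suc j)
      then obtain y where "y \<in> {..<c} \<rightarrow> P (j * Suc q3)" "(?D ^^ j) v = M.dot c F y" by blast
      from step[OF DN[OF vN] this(2,1)] show ?case by (simp add: add_ac)
    qed (use base in simp)
    have cancel_d: "x \<in> Nf k" if "x \<in> N" "(?D ^^ j) x \<in> Nf (k + j * q3)" for j k x
      using that(2)
    proof (induction j)
      case (Suc j)
      then have "?D ((?D ^^ j) x) \<in> Nf (k + j * q3 + q3)" by (simp add: add_ac)
      from Suc.IH[OF q3[OF DN[OF that(1)] this]] show ?case .
    qed simp
    \<comment> \<open>After \<open>k\<close> rounds the depth is at least k (q3 + 1), and the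
      cancellation of d^k costs k q3. The surplus is the arbitrary number \<open>k\<close>.\<close>
    have "v \<in> Nf k" for k
    proof (rule cancel_d[OF vN])
      from iter[of k] obtain y where y: "y \<in> {..<c} \<rightarrow> P (k * Suc q3)" "(?D ^^ k) v = M.dot c F y" by blast
      have "(?D ^^ k) v \<in> Nf (k * Suc q3 + T' - q2)" by (rule deep[OF DN[OF vN] y(2,1)])
      moreover have "Nf (k * Suc q3 + T' - q2) \<subseteq> Nf (k + k * q3)"
        unfolding Nf_def by (rule MN.filt_antimono[OF mA]) (simp add: T'_def)
      ultimately show "(?D ^^ k) v \<in> Nf (k + k * q3)" by blast
    qed
    then show "v = \<zero>\<^bsub>M\<^esub>"
      using MA.krull_intersection[OF A.one_minus_unit A.is_ideal order_refl noethN, of v] by (simp add: Nf_def)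
  qed
qed

end

section \<open>Koszul homology and free reductions\<close>

context module
begin

text \<open>Signed coordinates z_ij over ordered pairs, in place of coordinates over two-element
  sets, absorb the signs of \<open>koszul_diff\<close>: the coordinate of the boundary at {j}
  becomes the plain sum of all g_i z_ij. The generators obtained are those that witness the
  annihilation.\<close>

lemma annihilates_koszul_H1_alternating:
  assumes ann: "annihilates_koszul_H1 R I M r" and r: "r \<in> carrier R"
  obtains c g where "minimal_ideal_generators R I c g"
    "\<And>y. \<lbrakk>y \<in> {..<c} \<rightarrow> carrier M; dot c g y = \<zero>\<^bsub>M\<^esub>\<rbrakk> \<Longrightarrow>
      \<exists>z. alternating c (carrier M) z \<and> (\<forall>j<c. r \<odot>\<^bsub>M\<^esub> y j = dot c g (\<lambda>i. z i j))"
proof -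
  from ann obtain c g where mg: "minimal_ideal_generators R I c g"
    and H: "\<And>x. x \<in> carrier (koszul_homology c g M 1) \<Longrightarrow>
      r \<odot>\<^bsub>koszul_homology c g M 1\<^esub> x = \<zero>\<^bsub>koszul_homology c g M 1\<^esub>"
    by (auto simp: annihilates_koszul_H1_def)
  have g: "g \<in> {..<c} \<rightarrow> carrier R"
    using mg by (auto simp: minimal_ideal_generators_def ideal_generators_def)
  have idx0: "koszul_index c 0 = {{}}"
    using finite_subset[OF _ finite_lessThan[of c]] by (auto simp: koszul_index_def)
  have idx1: "koszul_index c 1 = (\<lambda>j. {j}) ` {..<c}"
    by (auto simp: koszul_index_def card_1_singleton_iff)
  note idx1' = idx1[unfolded One_nat_def]
  show thesis
  proof (rule that[OF mg])
    fix y assume y: "y \<in> {..<c} \<rightarrow> carrier M" and dy: "dot c g y = \<zero>\<^bsub>M\<^esub>"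
    let ?Z = "koszul_cycles c g M 1" and ?B = "koszul_boundaries c g M 1"
    let ?K = "(koszul_module c M 1)\<lparr>carrier := ?Z\<rparr>"
    \<comment> \<open>The family \<open>y\<close> as an element of degree 1 of the Koszul complex,
      whose indices are singletons.\<close>
    define x where "x = (\<lambda>K\<in>koszul_index c 1. y (the_elem K))"
    have xj: "x {j} = y j" if "j < c" for j using that by (simp add: x_def idx1')
    have xc: "x \<in> koszul_index c 1 \<rightarrow>\<^sub>E carrier M"
      unfolding x_def restrict_PiE_iff idx1 using y by auto
    have "koszul_diff c g M 0 x = \<zero>\<^bsub>koszul_module c M 0\<^esub>"
    proof -
      have "(\<Oplus>\<^bsub>M\<^esub>i\<in>{..<c} - {}. if even (card {j \<in> {}. j < i}) then g i \<odot>\<^bsub>M\<^esub> x (insert i {})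
          else \<ominus>\<^bsub>M\<^esub> (g i \<odot>\<^bsub>M\<^esub> x (insert i {}))) = dot c g y"
        unfolding dot_def using xj y g by (intro M.finsum_cong') auto
      then show ?thesis
        using dy by (auto simp: koszul_diff_def koszul_module_def idx0 intro!: restrict_ext)
    qed
    then have xZ: "x \<in> ?Z"
      using xc by (simp add: koszul_cycles_def koszul_module_def)
    have zero_add: "(\<lambda>K\<in>koszul_index c 1. \<zero>\<^bsub>M\<^esub>) \<oplus>\<^bsub>?K\<^esub> w = w" if "w \<in> koszul_index c 1 \<rightarrow>\<^sub>E carrier M" for w
      by (rule PiE_ext[OF _ that])
        (use that in \<open>auto simp: koszul_module_def PiE_iff\<close>)
    have zB: "(\<lambda>K\<in>koszul_index c 1. \<zero>\<^bsub>M\<^esub>) \<in> ?B"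
      unfolding koszul_boundaries_def
    proof (rule image_eqI)
      show "(\<lambda>K\<in>koszul_index c (Suc 1). \<zero>\<^bsub>M\<^esub>) \<in> carrier (koszul_module c M (Suc 1))"
        by (simp add: koszul_module_def)
      show "(\<lambda>K\<in>koszul_index c 1. \<zero>\<^bsub>M\<^esub>) = koszul_diff c g M 1 (\<lambda>K\<in>koszul_index c (Suc 1). \<zero>\<^bsub>M\<^esub>)"
        unfolding koszul_diff_def
      proof (rule restrict_ext)
        fix J assume J: "J \<in> koszul_index c 1"
        show "\<zero>\<^bsub>M\<^esub> = (\<Oplus>\<^bsub>M\<^esub>i\<in>{..<c} - J.
            if even (card {j \<in> J. j < i}) then g i \<odot>\<^bsub>M\<^esub> (\<lambda>K\<in>koszul_index c (Suc 1). \<zero>\<^bsub>M\<^esub>) (insert i J)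
            else \<ominus>\<^bsub>M\<^esub> (g i \<odot>\<^bsub>M\<^esub> (\<lambda>K\<in>koszul_index c (Suc 1). \<zero>\<^bsub>M\<^esub>) (insert i J)))"
        proof (rule M.add.finprod_one_eqI[symmetric])
          fix i assume i: "i \<in> {..<c} - J"
          then have "insert i J \<in> koszul_index c (Suc 1)"
            using J by (auto simp: koszul_index_def card_1_singleton_iff)
          then show "(if even (card {j \<in> J. j < i}) then g i \<odot>\<^bsub>M\<^esub> (\<lambda>K\<in>koszul_index c (Suc 1). \<zero>\<^bsub>M\<^esub>) (insert i J)
              else \<ominus>\<^bsub>M\<^esub> (g i \<odot>\<^bsub>M\<^esub> (\<lambda>K\<in>koszul_index c (Suc 1). \<zero>\<^bsub>M\<^esub>) (insert i J))) = \<zero>\<^bsub>M\<^esub>"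
            using i g by (auto simp: Pi_iff minus_zero_eq)
        qed
      qed
    qed
    let ?X = "?B +>\<^bsub>?K\<^esub> x"
    have xX: "x \<in> ?X"
      unfolding a_r_coset_def' using zB zero_add[OF xc] by force
    have "?X \<in> carrier (koszul_homology c g M 1)"
      unfolding koszul_homology_def quotient_module_def A_RCOSETS_def' using xZ by auto
    \<comment> \<open>A scalar multiple of a class is a union over all representatives. Taking
      \<open>x\<close> itself as representative puts r x among the boundaries.\<close>
    from H[OF this] have U: "(\<Union>w\<in>?X. ?B +>\<^bsub>?K\<^esub> (r \<odot>\<^bsub>?K\<^esub> w)) = ?B"
      by (simp add: koszul_homology_def quotient_module_def)
    have rx: "r \<odot>\<^bsub>?K\<^esub> x = (\<lambda>K\<in>koszul_index c 1. r \<odot>\<^bsub>M\<^esub> x K)" by (simp add: koszul_module_def)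
    have rxc: "(\<lambda>K\<in>koszul_index c 1. r \<odot>\<^bsub>M\<^esub> x K) \<in> koszul_index c 1 \<rightarrow>\<^sub>E carrier M"
      unfolding restrict_PiE_iff using xc r by auto
    have "(\<lambda>K\<in>koszul_index c 1. r \<odot>\<^bsub>M\<^esub> x K) \<in> ?B +>\<^bsub>?K\<^esub> (r \<odot>\<^bsub>?K\<^esub> x)"
      unfolding a_r_coset_def' rx using zB zero_add[OF rxc] by force
    then have "(\<lambda>K\<in>koszul_index c 1. r \<odot>\<^bsub>M\<^esub> x K) \<in> ?B"
      using U xX by blast
    then obtain w where w: "w \<in> koszul_index c (Suc 1) \<rightarrow>\<^sub>E carrier M"
      "(\<lambda>K\<in>koszul_index c 1. r \<odot>\<^bsub>M\<^esub> x K) = koszul_diff c g M 1 w"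
      by (auto simp: koszul_boundaries_def koszul_module_def)
    have wc: "w {i, j} \<in> carrier M" if "i < c" "j < c" "i \<noteq> j" for i j
    proof -
      have "{i, j} \<in> koszul_index c (Suc 1)" using that by (simp add: koszul_index_def)
      then show ?thesis using w(1) by auto
    qed
    \<comment> \<open>The sign is the one that \<open>koszul_diff\<close> attaches to
      \<open>i\<close> at the index {j}: negative precisely when j < i.\<close>
    define z where "z i j = (if i = j then \<zero>\<^bsub>M\<^esub> else if j < i then \<ominus>\<^bsub>M\<^esub> w {i, j} else w {i, j})" for i j :: nat
    have zc: "z i j \<in> carrier M" if "i < c" "j < c" for i j
      using wc[OF that] by (simp add: z_def)
    have "alternating c (carrier M) z"
      unfolding alternating_def
    proof (intro allI impI conjI)
      fix i j assume ij: "i < c" "j < c"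
      show "z i j \<in> carrier M" by (rule zc[OF ij])
      show "z j i = \<ominus>\<^bsub>M\<^esub> z i j"
        using wc[OF ij] by (auto simp: z_def insert_commute minus_zero_eq)
    qed (simp add: z_def)
    moreover have "r \<odot>\<^bsub>M\<^esub> y j = dot c g (\<lambda>i. z i j)" if j: "j < c" for j
    proof -
      have gR: "g i \<in> carrier R" if "i < c" for i using g that by auto
      have "z j j = \<zero>\<^bsub>M\<^esub>" by (simp add: z_def)
      then have t: "(\<lambda>i. g i \<odot>\<^bsub>M\<^esub> z i j) \<in> {..<c} - {j} \<rightarrow> carrier M" "g j \<odot>\<^bsub>M\<^esub> z j j = \<zero>\<^bsub>M\<^esub>"
        using gR zc j by auto
      have jc: "{..<c} = insert j ({..<c} - {j})" using j by auto
      have "dot c g (\<lambda>i. z i j) = (\<Oplus>\<^bsub>M\<^esub>i\<in>insert j ({..<c} - {j}). g i \<odot>\<^bsub>M\<^esub> z i j)"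
        unfolding dot_def using jc by simp
      also have "\<dots> = (\<Oplus>\<^bsub>M\<^esub>i\<in>{..<c} - {j}. g i \<odot>\<^bsub>M\<^esub> z i j)"
        using t by (subst M.finsum_insert) auto
      also have "\<dots> = koszul_diff c g M 1 w {j}"
      proof -
        have "koszul_diff c g M 1 w {j} = (\<Oplus>\<^bsub>M\<^esub>i\<in>{..<c} - {j}.
            if even (card {k \<in> {j}. k < i}) then g i \<odot>\<^bsub>M\<^esub> w (insert i {j}) else \<ominus>\<^bsub>M\<^esub> (g i \<odot>\<^bsub>M\<^esub> w (insert i {j})))"
          unfolding koszul_diff_def using j by (simp add: idx1')
        also have "\<dots> = (\<Oplus>\<^bsub>M\<^esub>i\<in>{..<c} - {j}. g i \<odot>\<^bsub>M\<^esub> z i j)"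
        proof (rule M.finsum_cong'[OF refl t(1)])
          fix i assume i: "i \<in> {..<c} - {j}"
          have "{k \<in> {j}. k < i} = (if j < i then {j} else {})" by auto
          then show "(if even (card {k \<in> {j}. k < i}) then g i \<odot>\<^bsub>M\<^esub> w (insert i {j}) else \<ominus>\<^bsub>M\<^esub> (g i \<odot>\<^bsub>M\<^esub> w (insert i {j}))) =
              g i \<odot>\<^bsub>M\<^esub> z i j"
            using i gR[of i] wc[of i j] j by (simp add: z_def smult_r_minus)
        qed
        finally show ?thesis by simp
      qed
      also have "\<dots> = r \<odot>\<^bsub>M\<^esub> y j"
        using fun_cong[OF w(2), of "{j}"] j xj[OF j] by (simp add: idx1')
      finally show ?thesis by simp
    qed
    ultimately show "\<exists>z. alternating c (carrier M) z \<and> (\<forall>j<c. r \<odot>\<^bsub>M\<^esub> y j = dot c g (\<lambda>i. z i j))"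
      by blast
  qed
qed

section \<open>Free submodules spanned by a given family\<close>

lemma finsum_update_carrier:
  assumes W: "submodule W R M" and X: "finite X" "f \<in> X \<rightarrow> W"
  shows "finsum (M\<lparr>carrier := W\<rparr>) f X = finsum M f X"
proof -
  interpret W: module R "M\<lparr>carrier := W\<rparr>" by (rule submodule.submodule_is_module[OF W module_axioms])
  have "(\<lambda>x. x) (finsum (M\<lparr>carrier := W\<rparr>) f X) = finsum M (\<lambda>i. (\<lambda>x. x) (f i)) X"
    by (rule finsum_hom[OF W.M.abelian_monoid_axioms M.abelian_monoid_axioms])
      (use X submodule_carrier[OF W] in auto)
  then show ?thesis by simp
qed

lemma span_update_carrier:
  assumes W: "submodule W R M" and X: "X \<subseteq> W" "module_span R M X = W"
  shows "module_span R (M\<lparr>carrier := W\<rparr>) X = W"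
proof -
  interpret W: module R "M\<lparr>carrier := W\<rparr>" by (rule submodule.submodule_is_module[OF W module_axioms])
  have X': "X \<subseteq> carrier (M\<lparr>carrier := W\<rparr>)" using X by simp
  note s = W.span_submodule[OF X']
  have "submodule (module_span R (M\<lparr>carrier := W\<rparr>) X) R M"
    by (rule submoduleI')
      (use W.submodule_carrier[OF s] W.submodule_zero[OF s] W.submodule_add[OF s] W.submodule_smult[OF s]
        submodule_carrier[OF W] in auto)
  then have "W \<subseteq> module_span R (M\<lparr>carrier := W\<rparr>) X"
    using span_least[OF _ W.span_superset] X(2) by blast
  then show ?thesis using W.submoduleE(1)[OF s] by auto
qed

lemma free_of_rank_spanI:
  assumes v: "v \<in> {..<n} \<rightarrow> carrier M" and W: "W = module_span R M (v ` {..<n})"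
    and indep: "\<And>a i. \<lbrakk>a \<in> {..<n} \<rightarrow> carrier R; (\<Oplus>\<^bsub>M\<^esub>i\<in>{..<n}. a i \<odot>\<^bsub>M\<^esub> v i) = \<zero>\<^bsub>M\<^esub>; i < n\<rbrakk> \<Longrightarrow> a i = \<zero>"
  shows "free_of_rank R (M\<lparr>carrier := W\<rparr>) n"
proof -
  have vc: "v ` {..<n} \<subseteq> carrier M" using v by auto
  have Ws: "submodule W R M" unfolding W by (rule span_submodule[OF vc])
  have vW: "v i \<in> W" if "i < n" for i using that span_superset[of "v ` {..<n}"] by (auto simp: W)
  define S where "S a = (\<Oplus>\<^bsub>M\<^esub>i\<in>{..<n}. a i \<odot>\<^bsub>M\<^esub> v i)" for a
  have cl: "(\<lambda>i. a i \<odot>\<^bsub>M\<^esub> v i) \<in> {..<n} \<rightarrow> carrier M" if "a \<in> {..<n} \<rightarrow> carrier R" for a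
    using that v by auto
  \<comment> \<open>\<open>finsum\<close> depends on the carrier, so sums in the submodule have to
    be compared with sums in \<open>M\<close>.\<close>
  have eq: "(\<Oplus>\<^bsub>M\<lparr>carrier := W\<rparr>\<^esub>i\<in>{..<n}. a i \<odot>\<^bsub>M\<lparr>carrier := W\<rparr>\<^esub> v i) = S a" if "a \<in> {..<n} \<rightarrow> carrier R" for a
  proof -
    have "(\<lambda>i. a i \<odot>\<^bsub>M\<^esub> v i) \<in> {..<n} \<rightarrow> W"
      using that vW submodule_smult[OF Ws] by auto
    from finsum_update_carrier[OF Ws finite_lessThan this] show ?thesis by (simp add: S_def)
  qed
  have "bij_betw S ({..<n} \<rightarrow>\<^sub>E carrier R) W"
    unfolding bij_betw_def
  proof
    show "inj_on S ({..<n} \<rightarrow>\<^sub>E carrier R)"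
    proof (rule inj_onI)
      fix a b assume ab: "a \<in> {..<n} \<rightarrow>\<^sub>E carrier R" "b \<in> {..<n} \<rightarrow>\<^sub>E carrier R" "S a = S b"
      have aR: "a \<in> {..<n} \<rightarrow> carrier R" and bR: "b \<in> {..<n} \<rightarrow> carrier R" using ab(1,2) by auto
      have d: "(\<lambda>i. a i \<ominus> b i) \<in> {..<n} \<rightarrow> carrier R"
        by (intro Pi_I R.minus_closed funcset_mem[OF aR] funcset_mem[OF bR])
      have "S a = (\<Oplus>\<^bsub>M\<^esub>i\<in>{..<n}. (a i \<ominus> b i) \<odot>\<^bsub>M\<^esub> v i \<oplus>\<^bsub>M\<^esub> b i \<odot>\<^bsub>M\<^esub> v i)"
        unfolding S_def
      proof (rule M.finsum_cong')
        show "(\<lambda>i. (a i \<ominus> b i) \<odot>\<^bsub>M\<^esub> v i \<oplus>\<^bsub>M\<^esub> b i \<odot>\<^bsub>M\<^esub> v i) \<in> {..<n} \<rightarrow> carrier M"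
          using cl[OF d] cl[OF bR] by auto
        fix i assume "i \<in> {..<n}"
        then have c: "a i \<in> carrier R" "b i \<in> carrier R" "v i \<in> carrier M" using aR bR v by auto
        then have "(a i \<ominus> b i) \<oplus> b i = a i" by (simp add: R.minus_eq R.a_assoc R.l_neg)
        then show "a i \<odot>\<^bsub>M\<^esub> v i = (a i \<ominus> b i) \<odot>\<^bsub>M\<^esub> v i \<oplus>\<^bsub>M\<^esub> b i \<odot>\<^bsub>M\<^esub> v i"
          using c smult_l_distr[of "a i \<ominus> b i" "b i" "v i"] by simp
      qed simp
      then have "S a = S (\<lambda>i. a i \<ominus> b i) \<oplus>\<^bsub>M\<^esub> S b"
        unfolding S_def using M.finsum_addf[OF cl[OF d] cl[OF bR]] by simp
      moreover have "S (\<lambda>i. a i \<ominus> b i) \<in> carrier M" "S b \<in> carrier M"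
        unfolding S_def by (rule M.finsum_closed[OF cl[OF d]]) (rule M.finsum_closed[OF cl[OF bR]])
      ultimately have "S (\<lambda>i. a i \<ominus> b i) = \<zero>\<^bsub>M\<^esub>"
        using ab(3) minus_cancel(3)[of "S (\<lambda>i. a i \<ominus> b i)" "S b"] by (simp add: M.minus_eq M.r_neg)
      then have z: "a i \<ominus> b i = \<zero>" if "i < n" for i using indep[OF d _ that] by (simp add: S_def)
      then have e: "a i = b i" if "i < n" for i
      proof -
        have c: "a i \<in> carrier R" "b i \<in> carrier R" using that aR bR by auto
        have "(a i \<ominus> b i) \<oplus> b i = a i" using c by (simp add: R.minus_eq R.a_assoc R.l_neg)
        with z[OF that] c show ?thesis by simp
      qed
      show "a = b"
        by (rule PiE_ext[OF ab(1,2)]) (simp add: e)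
    qed
    show "S ` ({..<n} \<rightarrow>\<^sub>E carrier R) = W"
    proof
      show "S ` ({..<n} \<rightarrow>\<^sub>E carrier R) \<subseteq> W"
        unfolding S_def
      proof (rule image_subsetI)
        fix a assume "a \<in> {..<n} \<rightarrow>\<^sub>E carrier R"
        then show "(\<Oplus>\<^bsub>M\<^esub>i\<in>{..<n}. a i \<odot>\<^bsub>M\<^esub> v i) \<in> W"
          using vW by (intro submodule_finsum[OF Ws finite_lessThan] submodule_smult[OF Ws]) auto
      qed
      show "W \<subseteq> S ` ({..<n} \<rightarrow>\<^sub>E carrier R)"
      proof
        fix w assume "w \<in> W"
        then obtain a where a: "a \<in> {..<n} \<rightarrow> carrier R" "w = S a"
          unfolding W span_finite_family[OF finite_lessThan v] S_def by blast
        have "S (restrict a {..<n}) = S a"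
          unfolding S_def using cl[OF a(1)] by (intro M.finsum_cong') auto
        moreover have "restrict a {..<n} \<in> {..<n} \<rightarrow>\<^sub>E carrier R"
          unfolding restrict_PiE_iff using a(1) by auto
        ultimately show "w \<in> S ` ({..<n} \<rightarrow>\<^sub>E carrier R)" using a(2) by (metis imageI)
      qed
    qed
  qed
  moreover have "bij_betw (\<lambda>a. \<Oplus>\<^bsub>M\<lparr>carrier := W\<rparr>\<^esub>i\<in>{..<n}. a i \<odot>\<^bsub>M\<lparr>carrier := W\<rparr>\<^esub> v i) ({..<n} \<rightarrow>\<^sub>E carrier R) W
      \<longleftrightarrow> bij_betw S ({..<n} \<rightarrow>\<^sub>E carrier R) W"
    by (rule bij_betw_cong, rule eq) (simp add: PiE_def)
  ultimately show ?thesis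
    unfolding free_of_rank_def using vW by (intro bexI[of _ v]) auto
qed

end

text \<open>The converse of \<open>free_of_rank_spanI\<close>. Freeness only supplies some basis of
  the span; \<open>free_of_rank_basis\<close> passes the independence on to the given
  \<open>n\<close> generators.\<close>

lemma (in noeth_module) free_of_rank_spanD:
  assumes v: "v \<in> {..<n} \<rightarrow> carrier M" and W: "W = module_span R M (v ` {..<n})"
    and free: "free_of_rank R (M\<lparr>carrier := W\<rparr>) n"
    and a: "a \<in> {..<n} \<rightarrow> carrier R" "(\<Oplus>\<^bsub>M\<^esub>i\<in>{..<n}. a i \<odot>\<^bsub>M\<^esub> v i) = \<zero>\<^bsub>M\<^esub>" and i: "i < n"
  shows "a i = \<zero>"
proof -
  have vc: "v ` {..<n} \<subseteq> carrier M" using v by auto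
  have Ws: "submodule W R M" unfolding W by (rule span_submodule[OF vc])
  have vW: "v ` {..<n} \<subseteq> W" using span_superset[of "v ` {..<n}"] by (auto simp: W)
  interpret V: noeth_module R "M\<lparr>carrier := W\<rparr>"
    by (rule noeth_module.intro[OF submodule.submodule_is_module[OF Ws module_axioms] noetherian_ring_axioms])
  have sp: "module_span R (M\<lparr>carrier := W\<rparr>) (v ` {..<n}) = W"
    by (rule span_update_carrier[OF Ws vW W[symmetric]])
  have fg: "fin_gen_module R (M\<lparr>carrier := W\<rparr>)"
    unfolding fin_gen_module_def using vW sp V.module_axioms by (intro conjI exI[of _ "v ` {..<n}"]) auto
  have "(\<lambda>i. a i \<odot>\<^bsub>M\<^esub> v i) \<in> {..<n} \<rightarrow> W"
    using a(1) vW submodule_smult[OF Ws] by auto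
  from finsum_update_carrier[OF Ws finite_lessThan this]
  have "(\<Oplus>\<^bsub>M\<lparr>carrier := W\<rparr>\<^esub>i\<in>{..<n}. a i \<odot>\<^bsub>M\<lparr>carrier := W\<rparr>\<^esub> v i) = \<zero>\<^bsub>M\<lparr>carrier := W\<rparr>\<^esub>"
    using a(2) by simp
  from V.free_of_rank_basis[OF V.fin_gen_noeth[OF fg] free _ _ a(1) this i] show ?thesis
    using vW sp by auto
qed

section \<open>Freeness of the image of N modulo the perturbed ideal\<close>

context local_extension_module
begin

lemma reduction_span_image:
  assumes J: "J \<subseteq> carrier R" and m: "m \<in> {..<n} \<rightarrow> carrier M" and N: "N = module_span A MA (m ` {..<n})"
  shows "reduction_map R M J ` N = module_span A (reduction h R M J) ((\<lambda>i. reduction_map R M J (m i)) ` {..<n})"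
proof -
  interpret Q: module_surjection A MA "reduction h R M J" "reduction_map R M J"
    by (rule reduction_surjection[OF J])
  have "m ` {..<n} \<subseteq> carrier MA" using m by auto
  from Q.span_image[OF this] show ?thesis by (simp add: N image_image)
qed

lemma reduction_lincomb_zero_iff:
  assumes J: "J \<subseteq> carrier R" and m: "m \<in> {..<n::nat} \<rightarrow> carrier M" and a: "a \<in> {..<n} \<rightarrow> carrier A"
  shows "(\<Oplus>\<^bsub>reduction h R M J\<^esub>i\<in>{..<n}. a i \<odot>\<^bsub>reduction h R M J\<^esub> reduction_map R M J (m i)) = \<zero>\<^bsub>reduction h R M J\<^esub> \<longleftrightarrow>
    (\<Oplus>\<^bsub>M\<^esub>i\<in>{..<n}. h (a i) \<odot>\<^bsub>M\<^esub> m i) \<in> ideal_smult R J M"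
proof -
  interpret Q: module_surjection A MA "reduction h R M J" "reduction_map R M J"
    by (rule reduction_surjection[OF J])
  have cl: "(\<lambda>i. h (a i) \<odot>\<^bsub>M\<^esub> m i) \<in> {..<n} \<rightarrow> carrier M" using a m by auto
  have "reduction_map R M J (finsum MA (\<lambda>i. h (a i) \<odot>\<^bsub>M\<^esub> m i) {..<n}) =
      finsum (reduction h R M J) (\<lambda>i. reduction_map R M J (h (a i) \<odot>\<^bsub>M\<^esub> m i)) {..<n}"
    using cl by (intro Q.map_finsum) auto
  also have "\<dots> = (\<Oplus>\<^bsub>reduction h R M J\<^esub>i\<in>{..<n}. a i \<odot>\<^bsub>reduction h R M J\<^esub> reduction_map R M J (m i))"
  proof (rule Q.Q.M.finsum_cong')
    show "(\<lambda>i. a i \<odot>\<^bsub>reduction h R M J\<^esub> reduction_map R M J (m i)) \<in> {..<n} \<rightarrow> carrier (reduction h R M J)"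
      using a m Q.map_closed by auto
    fix i assume "i \<in> {..<n}"
    then show "reduction_map R M J (h (a i) \<odot>\<^bsub>M\<^esub> m i) = a i \<odot>\<^bsub>reduction h R M J\<^esub> reduction_map R M J (m i)"
      using Q.map_smult[of "a i" "m i"] a m by auto
  qed simp
  finally show ?thesis
    using reduction_kernel[OF J M.M.finsum_closed[OF cl]] by simp
qed

text \<open>Because \<open>N\<close> meets bM only in 0, a relation among the \<open>m i\<close>
  modulo bM is a relation in \<open>M\<close>, hence also one modulo IM, where the
  \<open>m i\<close> are independent. Each perturbation of \<open>f\<close> is first rewritten as
  one of the fixed \<open>g\<close> with the same exponent, so \<open>T\<close> does not depend on
  \<open>f\<close>.\<close>

theorem perturbed_free_of_rank:
  assumes I: "ideal I R" and fin: "module_finite A (\<lambda>a. I +>\<^bsub>R\<^esub> h a) (R Quot I)"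
    and d: "d \<in> carrier A" "nonzerodivisor_on (self_module A) d"
    and ann: "annihilates_koszul_H1 R I M (h d)"
    and m: "m \<in> {..<n} \<rightarrow> carrier M" and N: "N = module_span A MA (m ` {..<n})"
    and free: "free_of_rank A ((reduction h R M I)\<lparr>carrier := reduction_map R M I ` N\<rparr>) n"
  shows "\<exists>T. \<forall>c f \<epsilon>. minimal_ideal_generators R I c f \<and> \<epsilon> \<in> {..<c} \<rightarrow> ideal_power R \<mm>R T \<longrightarrow>
    free_of_rank A ((reduction h R M (perturbed_ideal R c f \<epsilon>))
      \<lparr>carrier := reduction_map R M (perturbed_ideal R c f \<epsilon>) ` N\<rparr>) n"
proof -
  have IR: "I \<subseteq> carrier R" using ideal.Icarr[OF I] by auto
  have hd: "h d \<in> carrier R" using d(1) by simp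
  obtain c' g where g: "minimal_ideal_generators R I c' g"
    and H1: "\<And>y. \<lbrakk>y \<in> {..<c'} \<rightarrow> carrier M; M.dot c' g y = \<zero>\<^bsub>M\<^esub>\<rbrakk> \<Longrightarrow>
      \<exists>z. M.alternating c' (carrier M) z \<and> (\<forall>j<c'. h d \<odot>\<^bsub>M\<^esub> y j = M.dot c' g (\<lambda>i. z i j))"
    by (rule M.annihilates_koszul_H1_alternating[OF ann hd]) blast
  have g': "ideal_generators R I c' g" using g by (simp add: minimal_ideal_generators_def)
  have mMA: "m ` {..<n} \<subseteq> carrier MA" using m by auto
  have indep: "a i = \<zero>\<^bsub>A\<^esub>"
    if a: "a \<in> {..<n} \<rightarrow> carrier A" "(\<Oplus>\<^bsub>M\<^esub>i\<in>{..<n}. h (a i) \<odot>\<^bsub>M\<^esub> m i) \<in> ideal_smult R I M" and i: "i < n" for a i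
  proof -
    interpret Q: module_surjection A MA "reduction h R M I" "reduction_map R M I"
      by (rule reduction_surjection[OF IR])
    interpret QN: noeth_module A "reduction h R M I"
      by (rule noeth_module.intro[OF Q.target_module A.noetherian_ring_axioms])
    show ?thesis
      by (rule QN.free_of_rank_spanD[OF _ reduction_span_image[OF IR m N] free a(1) _ i])
        (use m Q.map_closed reduction_lincomb_zero_iff[OF IR m a(1)] a(2) in auto)
  qed
  obtain T where T: "\<And>\<epsilon> v. \<lbrakk>\<epsilon> \<in> {..<c'} \<rightarrow> ideal_power R \<mm>R T; v \<in> N;
      v \<in> ideal_smult R (perturbed_ideal R c' g \<epsilon>) M\<rbrakk> \<Longrightarrow> v = \<zero>\<^bsub>M\<^esub>"
    by (rule perturbed_span_inter_zero[OF I fin g' d _ m N]) (erule (1) H1 | rule indep, assumption+ | blast)+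
  show ?thesis
  proof (intro exI[of _ T] allI impI, elim conjE)
    fix c f \<epsilon> assume f: "minimal_ideal_generators R I c f" and \<epsilon>: "\<epsilon> \<in> {..<c} \<rightarrow> ideal_power R \<mm>R T"
    let ?b = "perturbed_ideal R c f \<epsilon>"
    obtain \<epsilon>' where \<epsilon>': "\<epsilon>' \<in> {..<c'} \<rightarrow> ideal_power R \<mm>R T" "?b = perturbed_ideal R c' g \<epsilon>'"
      by (rule R.perturbed_ideal_change_generators[OF f g' \<epsilon> R.ideal_power_ideal[OF R.is_ideal]])
    have fR: "f i \<in> carrier R" "\<epsilon> i \<in> carrier R" if "i < c" for i
      using f \<epsilon> that ideal.Icarr[OF R.ideal_power_ideal[OF R.is_ideal]]
      by (auto simp: minimal_ideal_generators_def ideal_generators_def)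
    have "ideal ?b R"
      unfolding perturbed_ideal_def by (rule R.genideal_ideal) (use fR in auto)
    then have bR: "?b \<subseteq> carrier R" using ideal.Icarr by auto
    interpret Q: module_surjection A MA "reduction h R M ?b" "reduction_map R M ?b"
      by (rule reduction_surjection[OF bR])
    show "free_of_rank A ((reduction h R M ?b)\<lparr>carrier := reduction_map R M ?b ` N\<rparr>) n"
    proof (rule Q.Q.free_of_rank_spanI[OF _ reduction_span_image[OF bR m N]])
      show "(\<lambda>i. reduction_map R M ?b (m i)) \<in> {..<n} \<rightarrow> carrier (reduction h R M ?b)"
        using m Q.map_closed by auto
      fix a i
      assume a: "a \<in> {..<n} \<rightarrow> carrier A" and i: "i < n"
        and 0: "(\<Oplus>\<^bsub>reduction h R M ?b\<^esub>i\<in>{..<n}. a i \<odot>\<^bsub>reduction h R M ?b\<^esub> reduction_map R M ?b (m i)) =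
          \<zero>\<^bsub>reduction h R M ?b\<^esub>"
      let ?v = "\<Oplus>\<^bsub>M\<^esub>i\<in>{..<n}. h (a i) \<odot>\<^bsub>M\<^esub> m i"
      have "?v \<in> ideal_smult R ?b M" using 0 reduction_lincomb_zero_iff[OF bR m a] by simp
      moreover have "?v \<in> N"
        unfolding N using MA.span_finite_family[OF finite_lessThan, of m n] m a by auto
      ultimately have "?v = \<zero>\<^bsub>M\<^esub>" using T[OF \<epsilon>'(1)] \<epsilon>'(2) by simp
      then show "a i = \<zero>\<^bsub>A\<^esub>"
        using indep[OF a _ i] M.submodule_zero[OF M.ideal_smult_submodule[OF IR]] by simp
    qed
  qed
qed

end

theorem theoremC:
  fixes A :: "'a ring" and R :: "'r ring" and h :: "'a \<Rightarrow> 'r"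
    and \<mm>A :: "'a set" and \<mm>R I :: "'r set"
  assumes "complete_noetherian_local_ring A \<mm>A"
    and "complete_noetherian_local_ring R \<mm>R"
    and "ideal I R"
    and "h \<in> ring_hom A R" and "inj_on h (carrier A)" and "h ` \<mm>A \<subseteq> \<mm>R"
    and "inj_on (\<lambda>a. I +>\<^bsub>R\<^esub> h a) (carrier A)"
    and "module_finite A (\<lambda>a. I +>\<^bsub>R\<^esub> h a) (R Quot I)"
  shows
    "(\<forall>T. ideal_power R \<mm>R T \<subseteq> ideal_prod R \<mm>R (I <+>\<^bsub>R\<^esub> Idl\<^bsub>R\<^esub> (h ` \<mm>A)) \<longrightarrow>
       (\<forall>c f \<epsilon> \<bb>. ideal_generators R I c f \<and> \<epsilon> \<in> {..<c} \<rightarrow> ideal_power R \<mm>R T \<and>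
          \<bb> = perturbed_ideal R c f \<epsilon> \<longrightarrow>
          module_finite A (\<lambda>a. \<bb> +>\<^bsub>R\<^esub> h a) (R Quot \<bb>) \<and>
          (\<forall>(M :: ('r, 'm) module) \<mu> m.
             fin_gen_module R M \<and>
             \<mu> = min_num_generators A (reduction h R M I) \<and>
             m \<in> {..<\<mu>} \<rightarrow> carrier M \<and>
             minimal_generating_family A (reduction h R M I) \<mu> (\<lambda>i. reduction_map R M I (m i)) \<longrightarrow>
             minimal_generating_family A (reduction h R M \<bb>) \<mu> (\<lambda>i. reduction_map R M \<bb> (m i)))))
     \<and>
     (depth A \<mm>A (self_module A) \<ge> 1 \<longrightarrow>
       (\<forall>(M :: ('r, 'm) module) n N.
          fin_gen_module R M \<and>
          (\<exists>d\<in>carrier A. nonzerodivisor_on (self_module A) d \<and> annihilates_koszul_H1 R I M (h d)) \<and>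
          (\<exists>m \<in> {..<n} \<rightarrow> carrier M. N = module_span A (restrict_scalars h M) (m ` {..<n})) \<and>
          free_of_rank A ((reduction h R M I)\<lparr>carrier := reduction_map R M I ` N\<rparr>) n \<longrightarrow>
          (\<exists>T. \<forall>c f \<epsilon>. minimal_ideal_generators R I c f \<and>
             \<epsilon> \<in> {..<c} \<rightarrow> ideal_power R \<mm>R T \<longrightarrow>
             (let \<bb> = perturbed_ideal R c f \<epsilon> in
              free_of_rank A ((reduction h R M \<bb>)\<lparr>carrier := reduction_map R M \<bb> ` N\<rparr>) n))))"
proof -
  interpret L: local_extension A \<mm>A R \<mm>R h
    by (intro local_extension.intro local_extension_axioms.intro assms)
  have loc: "local_extension_module A \<mm>A R \<mm>R h M" if "fin_gen_module R M" for M :: "('r, 'm) module"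
    by (intro local_extension_module.intro local_extension_module_axioms.intro L.local_extension_axioms that)
  show ?thesis
  proof (intro conjI allI impI)
    fix T c f \<epsilon> \<bb>
    assume T: "ideal_power R \<mm>R T \<subseteq> ideal_prod R \<mm>R (I <+>\<^bsub>R\<^esub> Idl\<^bsub>R\<^esub> (h ` \<mm>A))"
      and *: "ideal_generators R I c f \<and> \<epsilon> \<in> {..<c} \<rightarrow> ideal_power R \<mm>R T \<and> \<bb> = perturbed_ideal R c f \<epsilon>"
    \<comment> \<open>The condition on \<open>T\<close> enters in this form: every eps_i lies in m_R
      (I + m_A R).\<close>
    then have \<epsilon>: "\<epsilon> \<in> {..<c} \<rightarrow> ideal_prod R \<mm>R (I <+>\<^bsub>R\<^esub> Idl\<^bsub>R\<^esub> (h ` \<mm>A))" by blast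
    show "module_finite A (\<lambda>a. \<bb> +>\<^bsub>R\<^esub> h a) (R Quot \<bb>)"
      using L.perturbed_module_finite[OF assms(3) _ \<epsilon> assms(8)] * by blast
    fix M :: "('r, 'm) module" and \<mu> m
    assume M: "fin_gen_module R M \<and> \<mu> = min_num_generators A (reduction h R M I) \<and> m \<in> {..<\<mu>} \<rightarrow> carrier M \<and>
      minimal_generating_family A (reduction h R M I) \<mu> (\<lambda>i. reduction_map R M I (m i))"
    then show "minimal_generating_family A (reduction h R M \<bb>) \<mu> (\<lambda>i. reduction_map R M \<bb> (m i))"
      using local_extension_module.perturbed_minimal_generators[OF loc assms(3) _ \<epsilon>] * by blast
  next
    fix M :: "('r, 'm) module" and n N
    assume *: "fin_gen_module R M \<and>
      (\<exists>d\<in>carrier A. nonzerodivisor_on (self_module A) d \<and> annihilates_koszul_H1 R I M (h d)) \<and>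
      (\<exists>m \<in> {..<n} \<rightarrow> carrier M. N = module_span A (restrict_scalars h M) (m ` {..<n})) \<and>
      free_of_rank A ((reduction h R M I)\<lparr>carrier := reduction_map R M I ` N\<rparr>) n"
    then obtain d m where dm: "d \<in> carrier A" "nonzerodivisor_on (self_module A) d" "annihilates_koszul_H1 R I M (h d)"
      "m \<in> {..<n} \<rightarrow> carrier M" "N = module_span A (restrict_scalars h M) (m ` {..<n})" by blast
    show "\<exists>T. \<forall>c f \<epsilon>. minimal_ideal_generators R I c f \<and> \<epsilon> \<in> {..<c} \<rightarrow> ideal_power R \<mm>R T \<longrightarrow>
        (let \<bb> = perturbed_ideal R c f \<epsilon> in
         free_of_rank A ((reduction h R M \<bb>)\<lparr>carrier := reduction_map R M \<bb> ` N\<rparr>) n)"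
      unfolding Let_def
      using local_extension_module.perturbed_free_of_rank[OF loc assms(3,8) dm] * by blast
  qed
qed

end
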